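(* Assume that one of the following conditions is satisfied: (i) the law of $\omega_1$ has bounded support; (ii) the law of $\omega_1$ has a density $d(\cdot)$ with respect to Lebesgue measure on $\mathbb R$ and there exists $R$ such that for all $x\in\mathbb R$ $$\int_{\mathbb R}d(x+y)\log\left(\frac{d(x+y)}{d(y)}\right)\mathrm dy\le Rx^2 .$$ Then for any $\gamma>1/2$ and any $\beta>0$, $$\mathbf P_N^{\beta,h_c(\beta),\omega}\big(|\tau\cap[0,N]|>N^\gamma\big)\longrightarrow 0\quad\text{as }N\to\infty,\ \text{in }\mathbb P\text{-probability}.$$
   Context: Renewal process. Under the law $\mathbf P$ (expectation $\mathbf E$), $\tau=(\tau_n)_{n\ge 0}$ is a renewal sequence: $\tau_0=0$ and the increments $\tau_{n+1}-\tau_n$ (conditioned on $\tau_n<\infty$) are i.i.d. with values in $\{1,2,\dots\}\cup\{\infty\}$; $\tau$ may contain only finitely many finite terms (i.e. $\sum_{n\ge1}\mathbf P(\tau_1=n)\le 1$). $\tau$ is also viewed as the random subset $\{\tau_k:\tau_k<\infty\}$ of $\{0,1,2,\dots\}$. Throughout, $\mathbf P(\tau_1=n)=L(n)/n^{1+\alpha}$ for all integers $n\ge1$, where $\alpha>0$ and $L:(0,\infty)\to(0,\infty)$ is slowly varying, i.e. measurable with $\lim_{x\to\infty}L(xu)/L(x)=1$ for all $u>0$. Environment. $\omega=(\omega_n)_{n\ge1}$ is a sequence of i.i.d. real random variables (law $\mathbb P$, expectation $\mathbb E$), independent of $\tau$, with mean $0$, variance $1$ and exponential moments: $\lambda(\beta):=\log\mathbb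 E[\exp(\beta\omega_1)]<\infty$ for all $\beta\ge 0$. Model. For $\beta\ge0$, $h\in\mathbb R$, $N\ge1$, the pinning measure $\mathbf P_N^{\beta,h,\omega}$ on $\tau$ is defined by $$\frac{\mathrm d\mathbf P_N^{\beta,h,\omega}}{\mathrm d\mathbf P}(\tau):=\frac1{Z_N^{\beta,h,\omega}}\exp\Big(\sum_{n=1}^N(h+\beta\omega_n)\mathbf 1_{\{n\in\tau\}}\Big),\qquad Z_N^{\beta,h,\omega}:=\mathbf E\Big[\exp\Big(\sum_{n=1}^N(h+\beta\omega_n)\mathbf 1_{\{n\in\tau\}}\Big)\Big].$$ The quenched free energy is $\mathrm f^q(\beta,h):=\lim_{N\to\infty}\frac1N\mathbb E\log Z_N^{\beta,h,\omega}=\lim_{N\to\infty}\frac1N\log Z_N^{\beta,h,\omega}$ (the limits exist, the second one $\mathbb P$-a.s.). It is non-negative, and convex and non-decreasing in $h$. The quenched critical point is $h_c(\beta):=\inf\{h:\mathrm f^q(\beta,h)>0\}$. *)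

theory Defs
  imports "HOL-Probability.Probability"
begin

definition slowly_varying :: "(real \<Rightarrow> real) \<Rightarrow> bool" where
  "slowly_varying L \<longleftrightarrow>
     L \<in> borel_measurable (restrict_space borel {0<..}) \<and>
     (\<forall>x>0. L x > 0) \<and>
     (\<forall>u>0. ((\<lambda>x. L (x * u) / L x) \<longlongrightarrow> 1) at_top)"

text \<open>
  Once the sequence has reached \<open>\<infinity>\<close> it stays there. The last assumption says that, given the past
  and \<open>\<tau>\<^sub>k < \<infinity>\<close>, the increment \<open>\<tau>\<^sub>k\<^sub>+\<^sub>1 - \<tau>\<^sub>k\<close> has the law of \<open>\<tau>\<^sub>1\<close> on \<open>{1, 2, \<dots>} \<union> {\<infinity>}\<close>; note that
  \<open>t i\<close> is a natural number, so only finite pasts are conditioned on, while \<open>j\<close> may be \<open>\<infinity>\<close>.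
\<close>

locale renewal_process = prob_space P
  for P :: "'a measure" and \<tau> :: "nat \<Rightarrow> 'a \<Rightarrow> enat" +
  assumes tau_measurable: "\<And>k. \<tau> k \<in> measurable P (count_space UNIV)"
    and tau_0: "AE x in P. \<tau> 0 x = 0"
    and tau_increasing:
      "AE x in P. \<forall>k. if \<tau> k x = \<infinity> then \<tau> (Suc k) x = \<infinity> else \<tau> k x < \<tau> (Suc k) x"
    and tau_increments: "\<And>k (t :: nat \<Rightarrow> nat) (j :: enat).
      prob {x \<in> space P. (\<forall>i\<le>k. \<tau> i x = enat (t i)) \<and> \<tau> (Suc k) x = enat (t k) + j} =
      prob {x \<in> space P. \<forall>i\<le>k. \<tau> i x = enat (t i)} * prob {x \<in> space P. \<tau> 1 x = j}"

definition has_regular_tail ::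
    "'a measure \<Rightarrow> (nat \<Rightarrow> 'a \<Rightarrow> enat) \<Rightarrow> (real \<Rightarrow> real) \<Rightarrow> real \<Rightarrow> bool" where
  "has_regular_tail P \<tau> L \<alpha> \<longleftrightarrow>
     (\<forall>n\<ge>1. measure P {x \<in> space P. \<tau> 1 x = enat n} = L (real n) / real n powr (1 + \<alpha>))"

text \<open>Only the variables \<open>\<omega> n\<close> with \<open>n \<ge> 1\<close> matter; \<open>\<omega> 0\<close> is never used.\<close>

locale random_environment = prob_space Q
  for Q :: "'b measure" and \<omega> :: "nat \<Rightarrow> 'b \<Rightarrow> real" +
  assumes omega_indep: "indep_vars (\<lambda>_. borel) \<omega> {1..}"
    and omega_ident: "\<And>n. n \<ge> 1 \<Longrightarrow> distr Q borel (\<omega> n) = distr Q borel (\<omega> 1)"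
    and omega_integrable: "integrable Q (\<omega> 1)" "integrable Q (\<lambda>w. (\<omega> 1 w)\<^sup>2)"
    and omega_mean: "expectation (\<omega> 1) = 0"
    and omega_variance: "variance (\<omega> 1) = 1"
    and omega_exp_moments: "\<And>b. b \<ge> 0 \<Longrightarrow> integrable Q (\<lambda>w. exp (b * \<omega> 1 w))"

definition renewal_set :: "(nat \<Rightarrow> 'a \<Rightarrow> enat) \<Rightarrow> 'a \<Rightarrow> nat set" where
  "renewal_set \<tau> x = {n. \<exists>k. \<tau> k x = enat n}"

text \<open>
  In the definitions below \<open>v\<close> is a realisation of the environment, i.e.\ \<open>v n = \<omega> n w\<close>. The renewal
  and the environment live on separate probability spaces \<open>P\<close> and \<open>Q\<close>, which encodes their
  independence.
\<close>

definition boltzmann_weight ::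
    "(nat \<Rightarrow> 'a \<Rightarrow> enat) \<Rightarrow> real \<Rightarrow> real \<Rightarrow> (nat \<Rightarrow> real) \<Rightarrow> nat \<Rightarrow> 'a \<Rightarrow> real" where
  "boltzmann_weight \<tau> \<beta> h v N x =
     exp (\<Sum>n=1..N. (h + \<beta> * v n) * indicator (renewal_set \<tau> x) n)"

definition partition_function ::
    "'a measure \<Rightarrow> (nat \<Rightarrow> 'a \<Rightarrow> enat) \<Rightarrow> real \<Rightarrow> real \<Rightarrow> (nat \<Rightarrow> real) \<Rightarrow> nat \<Rightarrow> real" where
  "partition_function P \<tau> \<beta> h v N = (\<integral>x. boltzmann_weight \<tau> \<beta> h v N x \<partial>P)"

definition pinning_measure ::
    "'a measure \<Rightarrow> (nat \<Rightarrow> 'a \<Rightarrow> enat) \<Rightarrow> real \<Rightarrow> real \<Rightarrow> (nat \<Rightarrow> real) \<Rightarrow> nat \<Rightarrow> 'a measure" where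
  "pinning_measure P \<tau> \<beta> h v N =
     density P (\<lambda>x. ennreal (boltzmann_weight \<tau> \<beta> h v N x / partition_function P \<tau> \<beta> h v N))"

definition free_energy ::
    "'a measure \<Rightarrow> (nat \<Rightarrow> 'a \<Rightarrow> enat) \<Rightarrow> 'b measure \<Rightarrow> (nat \<Rightarrow> 'b \<Rightarrow> real) \<Rightarrow> real \<Rightarrow> real \<Rightarrow> real" where
  "free_energy P \<tau> Q \<omega> \<beta> h =
     lim (\<lambda>N. (1 / real N) * (\<integral>w. ln (partition_function P \<tau> \<beta> h (\<lambda>n. \<omega> n w) N) \<partial>Q))"

definition critical_point ::
    "'a measure \<Rightarrow> (nat \<Rightarrow> 'a \<Rightarrow> enat) \<Rightarrow> 'b measure \<Rightarrow> (nat \<Rightarrow> 'b \<Rightarrow> real) \<Rightarrow> real \<Rightarrow> real" where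
  "critical_point P \<tau> Q \<omega> \<beta> = Inf {h. free_energy P \<tau> Q \<omega> \<beta> h > 0}"

definition law_support :: "real measure \<Rightarrow> real set" where
  "law_support \<mu> = {x. \<forall>U. open U \<longrightarrow> x \<in> U \<longrightarrow> emeasure \<mu> U > 0}"

text \<open>
  The integrand \<open>a log (a / b)\<close> takes values in \<open>(-\<infinity>, \<infinity>]\<close>, with the usual conventions
  \<open>0 log (0 / b) = 0\<close> and \<open>a log (a / 0) = \<infinity>\<close> for \<open>a > 0\<close>. A real-valued rendering would be wrong
  here, since \<open>ln (a / 0) = 0\<close> in HOL and non-integrable functions have integral \<open>0\<close>.
\<close>

definition entropy_integrand :: "real \<Rightarrow> real \<Rightarrow> ereal" where
  "entropy_integrand a b =
     (if a = 0 then 0 else if b = 0 then \<infinity> else ereal (a * ln (a / b)))"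

text \<open>
  The extended Lebesgue integral. For the entropy integrand of two probability densities the
  negative part is integrable, because \<open>a log (a / b) \<ge> a - b\<close>, so \<open>\<infinity> - \<infinity>\<close> does not arise.
\<close>

definition extended_integral :: "'c measure \<Rightarrow> ('c \<Rightarrow> ereal) \<Rightarrow> ereal" where
  "extended_integral M f =
     enn2ereal (\<integral>\<^sup>+y. e2ennreal (f y) \<partial>M) - enn2ereal (\<integral>\<^sup>+y. e2ennreal (- f y) \<partial>M)"

definition smooth_density_condition :: "'b measure \<Rightarrow> ('b \<Rightarrow> real) \<Rightarrow> bool" where
  "smooth_density_condition Q X \<longleftrightarrow>
     (\<exists>d :: real \<Rightarrow> real. (\<forall>x. d x \<ge> 0) \<and> distributed Q lborel X (\<lambda>x. ennreal (d x)) \<and>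
       (\<exists>R :: real. \<forall>x.
          extended_integral lborel (\<lambda>y. entropy_integrand (d (x + y)) (d y)) \<le> ereal (R * x\<^sup>2)))"

definition tendsto_in_probability ::
    "'b measure \<Rightarrow> (nat \<Rightarrow> 'b \<Rightarrow> real) \<Rightarrow> real \<Rightarrow> bool" where
  "tendsto_in_probability Q X c \<longleftrightarrow>
     (\<forall>N. X N \<in> borel_measurable Q) \<and>
     (\<forall>\<epsilon>>0. (\<lambda>N. measure Q {w \<in> space Q. \<bar>X N w - c\<bar> > \<epsilon>}) \<longlonglongrightarrow> 0)"

end

theory Submission
  imports Defs
begin

text \<open>
  Let \<open>h\<^sub>c\<close> be the critical point and \<open>Z\<^sub>N(h)\<close> the partition function. Raising \<open>h\<close> by \<open>\<delta>\<close> multiplies the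
  weight of a trajectory by \<open>e\<^sup>\<delta>\<close> per contact, so at \<open>h\<^sub>c\<close> the probability of more than \<open>N\<^sup>\<gamma>\<close> contacts is
  at most about \<open>exp (- \<delta> N\<^sup>\<gamma>) Z\<^sub>N(h\<^sub>c + \<delta>) / Z\<^sub>N(h\<^sub>c)\<close>. The denominator is at least the probability that the
  first gap has length \<open>N + 1\<close>, which decays at most polynomially. For \<open>\<delta> = N\<^sup>-\<^sup>1\<^sup>/\<^sup>2\<close> the first factor is
  \<open>exp (- N\<^sup>\<gamma>\<^sup>-\<^sup>1\<^sup>/\<^sup>2)\<close>, and by Markov's inequality it suffices that \<open>E[ln Z\<^sub>N(h\<^sub>c + \<delta>)] = O(ln N)\<close>. Up to boundary
  terms of that order this follows from a smoothing inequality in finite volume: the partition function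
  restricted to trajectories with a contact at \<open>n\<close>, again written \<open>Z\<^sub>n\<close> below, satisfies
  \<open>E[ln Z\<^sub>n(h\<^sub>c + \<delta>)] \<le> C n \<delta>\<^sup>2\<close> (\<open>near_critical_bound\<close>).

  Smoothing is a consequence of a rare-stretch strategy. By superadditivity the free energy is the
  supremum of \<open>E[ln Z\<^sub>n(h)] / n\<close>, so all these means are at most zero if \<open>h < h\<^sub>c\<close>
  (\<open>mean_ln_nonpos_below_critical\<close>). Suppose that under another law of the environment, with entropy \<open>H\<close> per
  site, \<open>ln Z\<^sub>n(h)\<close> has mean \<open>a\<^sub>0\<close>. Then \<open>k\<close> consecutive stretches with a total of \<open>k a\<^sub>0 / 2\<close> are typical for
  that law, and under the original law they have probability at least \<open>exp (- O(k n H))\<close>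
  (\<open>entropy_inequality\<close>). As gap probabilities decay at most polynomially (\<open>slowly_varying_lower_bound\<close>), a trajectory can
  jump to the first such place at a cost of \<open>O(k n H)\<close>. Since it must not gain on average, \<open>a\<^sub>0\<close> is
  \<open>O(n H)\<close> (\<open>tilted_mean_ln_le\<close>).

  It remains to find a law of entropy \<open>O(\<delta>\<^sup>2)\<close> that raises the mean at least as much as the shift of \<open>h\<close> by
  \<open>\<delta>\<close> does. Since \<open>Z\<^sub>n\<close> is affine in each \<open>exp (\<beta> \<omega>\<^sub>i)\<close>, it suffices to compare the integrals of the functions
  \<open>ln (A + B exp (\<beta> x))\<close> of one site variable (\<open>shift_le_tilt\<close>). In the case of a smooth density, the translated law
  is such a law by hypothesis (\<open>tiltable_of_smooth_density\<close>). In the bounded case, the density \<open>1 + s x\<close> with \<open>s\<close>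
  proportional to \<open>\<delta>\<close> works (\<open>tiltable_of_bounded\<close>).
\<close>

section \<open>The constrained partition function\<close>

text \<open>The total weight of the renewal trajectories from \<open>0\<close> to a contact at \<open>n\<close>, where a gap of
  length \<open>j\<close> has weight \<open>K j\<close> and a contact at \<open>i + 1\<close> has energy \<open>e i\<close>. The recursion removes the last
  gap. With this indexing, \<open>zcon K e n\<close> depends on the first \<open>n\<close> energies, and moving the origin
  to \<open>m\<close> replaces \<open>e\<close> by \<open>\<lambda>i. e (m + i)\<close>.\<close>

function zcon :: "(nat \<Rightarrow> real) \<Rightarrow> (nat \<Rightarrow> real) \<Rightarrow> nat \<Rightarrow> real" where
  "zcon K e 0 = 1"
| "zcon K e (Suc n) = (\<Sum>m\<in>{..n}. zcon K e m * K (Suc n - m)) * exp (e n)"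
  by pat_completeness auto
termination
  by (relation "inv_image less_than (\<lambda>(K, e, n). n)") auto

declare zcon.simps(2) [simp del]

lemma zcon_cong:
  assumes "\<And>i. i < n \<Longrightarrow> e i = e' i"
  shows "zcon K e n = zcon K e' n"
  using assms
proof (induction n rule: less_induct)
  case (less n)
  show ?case
  proof (cases n)
    case (Suc k)
    have "zcon K e m = zcon K e' m" if "m \<le> k" for m
      using less.IH[of m] less.prems that Suc by auto
    moreover have "e k = e' k" using less.prems Suc by auto
    ultimately show ?thesis unfolding Suc zcon.simps(2)
      by (intro arg_cong2[where f="(*)"] sum.cong) auto
  qed simp
qed

text \<open>Each site energy enters through its own factor only, so every coordinate sees a function of
  the form \<open>A + B e\<^sup>x\<close>; this reduces comparisons of environments to a statement about one site.\<close>

lemma zcon_affine_coordinate: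
  assumes "\<And>j. j \<ge> 1 \<Longrightarrow> K j \<ge> 0"
  shows "\<exists>A B. A \<ge> 0 \<and> B \<ge> 0 \<and> (\<forall>x. zcon K (e(k := x)) n = A + B * exp x)"
proof (induction n rule: less_induct)
  case (less n)
  show ?case
  proof (cases n)
    case 0
    then show ?thesis by (auto intro: exI[of _ 1] exI[of _ 0])
  next
    case (Suc n')
    show ?thesis
    proof (cases "k = n'")
      case True
      let ?s = "\<Sum>m\<in>{..n'}. zcon K e m * K (Suc n' - m)"
      have *: "zcon K (e(k := x)) m = zcon K e m" if "m \<le> n'" for m x
        by (rule zcon_cong) (use that True in auto)
      have pos: "zcon K e m \<ge> 0" if m: "m \<le> n'" for m
      proof -
        obtain A B where AB: "A \<ge> 0" "B \<ge> 0" "\<forall>x. zcon K (e(k := x)) m = A + B * exp x"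
          using less.IH[of m] m Suc by (metis less_Suc_eq_le)
        have "zcon K e m = A + B * exp 0" using *[OF m, of 0] AB(3) by metis
        then show ?thesis using AB by simp
      qed
      show ?thesis
      proof (rule exI[of _ 0], rule exI[of _ ?s], intro conjI allI)
        show "?s \<ge> 0" by (intro sum_nonneg mult_nonneg_nonneg pos assms) auto
        show "zcon K (e(k := x)) n = 0 + ?s * exp x" for x
          unfolding Suc zcon.simps(2) using True * by simp
      qed simp
    next
      case False
      have "\<forall>m\<in>{..n'}. \<exists>A B. A \<ge> 0 \<and> B \<ge> 0 \<and> (\<forall>x. zcon K (e(k := x)) m = A + B * exp x)"
        using less.IH Suc by (simp add: less_Suc_eq_le del: fun_upd_apply)
      then obtain A B where AB: "\<And>m. m \<le> n' \<Longrightarrow> A m \<ge> 0" "\<And>m. m \<le> n' \<Longrightarrow> B m \<ge> 0"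
        "\<And>m x. m \<le> n' \<Longrightarrow> zcon K (e(k := x)) m = A m + B m * exp x"
        unfolding bchoice_iff by (metis atMost_iff)
      let ?A = "(\<Sum>m\<in>{..n'}. A m * K (Suc n' - m)) * exp (e n')"
      let ?B = "(\<Sum>m\<in>{..n'}. B m * K (Suc n' - m)) * exp (e n')"
      show ?thesis
      proof (rule exI[of _ ?A], rule exI[of _ ?B], intro conjI allI)
        show "?A \<ge> 0" "?B \<ge> 0" by (auto intro!: mult_nonneg_nonneg sum_nonneg assms AB)
        show "zcon K (e(k := x)) n = ?A + ?B * exp x" for x
        proof -
          have "zcon K (e(k := x)) n = (\<Sum>m\<in>{..n'}. (A m + B m * exp x) * K (Suc n' - m)) * exp (e n')"
            unfolding Suc zcon.simps(2) using False AB(3) by (auto intro!: sum.cong)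
          also have "\<dots> = ?A + ?B * exp x"
            by (simp add: algebra_simps sum.distrib sum_distrib_left sum_distrib_right)
          finally show ?thesis .
        qed
      qed
    qed
  qed
qed

lemma zcon_measurable [measurable]:
  assumes [measurable]: "\<And>i. (\<lambda>x. e x i) \<in> borel_measurable M"
  shows "(\<lambda>x. zcon K (e x) n) \<in> borel_measurable M"
proof (induction n rule: less_induct)
  case (less n)
  show ?case
  proof (cases n)
    case (Suc k)
    have [measurable]: "(\<lambda>x. zcon K (e x) m) \<in> borel_measurable M" if "m \<in> {..k}" for m
      using less.IH[of m] that Suc by auto
    show ?thesis unfolding Suc zcon.simps(2) by measurable
  qed simp
qed

locale gap_law =
  fixes K :: "nat \<Rightarrow> real"
  assumes K_pos: "\<And>j. j \<ge> 1 \<Longrightarrow> K j > 0"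
    and K_sum: "\<And>n. (\<Sum>j=1..n. K j) \<le> 1"
begin

lemma K_nonneg: "j \<ge> 1 \<Longrightarrow> K j \<ge> 0"
  using K_pos[of j] by simp

lemma zcon_pos: "zcon K e n > 0"
proof (induction n rule: less_induct)
  case (less n)
  show ?case
  proof (cases n)
    case (Suc k)
    then show ?thesis using less.IH K_pos unfolding Suc zcon.simps(2)
      by (intro mult_pos_pos sum_pos) auto
  qed simp
qed

lemma zcon_nonneg [simp]: "zcon K e n \<ge> 0"
  using zcon_pos[of e n] by simp

text \<open>The trajectories with a contact at \<open>m\<close> factorise, and all weights are non-negative.\<close>

lemma zcon_superadditive:
  "zcon K e m * zcon K (\<lambda>i. e (m + i)) n \<le> zcon K e (m + n)"
proof (induction n rule: less_induct)
  case (less n)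
  show ?case
  proof (cases n)
    case (Suc k)
    have "zcon K e m * zcon K (\<lambda>i. e (m + i)) n
        = (\<Sum>j\<in>{..k}. zcon K e m * zcon K (\<lambda>i. e (m + i)) j * K (Suc k - j)) * exp (e (m + k))"
      unfolding Suc zcon.simps(2) by (simp add: sum_distrib_left mult.assoc)
    also have "\<dots> \<le> (\<Sum>j\<in>{..k}. zcon K e (m + j) * K (Suc k - j)) * exp (e (m + k))"
      using less.IH Suc
      by (intro mult_right_mono sum_mono) (auto intro!: K_nonneg)
    also have "(\<Sum>j\<in>{..k}. zcon K e (m + j) * K (Suc k - j))
        = (\<Sum>j\<in>(+) m ` {..k}. zcon K e j * K (Suc (m + k) - j))"
      by (subst sum.reindex) auto
    also have "\<dots> * exp (e (m + k)) \<le> (\<Sum>j\<in>{..m + k}. zcon K e j * K (Suc (m + k) - j)) * exp (e (m + k))"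
      by (intro mult_right_mono sum_mono2) (auto intro!: mult_nonneg_nonneg K_nonneg)
    also have "\<dots> = zcon K e (m + n)"
      using Suc by (simp add: zcon.simps(2))
    finally show ?thesis .
  qed simp
qed

lemma zcon_jump:
  assumes "n \<ge> 1"
  shows "K n * exp (e (n - 1)) \<le> zcon K e n"
proof -
  obtain k where k: "n = Suc k" using assms by (cases n) auto
  have "K n * exp (e (n - 1)) = zcon K e 0 * K (Suc k - 0) * exp (e k)" using k by simp
  also have "\<dots> \<le> (\<Sum>m\<in>{..k}. zcon K e m * K (Suc k - m)) * exp (e k)"
    by (intro mult_right_mono member_le_sum[of 0 "{..k}" "\<lambda>m. zcon K e m * K (Suc k - m)"])
      (auto intro!: mult_nonneg_nonneg K_nonneg)
  finally show ?thesis using k by (simp add: zcon.simps(2))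
qed

lemma ln_zcon_jump:
  assumes "n \<ge> 1"
  shows "ln (K n) + e (n - 1) \<le> ln (zcon K e n)"
proof -
  have "ln (K n) + e (n - 1) = ln (K n * exp (e (n - 1)))"
    using K_pos[OF assms] by (simp add: ln_mult_pos)
  also have "\<dots> \<le> ln (zcon K e n)"
    using zcon_jump[OF assms] K_pos[OF assms] zcon_pos by (subst ln_le_cancel_iff) auto
  finally show ?thesis .
qed

lemma zcon_append_jump:
  assumes "n \<ge> 1"
  shows "zcon K e m * (K n * exp (e (m + n - 1))) \<le> zcon K e (m + n)"
proof -
  have "zcon K e m * (K n * exp (e (m + n - 1))) \<le> zcon K e m * zcon K (\<lambda>i. e (m + i)) n"
    using zcon_jump[OF assms, of "\<lambda>i. e (m + i)"] assms by (intro mult_left_mono) auto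
  also note zcon_superadditive
  finally show ?thesis .
qed

lemma K_sum_gaps: "(\<Sum>m\<in>{..k}. K (Suc k - m)) \<le> 1"
proof -
  have "(\<Sum>m\<in>{..k}. K (Suc k - m)) = (\<Sum>j=1..Suc k. K j)"
    by (rule sum.reindex_bij_witness[of _ "\<lambda>j. Suc k - j" "\<lambda>m. Suc k - m"]) auto
  then show ?thesis using K_sum[of "Suc k"] by linarith
qed

lemma K_le_1: assumes "j \<ge> 1" shows "K j \<le> 1"
proof -
  have "K j \<le> (\<Sum>i=1..j. K i)"
    by (rule member_le_sum) (use assms in \<open>auto intro!: K_nonneg\<close>)
  also have "\<dots> \<le> 1" by (rule K_sum)
  finally show ?thesis .
qed

lemma K_ge_power:
  assumes "c > 0" "a \<ge> 0" and lower: "\<And>j. j \<ge> 1 \<Longrightarrow> c * real j powr (- a) \<le> K j"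
    and j: "1 \<le> j" "j \<le> M"
  shows "c * real M powr (- a) \<le> K j"
proof -
  have "real M powr (- a) \<le> real j powr (- a)" using assms by (intro powr_mono2') auto
  then have "c * real M powr (- a) \<le> c * real j powr (- a)" using assms by (intro mult_left_mono) auto
  also note lower[OF j(1)]
  finally show ?thesis .
qed

lemma zcon_le: "zcon K e n \<le> exp (\<Sum>i<n. \<bar>e i\<bar>)"
proof (induction n rule: less_induct)
  case (less n)
  show ?case
  proof (cases n)
    case (Suc k)
    have "zcon K e m \<le> exp (\<Sum>i<k. \<bar>e i\<bar>)" if "m \<le> k" for m
    proof -
      have "zcon K e m \<le> exp (\<Sum>i<m. \<bar>e i\<bar>)" using less.IH[of m] that Suc by auto
      also have "\<dots> \<le> exp (\<Sum>i<k. \<bar>e i\<bar>)" using that by (auto intro!: sum_mono2)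
      finally show ?thesis .
    qed
    then have "zcon K e n \<le> (\<Sum>m\<in>{..k}. exp (\<Sum>i<k. \<bar>e i\<bar>) * K (Suc k - m)) * exp (e k)"
      unfolding Suc zcon.simps(2)
      by (intro mult_right_mono sum_mono) (auto intro!: K_nonneg)
    also have "\<dots> = exp (\<Sum>i<k. \<bar>e i\<bar>) * (\<Sum>m\<in>{..k}. K (Suc k - m)) * exp (e k)"
      by (simp add: sum_distrib_left)
    also have "\<dots> \<le> exp (\<Sum>i<k. \<bar>e i\<bar>) * 1 * exp \<bar>e k\<bar>"
      by (intro mult_mono K_sum_gaps) (auto intro!: sum_nonneg mult_nonneg_nonneg K_nonneg)
    also have "\<dots> = exp (\<Sum>i<n. \<bar>e i\<bar>)" using Suc by (simp add: exp_add)
    finally show ?thesis .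
  qed simp
qed

text \<open>From below, one gap of length \<open>n\<close>; from above, total gap weight at most one. All
  integrability in the environment rests on this bound.\<close>

lemma ln_zcon_abs_le: "\<bar>ln (zcon K e n)\<bar> \<le> \<bar>ln (K n)\<bar> + (\<Sum>i<n. \<bar>e i\<bar>)"
proof (cases n)
  case (Suc k)
  have "ln (K n) + e (n - 1) \<le> ln (zcon K e n)" by (rule ln_zcon_jump) (use Suc in simp)
  moreover have "ln (zcon K e n) \<le> (\<Sum>i<n. \<bar>e i\<bar>)"
    using zcon_le[of e n] zcon_pos[of e n] by (metis ln_exp ln_le_cancel_iff exp_gt_zero)
  moreover have "\<bar>e (n - 1)\<bar> \<le> (\<Sum>i<n. \<bar>e i\<bar>)"
    using Suc by (simp add: sum_nonneg)
  ultimately show ?thesis by linarith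
qed simp

end

section \<open>Sequences of i.i.d. real variables\<close>

locale iid_reals = prob_space \<mu> for \<mu> :: "real measure" +
  assumes sets_law [measurable_cong]: "sets \<mu> = sets borel"

lemma (in iid_reals) prob_space_law: "prob_space \<mu>"
  by unfold_locales

sublocale iid_reals \<subseteq> sequence_space \<mu> ..

context iid_reals
begin

lemma measurable_law: "borel_measurable \<mu> = borel_measurable borel"
  by (rule measurable_cong_sets[OF sets_law refl])

lemma space_law [simp]: "space \<mu> = UNIV"
  using sets_eq_imp_space_eq[OF sets_law] by simp

lemma sets_S: "sets S = sets (PiM UNIV (\<lambda>_::nat. borel :: real measure))"
  by (rule sets_PiM_cong) (auto simp: sets_law)

lemma space_S [simp]: "space S = UNIV"
  by (simp add: space_PiM)

lemma Collect_sets: "Measurable.pred S G \<Longrightarrow> {v. G v} \<in> sets S"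
  by (drule predE) simp

lemma coordinate_measurable: "(\<lambda>v. v i) \<in> borel_measurable S"
proof -
  have "(\<lambda>v. v i) \<in> measurable S \<mu>" by (rule measurable_component_singleton) simp
  then show ?thesis by (simp only: measurable_cong_sets[OF refl sets_law])
qed

lemma shift_measurable: "(\<lambda>v i. v (n + i)) \<in> measurable S S"
  by (rule measurable_PiM_single') (auto simp: measurable_component_singleton)

lemma distr_shift: "distr S S (\<lambda>v i. v (n + i)) = S"
proof -
  have "distr S S (\<lambda>v. \<lambda>i\<in>UNIV. v (n + i)) = S"
    by (rule distr_PiM_reindex[where M="\<lambda>_. \<mu>"]) (auto simp: prob_space_law)
  then show ?thesis by (simp add: restrict_def)
qed

lemma integral_shift:
  fixes F :: "(nat \<Rightarrow> real) \<Rightarrow> real"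
  assumes "F \<in> borel_measurable S"
  shows "(\<integral>v. F (\<lambda>i. v (n + i)) \<partial>S) = (\<integral>v. F v \<partial>S)"
proof -
  have "(\<integral>v. F v \<partial>S) = (\<integral>v. F v \<partial>distr S S (\<lambda>v i. v (n + i)))" by (simp only: distr_shift)
  also have "\<dots> = (\<integral>v. F (\<lambda>i. v (n + i)) \<partial>S)" by (rule integral_distr[OF shift_measurable assms])
  finally show ?thesis ..
qed

lemma integrable_shift:
  fixes F :: "(nat \<Rightarrow> real) \<Rightarrow> real"
  assumes "integrable S F"
  shows "integrable S (\<lambda>v. F (\<lambda>i. v (n + i)))"
proof -
  have "integrable (distr S S (\<lambda>v i. v (n + i))) F" using assms by (simp only: distr_shift)
  then show ?thesis by (rule integrable_distr[OF shift_measurable])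
qed

lemma coordinate_measurable': "(\<lambda>v. v i) \<in> measurable S \<mu>"
  by (rule measurable_component_singleton) simp

lemma distr_coordinate: "distr S \<mu> (\<lambda>v. v i) = \<mu>"
  by (rule PiM_component) simp

lemma integral_coordinate:
  fixes f :: "real \<Rightarrow> real"
  assumes "f \<in> borel_measurable borel"
  shows "(\<integral>v. f (v i) \<partial>S) = (\<integral>x. f x \<partial>\<mu>)"
proof -
  have "(\<integral>x. f x \<partial>\<mu>) = (\<integral>x. f x \<partial>distr S \<mu> (\<lambda>v. v i))" by (simp only: distr_coordinate)
  also have "\<dots> = (\<integral>v. f (v i) \<partial>S)"
    by (rule integral_distr[OF coordinate_measurable']) (simp add: measurable_law assms)
  finally show ?thesis ..
qed

lemma integrable_coordinate:
  fixes f :: "real \<Rightarrow> real"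
  assumes "integrable \<mu> f"
  shows "integrable S (\<lambda>v. f (v i))"
proof -
  have "integrable (distr S \<mu> (\<lambda>v. v i)) f" using assms by (simp only: distr_coordinate)
  then show ?thesis by (rule integrable_distr[OF coordinate_measurable'])
qed

text \<open>The coordinates before and after \<open>n\<close> are independent: they may be resampled from two
  independent copies of the sequence.\<close>

lemma nn_integral_split:
  assumes F [measurable]: "F \<in> borel_measurable S"
  shows "(\<integral>\<^sup>+v. F v \<partial>S) = (\<integral>\<^sup>+v. \<integral>\<^sup>+w. F (comb_seq n v w) \<partial>S \<partial>S)"
proof -
  interpret SS: pair_sigma_finite S S ..
  have [measurable]: "(\<lambda>(v, w). comb_seq n v w) \<in> measurable (S \<Otimes>\<^sub>M S) S"
    by (rule measurable_comb_seq)
  have "(\<integral>\<^sup>+v. F v \<partial>S) = (\<integral>\<^sup>+v. F v \<partial>distr (S \<Otimes>\<^sub>M S) S (\<lambda>(v, w). comb_seq n v w))"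
    by (simp only: PiM_comb_seq)
  also have "\<dots> = (\<integral>\<^sup>+p. F (case p of (v, w) \<Rightarrow> comb_seq n v w) \<partial>(S \<Otimes>\<^sub>M S))"
    by (intro nn_integral_distr) auto
  also have "\<dots> = (\<integral>\<^sup>+v. \<integral>\<^sup>+w. F (comb_seq n v w) \<partial>S \<partial>S)"
    by (subst P.nn_integral_fst[symmetric]) auto
  finally show ?thesis .
qed

lemma nn_integral_iter:
  assumes F [measurable]: "F \<in> borel_measurable S"
  shows "(\<integral>\<^sup>+v. F v \<partial>S) = (\<integral>\<^sup>+x. \<integral>\<^sup>+v. F (case_nat x v) \<partial>S \<partial>\<mu>)"
proof -
  have [measurable]: "(\<lambda>(x, v). case_nat x v) \<in> measurable (\<mu> \<Otimes>\<^sub>M S) S"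
    by measurable
  have "(\<integral>\<^sup>+v. F v \<partial>S) = (\<integral>\<^sup>+v. F v \<partial>distr (\<mu> \<Otimes>\<^sub>M S) S (\<lambda>(x, v). case_nat x v))"
    by (simp only: PiM_iter)
  also have "\<dots> = (\<integral>\<^sup>+p. F (case p of (x, v) \<Rightarrow> case_nat x v) \<partial>(\<mu> \<Otimes>\<^sub>M S))"
    by (intro nn_integral_distr) auto
  also have "\<dots> = (\<integral>\<^sup>+x. \<integral>\<^sup>+v. F (case_nat x v) \<partial>S \<partial>\<mu>)"
    by (subst P.nn_integral_fst[symmetric]) auto
  finally show ?thesis .
qed

lemma integral_iter:
  fixes F :: "(nat \<Rightarrow> real) \<Rightarrow> real"
  assumes F: "integrable S F"
  shows "integrable (\<mu> \<Otimes>\<^sub>M S) (\<lambda>(x, v). F (case_nat x v))"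
    and "(\<integral>v. F v \<partial>S) = (\<integral>x. \<integral>v. F (case_nat x v) \<partial>S \<partial>\<mu>)"
    and "(\<integral>v. F v \<partial>S) = (\<integral>v. \<integral>x. F (case_nat x v) \<partial>\<mu> \<partial>S)"
proof -
  interpret MS: pair_sigma_finite \<mu> S ..
  have [measurable]: "F \<in> borel_measurable S" using F by auto
  have m [measurable]: "(\<lambda>(x, v). case_nat x v) \<in> measurable (\<mu> \<Otimes>\<^sub>M S) S"
    by measurable
  have "integrable (distr (\<mu> \<Otimes>\<^sub>M S) S (\<lambda>(x, v). case_nat x v)) F" using F by (simp only: PiM_iter)
  then have i: "integrable (\<mu> \<Otimes>\<^sub>M S) (\<lambda>p. F (case p of (x, v) \<Rightarrow> case_nat x v))"
    by (rule integrable_distr[OF m])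
  then show i': "integrable (\<mu> \<Otimes>\<^sub>M S) (\<lambda>(x, v). F (case_nat x v))" by (simp add: split_beta')
  have "(\<integral>v. F v \<partial>S) = (\<integral>v. F v \<partial>distr (\<mu> \<Otimes>\<^sub>M S) S (\<lambda>(x, v). case_nat x v))"
    by (simp only: PiM_iter)
  also have "\<dots> = (\<integral>p. F (case p of (x, v) \<Rightarrow> case_nat x v) \<partial>(\<mu> \<Otimes>\<^sub>M S))"
    by (intro integral_distr) auto
  finally have e: "(\<integral>v. F v \<partial>S) = (\<integral>p. (case p of (x, v) \<Rightarrow> F (case_nat x v)) \<partial>(\<mu> \<Otimes>\<^sub>M S))"
    by (simp add: split_beta')
  show "(\<integral>v. F v \<partial>S) = (\<integral>x. \<integral>v. F (case_nat x v) \<partial>S \<partial>\<mu>)"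
    unfolding e by (rule MS.integral_fst'[OF i', symmetric, simplified])
  show "(\<integral>v. F v \<partial>S) = (\<integral>v. \<integral>x. F (case_nat x v) \<partial>\<mu> \<partial>S)"
    unfolding e using MS.integral_snd[of "\<lambda>x v. F (case_nat x v)", OF i'] by simp
qed

text \<open>Centred functions of disjoint blocks are orthogonal. Splitting off the first block leaves a
  cross term whose inner integral, over the remaining blocks, vanishes.\<close>

lemma block_sum_second_moment:
  fixes Y :: "(nat \<Rightarrow> real) \<Rightarrow> real"
  assumes Y: "integrable S Y" "integrable S (\<lambda>v. (Y v)\<^sup>2)" "(\<integral>v. Y v \<partial>S) = 0"
    and loc: "\<And>v w. (\<And>i. i < N \<Longrightarrow> v i = w i) \<Longrightarrow> Y v = Y w"
  shows "(\<integral>\<^sup>+v. ennreal ((\<Sum>j<k. Y (\<lambda>i. v (j * N + i)))\<^sup>2) \<partial>S) = ennreal (real k * (\<integral>v. (Y v)\<^sup>2 \<partial>S))"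
proof (induction k)
  case 0
  then show ?case by simp
next
  case (Suc k)
  let ?V = "\<integral>v. (Y v)\<^sup>2 \<partial>S"
  define T where "T v = (\<Sum>j<k. Y (\<lambda>i. v (j * N + i)))" for v
  have [measurable]: "Y \<in> borel_measurable S" using Y by auto
  have T1: "integrable S T" unfolding T_def by (intro Bochner_Integration.integrable_sum integrable_shift Y)
  have [measurable]: "T \<in> borel_measurable S" using T1 by auto
  have T0: "(\<integral>v. T v \<partial>S) = 0"
    unfolding T_def using Y
    by (subst Bochner_Integration.integral_sum) (auto simp: integral_shift integrable_shift)
  have V: "?V \<ge> 0" by simp
  have nnT: "(\<integral>\<^sup>+v. ennreal ((T v)\<^sup>2) \<partial>S) = ennreal (real k * ?V)" using Suc unfolding T_def .
  have T2: "integrable S (\<lambda>v. (T v)\<^sup>2)"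
    by (rule integrableI_nonneg) (auto simp: nnT)
  have T2': "(\<integral>v. (T v)\<^sup>2 \<partial>S) = real k * ?V"
    by (subst integral_eq_nn_integral) (auto simp: nnT V)
  have step: "(\<Sum>j<Suc k. Y (\<lambda>i. comb_seq N v w (j * N + i))) = Y v + T w" for v w
  proof -
    have "(\<Sum>j<Suc k. Y (\<lambda>i. comb_seq N v w (j * N + i)))
        = Y (\<lambda>i. comb_seq N v w i) + (\<Sum>j<k. Y (\<lambda>i. comb_seq N v w (Suc j * N + i)))"
      by (subst sum.lessThan_Suc_shift) simp
    also have "Y (\<lambda>i. comb_seq N v w i) = Y v" by (rule loc) (simp add: comb_seq_def)
    also have "(\<Sum>j<k. Y (\<lambda>i. comb_seq N v w (Suc j * N + i))) = T w"
      unfolding T_def by (intro sum.cong refl loc) (simp add: comb_seq_def)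
    finally show ?thesis .
  qed
  have inner: "(\<integral>\<^sup>+w. ennreal ((y + T w)\<^sup>2) \<partial>S) = ennreal (y\<^sup>2 + real k * ?V)" for y
  proof -
    have i: "integrable S (\<lambda>w. (y + T w)\<^sup>2)"
      unfolding power2_sum by (intro Bochner_Integration.integrable_add integrable_mult_right T1 T2) auto
    have "(\<integral>\<^sup>+w. ennreal ((y + T w)\<^sup>2) \<partial>S) = ennreal (\<integral>w. (y + T w)\<^sup>2 \<partial>S)"
      by (rule nn_integral_eq_integral[OF i]) auto
    also have "(\<integral>w. (y + T w)\<^sup>2 \<partial>S) = (\<integral>w. y\<^sup>2 + (T w)\<^sup>2 + 2 * y * T w \<partial>S)"
      by (simp add: power2_sum)
    also have "\<dots> = y\<^sup>2 + real k * ?V"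
      using T1 T2 T0 T2' by (simp add: P.prob_space[simplified])
    finally show ?thesis .
  qed
  have "(\<integral>\<^sup>+v. ennreal ((\<Sum>j<Suc k. Y (\<lambda>i. v (j * N + i)))\<^sup>2) \<partial>S)
      = (\<integral>\<^sup>+v. \<integral>\<^sup>+w. ennreal ((Y v + T w)\<^sup>2) \<partial>S \<partial>S)"
  proof (subst nn_integral_split[where n=N])
    have "(\<lambda>v. Y (\<lambda>i. v (j * N + i))) \<in> borel_measurable S" for j
      by (rule measurable_compose[OF shift_measurable]) simp
    note [measurable] = this
    show "(\<lambda>v. ennreal ((\<Sum>j<Suc k. Y (\<lambda>i. v (j * N + i)))\<^sup>2)) \<in> borel_measurable S"
      by measurable
  qed (simp only: step)
  also have "\<dots> = (\<integral>\<^sup>+v. ennreal ((Y v)\<^sup>2 + real k * ?V) \<partial>S)"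
    by (simp add: inner)
  also have "\<dots> = ennreal (\<integral>v. (Y v)\<^sup>2 + real k * ?V \<partial>S)"
    by (rule nn_integral_eq_integral) (use Y V in auto)
  also have "(\<integral>v. (Y v)\<^sup>2 + real k * ?V \<partial>S) = real (Suc k) * ?V"
    using Y by (simp add: P.prob_space[simplified] algebra_simps)
  finally show ?case .
qed

text \<open>By the second moment above and Chebyshev's inequality, this probability is \<open>O(1/k)\<close>.\<close>

lemma block_sum_lower_tail:
  fixes X :: "(nat \<Rightarrow> real) \<Rightarrow> real"
  assumes X: "integrable S X" "integrable S (\<lambda>v. (X v)\<^sup>2)" and a: "(\<integral>v. X v \<partial>S) = a" "a > 0"
    and loc: "\<And>v w. (\<And>i. i < N \<Longrightarrow> v i = w i) \<Longrightarrow> X v = X w"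
  shows "\<exists>k0. \<forall>k\<ge>k0. measure S {v. (\<Sum>j<k. X (\<lambda>i. v (j * N + i))) < real k * (a / 2)} \<le> 1 / 8"
proof -
  define Y where "Y v = X v - a" for v
  have [measurable]: "X \<in> borel_measurable S" using X by auto
  have [measurable]: "Y \<in> borel_measurable S" unfolding Y_def by measurable
  define V where "V = (\<integral>v. (Y v)\<^sup>2 \<partial>S)"
  have Y: "integrable S Y" "integrable S (\<lambda>v. (Y v)\<^sup>2)" "(\<integral>v. Y v \<partial>S) = 0"
    unfolding Y_def power2_diff using X a by (auto simp: P.prob_space[simplified])
  have V: "V \<ge> 0" unfolding V_def by simp
  have locY: "Y v = Y w" if "\<And>i. i < N \<Longrightarrow> v i = w i" for v w
    unfolding Y_def using loc[OF that] by simp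
  define k0 where "k0 = nat \<lceil>32 * V / a\<^sup>2\<rceil> + 1"
  show ?thesis
  proof (intro exI[of _ k0] allI impI)
    fix k assume k: "k \<ge> k0"
    have k': "real k \<ge> 32 * V / a\<^sup>2" "k \<ge> 1" using k unfolding k0_def by linarith+
    define T where "T v = (\<Sum>j<k. Y (\<lambda>i. v (j * N + i)))" for v
    have "T \<in> borel_measurable S"
      unfolding T_def by (intro borel_measurable_sum measurable_compose[OF shift_measurable]) simp
    note [measurable] = this
    have nnT: "(\<integral>\<^sup>+v. ennreal ((T v)\<^sup>2) \<partial>S) = ennreal (real k * V)"
      unfolding T_def V_def by (rule block_sum_second_moment[OF Y locY])
    have T2: "integrable S (\<lambda>v. (T v)\<^sup>2)" by (rule integrableI_nonneg) (auto simp: nnT)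
    have T2': "(\<integral>v. (T v)\<^sup>2 \<partial>S) = real k * V"
      by (subst integral_eq_nn_integral) (auto simp: nnT V)
    have sub: "{v. (\<Sum>j<k. X (\<lambda>i. v (j * N + i))) < real k * (a / 2)}
        \<subseteq> {v \<in> space S. (real k * (a / 2))\<^sup>2 \<le> (T v)\<^sup>2}"
    proof safe
      fix v assume "(\<Sum>j<k. X (\<lambda>i. v (j * N + i))) < real k * (a / 2)"
      moreover have "T v = (\<Sum>j<k. X (\<lambda>i. v (j * N + i))) - real k * a"
        by (simp add: T_def Y_def sum_subtractf)
      ultimately have "real k * (a / 2) \<le> \<bar>T v\<bar>" by (simp add: field_simps)
      then show "(real k * (a / 2))\<^sup>2 \<le> (T v)\<^sup>2"
        using a by (intro abs_le_square_iff[THEN iffD1]) (auto simp: abs_mult)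
    qed simp
    have ka: "(real k * (a / 2))\<^sup>2 > 0" using k' a by auto
    have "measure S {v. (\<Sum>j<k. X (\<lambda>i. v (j * N + i))) < real k * (a / 2)}
        \<le> measure S {v \<in> space S. (real k * (a / 2))\<^sup>2 \<le> (T v)\<^sup>2}"
      by (rule P.finite_measure_mono[OF sub]) measurable
    also have "\<dots> \<le> (\<integral>v. (T v)\<^sup>2 \<partial>S) / (real k * (a / 2))\<^sup>2"
      by (rule integral_Markov_inequality_measure[where A="{}"]) (use T2 ka in auto)
    also have "\<dots> = 4 * V / (real k * a\<^sup>2)"
      unfolding T2' using k' a by (simp add: field_simps power2_eq_square)
    also have "\<dots> \<le> 1 / 8"
      using k' a by (simp add: field_simps)
    finally show "measure S {v. (\<Sum>j<k. X (\<lambda>i. v (j * N + i))) < real k * (a / 2)} \<le> 1 / 8" .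
  qed
qed

text \<open>Disjoint blocks are independent, and each is good with the same probability.\<close>

lemma no_good_block:
  assumes G [measurable]: "Measurable.pred S G"
    and loc: "\<And>v w. (\<And>i. i < N \<Longrightarrow> v i = w i) \<Longrightarrow> G v = G w"
  shows "measure S {v. \<forall>j<B. \<not> G (\<lambda>i. v (j * N + i))} = (1 - measure S {v. G v}) ^ B"
proof -
  have Gs: "{v. G v} \<in> sets S" by (rule Collect_sets[OF G])
  have compl: "emeasure S {v. \<not> G v} = ennreal (1 - measure S {v. G v})"
  proof -
    have "{v. \<not> G v} = space S - {v. G v}" by auto
    then show ?thesis using P.prob_compl[OF Gs] by (simp add: P.emeasure_eq_measure)
  qed
  have "emeasure S {v. \<forall>j<B. \<not> G (\<lambda>i. v (j * N + i))} = ennreal (1 - measure S {v. G v}) ^ B"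
  proof (induction B)
    case 0
    then show ?case using P.emeasure_space_1 by simp
  next
    case (Suc B)
    let ?E = "\<lambda>B. {v. \<forall>j<B. \<not> G (\<lambda>i. v (j * N + i))}"
    have E: "?E B \<in> sets S" for B
    proof -
      have [measurable]: "Measurable.pred S (\<lambda>v. G (\<lambda>i. v (j * N + i)))" for j
        by (rule measurable_compose[OF shift_measurable G])
      have "Measurable.pred S (\<lambda>v. \<forall>j<B. \<not> G (\<lambda>i. v (j * N + i)))" by measurable
      then show ?thesis by (rule Collect_sets)
    qed
    have nG: "{v. \<not> G v} \<in> sets S"
      using sets.compl_sets[OF Gs] by (simp add: Compl_eq_Diff_UNIV[symmetric] Collect_neg_eq)
    have step: "indicator (?E (Suc B)) (comb_seq N v w)
        = (indicator {v. \<not> G v} v * indicator (?E B) w :: ennreal)" for v w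
    proof -
      have 1: "G (\<lambda>i. comb_seq N v w (0 * N + i)) = G v" by (rule loc) (simp add: comb_seq_def)
      have 2: "G (\<lambda>i. comb_seq N v w (Suc j * N + i)) = G (\<lambda>i. w (j * N + i))" for j
        by (rule loc) (simp add: comb_seq_def)
      have "(\<forall>j<Suc B. \<not> G (\<lambda>i. comb_seq N v w (j * N + i)))
          \<longleftrightarrow> \<not> G v \<and> (\<forall>j<B. \<not> G (\<lambda>i. w (j * N + i)))"
        by (simp only: All_less_Suc2 1 2)
      then show ?thesis by (simp add: indicator_def)
    qed
    have "emeasure S (?E (Suc B)) = (\<integral>\<^sup>+v. indicator (?E (Suc B)) v \<partial>S)"
      using E[of "Suc B"] by simp
    also have "\<dots> = (\<integral>\<^sup>+v. \<integral>\<^sup>+w. indicator {v. \<not> G v} v * indicator (?E B) w \<partial>S \<partial>S)"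
      by (subst nn_integral_split[where n=N]) (use E in \<open>simp, simp only: step\<close>)
    also have "\<dots> = (\<integral>\<^sup>+v. indicator {v. \<not> G v} v * emeasure S (?E B) \<partial>S)"
      using E[of B] by (simp add: nn_integral_cmult)
    also have "\<dots> = emeasure S {v. \<not> G v} * emeasure S (?E B)"
      using nG by (simp add: nn_integral_multc)
    finally show ?case unfolding Suc.IH compl by simp
  qed
  moreover have "ennreal (1 - measure S {v. G v}) ^ B = ennreal ((1 - measure S {v. G v}) ^ B)"
    by (simp add: ennreal_power P.prob_le_1)
  moreover have "(1 - measure S {v. G v}) ^ B \<ge> 0" by (simp add: P.prob_le_1)
  ultimately show ?thesis
    by (simp only: P.emeasure_eq_measure ennreal_inj measure_nonneg)
qed

end

section \<open>The mean logarithm of the constrained partition function\<close>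

text \<open>Fekete's lemma.\<close>

lemma superadditive_convergent:
  fixes a :: "nat \<Rightarrow> real"
  assumes super: "\<And>m n. a m + a n \<le> a (m + n)" and a0: "a 0 = 0"
    and bound: "\<And>n. a n \<le> C * real n"
  shows "\<exists>L. (\<lambda>n. a n / real n) \<longlonglongrightarrow> L \<and> (\<forall>n\<ge>1. a n / real n \<le> L)"
proof -
  define L where "L = (SUP n\<in>{1..}. a n / real n)"
  have bdd: "bdd_above ((\<lambda>n. a n / real n) ` {1..})"
    by (rule bdd_aboveI2[of _ _ C]) (use bound in \<open>auto simp: divide_simps\<close>)
  have upper: "a n / real n \<le> L" if "n \<ge> 1" for n
    unfolding L_def by (rule cSUP_upper[OF _ bdd]) (use that in auto)
  have mult: "real q * a m \<le> a (q * m)" for q m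
  proof (induction q)
    case (Suc q)
    then show ?case using super[of m "q * m"] by (simp add: algebra_simps)
  qed (simp add: a0)
  have "(\<lambda>n. a n / real n) \<longlonglongrightarrow> L"
  proof (rule LIMSEQ_I)
    fix \<epsilon> :: real assume \<epsilon>: "\<epsilon> > 0"
    obtain m where m: "m \<ge> 1" "a m / real m > L - \<epsilon> / 2"
    proof -
      have "L - \<epsilon> / 2 < Sup ((\<lambda>n. a n / real n) ` {1..})" using \<epsilon> unfolding L_def by simp
      then show ?thesis using that less_cSup_iff[OF _ bdd] by auto
    qed
    define c where "c = \<bar>a m\<bar> + (\<Sum>r<m. \<bar>a r\<bar>)"
    obtain n0 where n0: "real n0 > 2 * c / \<epsilon>" using reals_Archimedean2 by blast
    show "\<exists>no. \<forall>n\<ge>no. norm (a n / real n - L) < \<epsilon>"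
    proof (intro exI[of _ "max 1 n0"] allI impI)
      fix n assume n: "n \<ge> max 1 n0"
      define q r where "q = n div m" and "r = n mod m"
      have n_eq: "n = q * m + r" and r: "r < m" unfolding q_def r_def using m by auto
      have "\<bar>a r\<bar> \<le> (\<Sum>r<m. \<bar>a r\<bar>)" by (rule member_le_sum) (use r in auto)
      moreover have "real q * a m + a r \<le> a n"
        using super[of "q * m" r] mult[of q m] n_eq by simp
      moreover have "real q * a m = real n * (a m / real m) - (real r / real m) * a m"
        using m n_eq by (simp add: field_simps)
      moreover have "(real r / real m) * a m \<le> \<bar>a m\<bar>"
      proof -
        have "(real r / real m) * a m \<le> (real r / real m) * \<bar>a m\<bar>" by (intro mult_left_mono) auto
        also have "\<dots> \<le> 1 * \<bar>a m\<bar>" using r by (intro mult_right_mono) auto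
        finally show ?thesis by simp
      qed
      ultimately have "a n \<ge> real n * (a m / real m) - c" unfolding c_def by linarith
      moreover have "real n * (a m / real m) \<ge> real n * (L - \<epsilon> / 2)"
        using m by (intro mult_left_mono) auto
      moreover have "c < real n * (\<epsilon> / 2)"
      proof -
        have "real n > 2 * c / \<epsilon>" using n0 n by linarith
        then show ?thesis using \<epsilon> by (simp add: field_simps)
      qed
      ultimately have "a n > real n * (L - \<epsilon>)" by (simp add: algebra_simps)
      then have "a n / real n > L - \<epsilon>" using n by (simp add: field_simps)
      moreover have "a n / real n \<le> L" using n by (intro upper) auto
      ultimately show "norm (a n / real n - L) < \<epsilon>" by simp
    qed
  qed
  with upper show ?thesis by blast
qed

locale pinned_law = gap_law K + iid_reals \<mu>
  for K :: "nat \<Rightarrow> real" and \<mu> :: "real measure" +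
  fixes \<beta> :: real
  assumes beta_pos: "\<beta> > 0"
    and square_integrable: "integrable \<mu> (\<lambda>x. x\<^sup>2)"
begin

abbreviation ln_zcon :: "real \<Rightarrow> nat \<Rightarrow> (nat \<Rightarrow> real) \<Rightarrow> real" where
  "ln_zcon h n v \<equiv> ln (zcon K (\<lambda>i. h + \<beta> * v i) n)"

definition mean_ln :: "real \<Rightarrow> nat \<Rightarrow> real" where
  "mean_ln h n = (\<integral>v. ln_zcon h n v \<partial>S)"

lemma first_moment: "integrable \<mu> (\<lambda>x. x)"
  by (rule finite_measure.square_integrable_imp_integrable[OF prob_space.finite_measure[OF prob_space_law]])
    (auto simp: measurable_law square_integrable)

lemma abs_energy_integrable: "integrable \<mu> (\<lambda>x. \<bar>h + \<beta> * x\<bar>)"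
  by (intro integrable_abs Bochner_Integration.integrable_add integrable_mult_right first_moment) auto

lemma ln_zcon_measurable [measurable]: "(\<lambda>v. ln_zcon h n v) \<in> borel_measurable S"
proof -
  have "(\<lambda>v. zcon K (\<lambda>i. h + \<beta> * v i) n) \<in> borel_measurable S"
    by (rule zcon_measurable) (intro borel_measurable_add borel_measurable_times borel_measurable_const coordinate_measurable)
  then show ?thesis by measurable
qed

lemma energy_integrable: "integrable S (\<lambda>v. \<Sum>i<n. \<bar>h + \<beta> * v i\<bar>)"
  by (intro Bochner_Integration.integrable_sum integrable_coordinate[OF abs_energy_integrable])

lemma ln_zcon_integrable: "integrable S (\<lambda>v. ln_zcon h n v)"
proof (rule Bochner_Integration.integrable_bound)
  show "integrable S (\<lambda>v. \<bar>ln (K n)\<bar> + (\<Sum>i<n. \<bar>h + \<beta> * v i\<bar>))"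
    by (intro Bochner_Integration.integrable_add energy_integrable) auto
  show "AE v in S. norm (ln_zcon h n v) \<le> norm (\<bar>ln (K n)\<bar> + (\<Sum>i<n. \<bar>h + \<beta> * v i\<bar>))"
  proof (rule AE_I2)
    fix v
    have "(\<Sum>i<n. \<bar>h + \<beta> * v i\<bar>) \<ge> 0" by (rule sum_nonneg) simp
    then show "norm (ln_zcon h n v) \<le> norm (\<bar>ln (K n)\<bar> + (\<Sum>i<n. \<bar>h + \<beta> * v i\<bar>))"
      using ln_zcon_abs_le[of "\<lambda>i. h + \<beta> * v i" n] by simp
  qed
qed simp

lemma ln_zcon_square_integrable: "integrable S (\<lambda>v. (ln_zcon h n v)\<^sup>2)"
proof (rule Bochner_Integration.integrable_bound)
  have *: "integrable S (\<lambda>v. (h + \<beta> * v i)\<^sup>2)" for i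
  proof -
    have "integrable \<mu> (\<lambda>x. (h + \<beta> * x)\<^sup>2)"
      using square_integrable first_moment by (auto simp: power2_sum power_mult_distrib)
    then show ?thesis by (rule integrable_coordinate)
  qed
  show "integrable S (\<lambda>v. 2 * \<bar>ln (K n)\<bar>\<^sup>2 + 2 * ((\<Sum>i<n. (h + \<beta> * v i)\<^sup>2) * real n))"
    by (intro Bochner_Integration.integrable_add integrable_mult_right integrable_mult_left
        Bochner_Integration.integrable_sum *) auto
  show "AE v in S. norm ((ln_zcon h n v)\<^sup>2)
      \<le> norm (2 * \<bar>ln (K n)\<bar>\<^sup>2 + 2 * ((\<Sum>i<n. (h + \<beta> * v i)\<^sup>2) * real n))"
  proof (rule AE_I2)
    fix v
    let ?b = "\<Sum>i<n. \<bar>h + \<beta> * v i\<bar>"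
    have "(ln_zcon h n v)\<^sup>2 \<le> (\<bar>ln (K n)\<bar> + ?b)\<^sup>2"
      using ln_zcon_abs_le[of "\<lambda>i. h + \<beta> * v i" n] by (metis abs_ge_zero power2_abs power_mono)
    also have "\<dots> \<le> 2 * \<bar>ln (K n)\<bar>\<^sup>2 + 2 * ?b\<^sup>2"
      using zero_le_power2[of "\<bar>ln (K n)\<bar> - ?b"] by (simp add: power2_sum power2_diff)
    also have "?b\<^sup>2 \<le> (\<Sum>i<n. \<bar>h + \<beta> * v i\<bar>\<^sup>2) * real n"
      using sum_squared_le_sum_of_squares[of "\<lambda>i. \<bar>h + \<beta> * v i\<bar>" "{..<n}"] by simp
    finally show "norm ((ln_zcon h n v)\<^sup>2)
      \<le> norm (2 * \<bar>ln (K n)\<bar>\<^sup>2 + 2 * ((\<Sum>i<n. (h + \<beta> * v i)\<^sup>2) * real n))"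
      by simp
  qed
qed simp

lemma ln_zcon_cong:
  assumes "\<And>i. i < n \<Longrightarrow> v i = w i"
  shows "ln_zcon h n v = ln_zcon h n w"
  using assms by (intro arg_cong[where f=ln] zcon_cong) auto

lemma ln_zcon_superadditive:
  "ln_zcon h m v + ln_zcon h n (\<lambda>i. v (m + i)) \<le> ln_zcon h (m + n) v"
proof -
  have "ln_zcon h m v + ln_zcon h n (\<lambda>i. v (m + i))
      = ln (zcon K (\<lambda>i. h + \<beta> * v i) m * zcon K (\<lambda>i. h + \<beta> * v (m + i)) n)"
    by (rule ln_mult_pos[symmetric]) (rule zcon_pos)+
  also have "\<dots> \<le> ln_zcon h (m + n) v"
    using zcon_pos zcon_superadditive[of "\<lambda>i. h + \<beta> * v i" m n]
    by (subst ln_le_cancel_iff) (auto intro!: mult_pos_pos)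
  finally show ?thesis .
qed

lemma ln_zcon_blocks:
  "(\<Sum>j<k. ln_zcon h N (\<lambda>i. v (j * N + i))) \<le> ln_zcon h (k * N) v"
proof (induction k)
  case (Suc k)
  then show ?case using ln_zcon_superadditive[where h=h and m="k * N" and n=N and v=v] by (simp add: add.commute)
qed simp

lemma mean_ln_superadditive: "mean_ln h m + mean_ln h n \<le> mean_ln h (m + n)"
proof -
  have "mean_ln h m + mean_ln h n
      = (\<integral>v. ln_zcon h m v \<partial>S) + (\<integral>v. ln_zcon h n (\<lambda>i. v (m + i)) \<partial>S)"
    unfolding mean_ln_def by (subst integral_shift) simp_all
  also have "\<dots> = (\<integral>v. ln_zcon h m v + ln_zcon h n (\<lambda>i. v (m + i)) \<partial>S)"
    by (rule Bochner_Integration.integral_add[symmetric])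
      (rule ln_zcon_integrable integrable_shift)+
  also have "\<dots> \<le> mean_ln h (m + n)"
    unfolding mean_ln_def
    by (intro integral_mono Bochner_Integration.integrable_add ln_zcon_integrable
        integrable_shift[OF ln_zcon_integrable] ln_zcon_superadditive)
  finally show ?thesis .
qed

lemma mean_ln_linear_bound: "mean_ln h n \<le> (\<integral>x. \<bar>h + \<beta> * x\<bar> \<partial>\<mu>) * real n"
proof -
  have "mean_ln h n \<le> (\<integral>v. (\<Sum>i<n. \<bar>h + \<beta> * v i\<bar>) \<partial>S)"
    unfolding mean_ln_def
  proof (intro integral_mono ln_zcon_integrable energy_integrable)
    fix v
    show "ln_zcon h n v \<le> (\<Sum>i<n. \<bar>h + \<beta> * v i\<bar>)"
      using zcon_le[of "\<lambda>i. h + \<beta> * v i" n] zcon_pos[of "\<lambda>i. h + \<beta> * v i" n]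
      by (metis ln_exp ln_le_cancel_iff exp_gt_zero)
  qed
  also have "\<dots> = (\<Sum>i<n. (\<integral>v. \<bar>h + \<beta> * v i\<bar> \<partial>S))"
    by (intro Bochner_Integration.integral_sum integrable_coordinate[OF abs_energy_integrable])
  also have "\<dots> = (\<Sum>i<n. (\<integral>x. \<bar>h + \<beta> * x\<bar> \<partial>\<mu>))"
    by (intro sum.cong refl integral_coordinate) simp
  finally show ?thesis by (simp add: mult.commute)
qed

lemma mean_ln_convergent:
  "\<exists>L. (\<lambda>n. mean_ln h n / real n) \<longlonglongrightarrow> L \<and> (\<forall>n\<ge>1. mean_ln h n / real n \<le> L)"
  by (rule superadditive_convergent[OF mean_ln_superadditive _ mean_ln_linear_bound])
    (simp add: mean_ln_def)

text \<open>Annealed bound: averaging over the environment first gives a renewal with total mass at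
  most one, and \<open>ln x \<le> x - 1\<close>.\<close>

lemma mean_ln_nonpos:
  assumes "(\<integral>\<^sup>+x. ennreal (exp (h + \<beta> * x)) \<partial>\<mu>) \<le> 1"
  shows "mean_ln h n \<le> 0"
proof -
  let ?Z = "\<lambda>n v. zcon K (\<lambda>i. h + \<beta> * v i) n"
  have [measurable]: "?Z n \<in> borel_measurable S" for n
    by (rule zcon_measurable) (intro borel_measurable_add borel_measurable_times borel_measurable_const coordinate_measurable)
  have [measurable]: "(\<lambda>v. exp (h + \<beta> * v i)) \<in> borel_measurable S" for i
    by (intro measurable_compose[OF coordinate_measurable]) simp
  have Z: "(\<integral>\<^sup>+v. ennreal (?Z n v) \<partial>S) \<le> 1" for n
  proof (induction n rule: less_induct)
    case (less n)
    show ?case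
    proof (cases n)
      case 0
      then show ?thesis using P.emeasure_space_1 by simp
    next
      case (Suc k)
      have site: "(\<integral>\<^sup>+w. ennreal (exp (h + \<beta> * w 0)) \<partial>S) \<le> 1"
      proof -
        have "(\<integral>\<^sup>+x. ennreal (exp (h + \<beta> * x)) \<partial>\<mu>)
            = (\<integral>\<^sup>+x. ennreal (exp (h + \<beta> * x)) \<partial>distr S \<mu> (\<lambda>v. v 0))"
          by (simp only: distr_coordinate)
        also have "\<dots> = (\<integral>\<^sup>+w. ennreal (exp (h + \<beta> * w 0)) \<partial>S)"
          by (rule nn_integral_distr[OF coordinate_measurable']) (simp add: measurable_law)
        finally show ?thesis using assms by simp
      qed
      have prod: "(\<integral>\<^sup>+v. ennreal (?Z m v * exp (h + \<beta> * v k)) \<partial>S) \<le> 1" if "m \<le> k" for m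
      proof -
        have "(\<integral>\<^sup>+v. ennreal (?Z m v * exp (h + \<beta> * v k)) \<partial>S)
            = (\<integral>\<^sup>+v. \<integral>\<^sup>+w. ennreal (?Z m (comb_seq k v w) * exp (h + \<beta> * comb_seq k v w k)) \<partial>S \<partial>S)"
          by (rule nn_integral_split) simp
        also have "\<dots> = (\<integral>\<^sup>+v. \<integral>\<^sup>+w. ennreal (?Z m v) * ennreal (exp (h + \<beta> * w 0)) \<partial>S \<partial>S)"
        proof (intro nn_integral_cong)
          fix v w
          have "?Z m (comb_seq k v w) = ?Z m v"
            by (rule zcon_cong) (use that in \<open>auto simp: comb_seq_def\<close>)
          moreover have "comb_seq k v w k = w 0" by (simp add: comb_seq_def)
          ultimately show "ennreal (?Z m (comb_seq k v w) * exp (h + \<beta> * comb_seq k v w k))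
              = ennreal (?Z m v) * ennreal (exp (h + \<beta> * w 0))"
            by (simp add: ennreal_mult)
        qed
        also have "\<dots> = (\<integral>\<^sup>+v. ennreal (?Z m v) \<partial>S) * (\<integral>\<^sup>+w. ennreal (exp (h + \<beta> * w 0)) \<partial>S)"
          by (simp add: nn_integral_cmult nn_integral_multc)
        also have "\<dots> \<le> 1 * 1"
          by (intro mult_mono site less.IH) (use that Suc in auto)
        finally show ?thesis by simp
      qed
      have "(\<integral>\<^sup>+v. ennreal (?Z n v) \<partial>S)
          = (\<integral>\<^sup>+v. (\<Sum>m\<in>{..k}. ennreal (K (Suc k - m)) * ennreal (?Z m v * exp (h + \<beta> * v k))) \<partial>S)"
      proof (intro nn_integral_cong)
        fix v
        have "?Z n v = (\<Sum>m\<in>{..k}. K (Suc k - m) * (?Z m v * exp (h + \<beta> * v k)))"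
          unfolding Suc zcon.simps(2) by (simp add: sum_distrib_left sum_distrib_right mult_ac)
        also have "ennreal \<dots> = (\<Sum>m\<in>{..k}. ennreal (K (Suc k - m) * (?Z m v * exp (h + \<beta> * v k))))"
          by (rule sum_ennreal[symmetric]) (auto intro!: mult_nonneg_nonneg K_nonneg)
        also have "\<dots> = (\<Sum>m\<in>{..k}. ennreal (K (Suc k - m)) * ennreal (?Z m v * exp (h + \<beta> * v k)))"
          by (intro sum.cong refl ennreal_mult) (auto intro!: mult_nonneg_nonneg K_nonneg)
        finally show "ennreal (?Z n v) = \<dots>" .
      qed
      also have "\<dots> = (\<Sum>m\<in>{..k}. ennreal (K (Suc k - m)) * (\<integral>\<^sup>+v. ennreal (?Z m v * exp (h + \<beta> * v k)) \<partial>S))"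
        by (subst nn_integral_sum) (auto intro!: sum.cong nn_integral_cmult)
      also have "\<dots> \<le> (\<Sum>m\<in>{..k}. ennreal (K (Suc k - m)) * 1)"
        by (intro sum_mono mult_left_mono prod) auto
      also have "\<dots> = ennreal (\<Sum>m\<in>{..k}. K (Suc k - m))"
        by (subst sum_ennreal[symmetric]) (auto intro!: K_nonneg)
      also have "\<dots> \<le> 1" using K_sum_gaps[of k] by simp
      finally show ?thesis .
    qed
  qed
  have "(\<integral>\<^sup>+v. ennreal (?Z n v) \<partial>S) < \<infinity>" using Z[of n] by (rule le_less_trans) simp
  then have fin: "integrable S (?Z n)"
    by (intro integrableI_nonneg) auto
  have le1: "(\<integral>v. ?Z n v \<partial>S) \<le> 1"
    using Z[of n] by (subst integral_eq_nn_integral) (auto intro!: enn2real_leI)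
  have "mean_ln h n \<le> (\<integral>v. ?Z n v - 1 \<partial>S)"
    unfolding mean_ln_def
    by (intro integral_mono ln_zcon_integrable Bochner_Integration.integrable_diff fin ln_le_minus_one zcon_pos) simp
  also have "\<dots> = (\<integral>v. ?Z n v \<partial>S) - 1"
    using fin by (simp add: P.prob_space[simplified])
  finally show ?thesis using le1 by simp
qed

end

section \<open>The cost of changing the law of the environment\<close>

text \<open>A second law \<open>\<nu>\<close> for the coordinates, with density \<open>g\<close> and finite entropy relative to \<open>\<mu>\<close>.\<close>

locale tilted_law = iid_reals \<mu> for \<mu> :: "real measure" +
  fixes g :: "real \<Rightarrow> real"
  assumes g_measurable [measurable]: "g \<in> borel_measurable borel"
    and g_nonneg: "\<And>x. g x \<ge> 0"
    and tilted_prob_space: "prob_space (density \<mu> (\<lambda>x. ennreal (g x)))"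
    and log_density_integrable: "integrable (density \<mu> (\<lambda>x. ennreal (g x))) (\<lambda>x. ln (g x))"
begin

abbreviation \<nu> :: "real measure" where "\<nu> \<equiv> density \<mu> (\<lambda>x. ennreal (g x))"

definition rel_entropy :: real where "rel_entropy = (\<integral>x. ln (g x) \<partial>\<nu>)"

sublocale N: iid_reals \<nu>
proof -
  interpret N: prob_space \<nu> by (rule tilted_prob_space)
  show "iid_reals \<nu>" by unfold_locales (simp add: sets_law)
qed

lemma sets_tilted_S: "sets N.S = sets S"
  by (rule sets_PiM_cong) auto

lemma measurable_tilted_S: "borel_measurable N.S = borel_measurable S"
  by (rule measurable_cong_sets[OF sets_tilted_S refl])

text \<open>Integrating out the first coordinate leaves a function of \<open>n\<close> coordinates of the same tilted
  sequence and contributes one factor \<open>g x\<close>.\<close>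

lemma nn_integral_tilted:
  assumes F: "F \<in> borel_measurable S"
    and loc: "\<And>v w. (\<And>i. i < n \<Longrightarrow> v i = w i) \<Longrightarrow> F v = F w"
  shows "(\<integral>\<^sup>+v. F v \<partial>N.S) = (\<integral>\<^sup>+v. F v * ennreal (\<Prod>i<n. g (v i)) \<partial>S)"
  using assms
proof (induction n arbitrary: F)
  case 0
  have "F v = F (\<lambda>_. 0)" for v by (rule "0.prems"(2)) simp
  then have F0: "F = (\<lambda>v. F (\<lambda>_. 0))" by (rule ext)
  show ?case
    by (subst (1 2) F0) (use P.emeasure_space_1 N.P.emeasure_space_1 in \<open>simp add: nn_integral_const\<close>)
next
  case (Suc n)
  note F = Suc.prems(1)
  have iter: "(\<lambda>(x, v). case_nat x v) \<in> measurable (\<mu> \<Otimes>\<^sub>M S) S"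
    by measurable
  have F2 [measurable]: "(\<lambda>(x, v). F (case_nat x v)) \<in> borel_measurable (\<mu> \<Otimes>\<^sub>M S)"
    using measurable_compose[OF iter F] by (simp add: split_beta')
  have Fx [measurable]: "(\<lambda>v. F (case_nat x v)) \<in> borel_measurable S" for x
    using measurable_compose[OF measurable_Pair1'[of x \<mu> S] F2] by simp
  have gi: "(\<lambda>v. g (v i)) \<in> borel_measurable S" for i
    by (rule measurable_compose[OF coordinate_measurable g_measurable])
  have prod_meas [measurable]: "(\<lambda>v. \<Prod>i<n. g (v i)) \<in> borel_measurable S" for n
    by (intro borel_measurable_prod gi)
  have inner: "(\<integral>\<^sup>+v. F (case_nat x v) \<partial>N.S) = (\<integral>\<^sup>+v. F (case_nat x v) * ennreal (\<Prod>i<n. g (v i)) \<partial>S)" for x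
  proof (rule Suc.IH[OF Fx])
    fix v w :: "nat \<Rightarrow> real" assume "\<And>i. i < n \<Longrightarrow> v i = w i"
    then show "F (case_nat x v) = F (case_nat x w)"
      by (intro Suc.prems(2)) (auto split: nat.split)
  qed
  have FN: "F \<in> borel_measurable N.S" using F by (simp only: measurable_tilted_S)
  have m1: "(\<lambda>x. \<integral>\<^sup>+v. F (case_nat x v) * ennreal (\<Prod>i<n. g (v i)) \<partial>S) \<in> borel_measurable \<mu>"
    by measurable
  have "(\<integral>\<^sup>+v. F v \<partial>N.S) = (\<integral>\<^sup>+x. \<integral>\<^sup>+v. F (case_nat x v) \<partial>N.S \<partial>\<nu>)"
    by (rule N.nn_integral_iter[OF FN])
  also have "\<dots> = (\<integral>\<^sup>+x. \<integral>\<^sup>+v. F (case_nat x v) * ennreal (\<Prod>i<n. g (v i)) \<partial>S \<partial>\<nu>)"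
    by (simp only: inner)
  also have "\<dots> = (\<integral>\<^sup>+x. ennreal (g x) * (\<integral>\<^sup>+v. F (case_nat x v) * ennreal (\<Prod>i<n. g (v i)) \<partial>S) \<partial>\<mu>)"
    by (rule nn_integral_density[OF _ m1]) (simp add: measurable_cong_sets[OF sets_law refl])
  also have "\<dots> = (\<integral>\<^sup>+x. \<integral>\<^sup>+v. F (case_nat x v) * ennreal (\<Prod>i<Suc n. g (case_nat x v i)) \<partial>S \<partial>\<mu>)"
  proof (intro nn_integral_cong)
    fix x
    have "ennreal (g x) * (\<integral>\<^sup>+v. F (case_nat x v) * ennreal (\<Prod>i<n. g (v i)) \<partial>S)
        = (\<integral>\<^sup>+v. ennreal (g x) * (F (case_nat x v) * ennreal (\<Prod>i<n. g (v i))) \<partial>S)"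
      by (rule nn_integral_cmult[symmetric]) measurable
    also have "\<dots> = (\<integral>\<^sup>+v. F (case_nat x v) * ennreal (\<Prod>i<Suc n. g (case_nat x v i)) \<partial>S)"
      by (intro nn_integral_cong, subst prod.lessThan_Suc_shift)
        (simp add: ennreal_mult g_nonneg prod_nonneg mult_ac)
    finally show "ennreal (g x) * (\<integral>\<^sup>+v. F (case_nat x v) * ennreal (\<Prod>i<n. g (v i)) \<partial>S) = \<dots>" .
  qed
  also have "\<dots> = (\<integral>\<^sup>+v. F v * ennreal (\<Prod>i<Suc n. g (v i)) \<partial>S)"
    by (rule nn_integral_iter[symmetric]) (use F in measurable)
  finally show ?case .
qed

text \<open>The entropy inequality. The logarithm \<open>T\<close> of the density has mean \<open>n * rel_entropy\<close> under
  the tilted law, and its negative part has mean at most \<open>1\<close> since \<open>e\<^sup>t (- t) \<le> 1\<close>. With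
  \<open>s = 4 (n H + 1)\<close>, Markov's inequality gives \<open>T < s\<close> with tilted probability at least \<open>3/4\<close>,
  and on that event the density is at most \<open>e\<^sup>s\<close>.\<close>

lemma entropy_inequality:
  assumes G: "Measurable.pred S G"
    and loc: "\<And>v w. (\<And>i. i < n \<Longrightarrow> v i = w i) \<Longrightarrow> G v = G w"
    and H: "rel_entropy \<le> H" "H \<ge> 0"
  shows "exp (- (4 * (real n * H + 1))) * (measure N.S {v. G v} - 1 / 4) \<le> measure S {v. G v}"
proof -
  define T where "T v = (\<Sum>i<n. ln (g (v i)))" for v :: "nat \<Rightarrow> real"
  define D where "D v = (\<Prod>i<n. g (v i))" for v :: "nat \<Rightarrow> real"
  define s where "s = 4 * (real n * H + 1)"
  have s: "s > 0" unfolding s_def using H by (simp add: add_nonneg_pos)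
  note setsN = sets_tilted_S and measN = measurable_tilted_S
  have gi: "(\<lambda>v. g (v i)) \<in> borel_measurable S" for i
    by (rule measurable_compose[OF coordinate_measurable g_measurable])
  have Tm [measurable]: "T \<in> borel_measurable S"
    unfolding T_def by (intro borel_measurable_sum borel_measurable_ln gi)
  have Dm [measurable]: "D \<in> borel_measurable S"
    unfolding D_def by (intro borel_measurable_prod gi)
  have Tloc: "T v = T w" if "\<And>i. i < n \<Longrightarrow> v i = w i" for v w
    unfolding T_def using that by (intro sum.cong) auto
  have DT: "D v = 0 \<or> D v = exp (T v)" for v
  proof (cases "\<forall>i<n. g (v i) > 0")
    case True
    then have "D v = exp (T v)" unfolding D_def T_def
      by (simp add: exp_sum)
    then show ?thesis ..
  next
    case False
    then obtain i where "i < n" "g (v i) = 0" using g_nonneg by (metis less_eq_real_def)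
    then show ?thesis unfolding D_def by auto
  qed
  have Ti: "integrable N.S T"
    unfolding T_def by (intro Bochner_Integration.integrable_sum N.integrable_coordinate log_density_integrable)
  have "(\<integral>v. T v \<partial>N.S) = (\<Sum>i<n. (\<integral>v. ln (g (v i)) \<partial>N.S))"
    unfolding T_def by (intro Bochner_Integration.integral_sum N.integrable_coordinate log_density_integrable)
  also have "\<dots> = real n * rel_entropy"
    unfolding rel_entropy_def by (subst N.integral_coordinate) simp_all
  finally have mean: "(\<integral>v. T v \<partial>N.S) \<le> real n * H"
    using H by (simp add: mult_left_mono)
  have "(\<integral>\<^sup>+v. ennreal (max 0 (- T v)) \<partial>N.S) = (\<integral>\<^sup>+v. ennreal (max 0 (- T v)) * ennreal (D v) \<partial>S)"
    unfolding D_def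
  proof (rule nn_integral_tilted)
    show "(\<lambda>v. ennreal (max 0 (- T v))) \<in> borel_measurable S" by measurable
    fix v w :: "nat \<Rightarrow> real" assume "\<And>i. i < n \<Longrightarrow> v i = w i"
    from Tloc[OF this] show "ennreal (max 0 (- T v)) = ennreal (max 0 (- T w))" by simp
  qed
  also have "\<dots> \<le> (\<integral>\<^sup>+v. 1 \<partial>S)"
  proof (intro nn_integral_mono)
    fix v
    have "max 0 (- T v) * exp (T v) \<le> exp (- T v) * exp (T v)"
      using exp_ge_add_one_self[of "- T v"] by (intro mult_right_mono) auto
    then have "max 0 (- T v) * D v \<le> 1"
      using DT[of v] by (auto simp flip: exp_add)
    moreover have "ennreal (max 0 (- T v)) * ennreal (D v) = ennreal (max 0 (- T v) * D v)"
      by (rule ennreal_mult[symmetric]) (simp, use DT[of v] in auto)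
    ultimately show "ennreal (max 0 (- T v)) * ennreal (D v) \<le> 1" by simp
  qed
  also have "\<dots> = 1" using P.emeasure_space_1 by simp
  finally have neg: "(\<integral>v. max 0 (- T v) \<partial>N.S) \<le> 1"
    using Tm by (subst integral_eq_nn_integral) (auto intro!: enn2real_leI simp: measN)
  have "(\<integral>v. max 0 (T v) \<partial>N.S) = (\<integral>v. T v + max 0 (- T v) \<partial>N.S)"
    by (intro Bochner_Integration.integral_cong) auto
  also have "\<dots> = (\<integral>v. T v \<partial>N.S) + (\<integral>v. max 0 (- T v) \<partial>N.S)"
    by (intro Bochner_Integration.integral_add integrable_max Ti) (auto intro!: Ti)
  finally have pos: "(\<integral>v. max 0 (T v) \<partial>N.S) \<le> real n * H + 1" using mean neg by simp
  have "measure N.S {v \<in> space N.S. s \<le> max 0 (T v)} \<le> (\<integral>v. max 0 (T v) \<partial>N.S) / s"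
    by (rule integral_Markov_inequality_measure[where A="{}"]) (use s in \<open>auto intro!: Ti\<close>)
  also have "\<dots> \<le> (real n * H + 1) / s" using pos s by (simp add: divide_right_mono)
  also have "\<dots> = 1 / 4" unfolding s_def using H by (simp add: field_simps add_nonneg_eq_0_iff)
  finally have tail: "measure N.S {v. s \<le> max 0 (T v)} \<le> 1 / 4" by simp
  have [measurable]: "Measurable.pred S G" by (rule G)
  have Gs: "{v. G v} \<in> sets S" by (rule Collect_sets[OF G])
  have GT: "{v. G v \<and> T v \<le> s} \<in> sets S"
  proof -
    have "Measurable.pred S (\<lambda>v. G v \<and> T v \<le> s)" by measurable
    then show ?thesis by (rule Collect_sets)
  qed
  have Ts: "{v. s \<le> max 0 (T v)} \<in> sets S"
  proof -
    have "Measurable.pred S (\<lambda>v. s \<le> max 0 (T v))" by measurable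
    then show ?thesis by (rule Collect_sets)
  qed
  have "emeasure N.S {v. G v \<and> T v \<le> s} = (\<integral>\<^sup>+v. indicator {v. G v \<and> T v \<le> s} v \<partial>N.S)"
    using GT setsN by simp
  also have "\<dots> = (\<integral>\<^sup>+v. indicator {v. G v \<and> T v \<le> s} v * ennreal (D v) \<partial>S)"
    unfolding D_def
  proof (rule nn_integral_tilted)
    fix v w :: "nat \<Rightarrow> real" assume "\<And>i. i < n \<Longrightarrow> v i = w i"
    then have "G v = G w" "T v = T w" using loc Tloc by blast+
    then show "indicator {v. G v \<and> T v \<le> s} v = (indicator {v. G v \<and> T v \<le> s} w :: ennreal)"
      by (simp add: indicator_def)
  qed (use GT in simp)
  also have "\<dots> \<le> (\<integral>\<^sup>+v. ennreal (exp s) * indicator {v. G v} v \<partial>S)"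
  proof (intro nn_integral_mono)
    fix v
    have "D v \<le> exp s" if "T v \<le> s" using DT[of v] that by auto
    then show "indicator {v. G v \<and> T v \<le> s} v * ennreal (D v) \<le> ennreal (exp s) * indicator {v. G v} v"
      by (auto simp: indicator_def intro!: ennreal_leI)
  qed
  also have "\<dots> = ennreal (exp s) * emeasure S {v. G v}" using Gs by (simp add: nn_integral_cmult)
  finally have "measure N.S {v. G v \<and> T v \<le> s} \<le> exp s * measure S {v. G v}"
    by (simp add: N.P.emeasure_eq_measure P.emeasure_eq_measure ennreal_mult[symmetric])
  moreover have "measure N.S {v. G v} \<le> measure N.S {v. G v \<and> T v \<le> s} + measure N.S {v. s \<le> max 0 (T v)}"
    using GT Ts setsN
    by (intro order_trans[OF N.P.finite_measure_mono measure_Un_le]) auto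
  ultimately have "measure N.S {v. G v} - 1 / 4 \<le> exp s * measure S {v. G v}" using tail by linarith
  then have "exp (- s) * (measure N.S {v. G v} - 1 / 4) \<le> exp (- s) * (exp s * measure S {v. G v})"
    by (intro mult_left_mono) auto
  also have "\<dots> = measure S {v. G v}" by (simp flip: mult.assoc exp_add)
  finally show ?thesis unfolding s_def .
qed

end

section \<open>Rare stretches\<close>

locale tilted_pinned_law = pinned_law K \<mu> \<beta> + tilted_law \<mu> g
  for K \<mu> \<beta> g +
  assumes tilted_square_integrable: "integrable \<nu> (\<lambda>x. x\<^sup>2)"

sublocale tilted_pinned_law \<subseteq> N: pinned_law K \<nu> \<beta>
  by unfold_locales (rule beta_pos, rule tilted_square_integrable)

context tilted_pinned_law
begin

text \<open>The environment is cut into \<open>B\<close> blocks of length \<open>l + 1\<close>, followed by one last coordinate. The first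
  coordinate of a block is the landing site of a long jump, the other \<open>l\<close> are the stretch to be
  visited. The strategy behind the bound: jump from the origin into block \<open>I\<close>, collect its stretch,
  jump to the last site. The two jumps cost \<open>2 ln \<kappa>\<close>.\<close>

lemma visit_good_block:
  assumes \<kappa>: "\<And>n. n \<ge> 1 \<Longrightarrow> n \<le> Suc (B * Suc l) \<Longrightarrow> \<kappa> \<le> K n" "0 < \<kappa>"
    and I: "I < B" and R: "\<bar>v (I * Suc l)\<bar> \<le> R"
    and x: "x \<le> ln_zcon h l (\<lambda>i. v (I * Suc l + Suc i))"
  shows "2 * ln \<kappa> - 2 * \<bar>h\<bar> - \<beta> * R - \<beta> * \<bar>v (B * Suc l)\<bar> + x \<le> ln_zcon h (Suc (B * Suc l)) v"
proof -
  define e where "e i = h + \<beta> * v i" for i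
  define s where "s = Suc (I * Suc l)"
  have "Suc I * Suc l \<le> B * Suc l" using I by (intro mult_right_mono) auto
  then have sl: "s + l \<le> B * Suc l" by (simp add: s_def)
  define r where "r = Suc (B * Suc l) - (s + l)"
  have r: "r \<ge> 1" "s + l + r = Suc (B * Suc l)" unfolding r_def using sl by auto
  have s: "s \<ge> 1" "s \<le> Suc (B * Suc l)" using sl by (auto simp: s_def)
  have lnjump: "ln \<kappa> \<le> ln (K n)" if "n \<ge> 1" "n \<le> Suc (B * Suc l)" for n
    using \<kappa>(1)[OF that] \<kappa>(2) K_pos[OF that(1)] by (subst ln_le_cancel_iff) auto
  have "zcon K e s * zcon K (\<lambda>i. e (s + i)) l \<le> zcon K e (s + l)" by (rule zcon_superadditive)
  then have "ln (zcon K e s) + ln (zcon K (\<lambda>i. e (s + i)) l) \<le> ln (zcon K e (s + l))"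
    using zcon_pos by (subst ln_mult_pos[symmetric]) (auto intro!: mult_pos_pos)
  moreover have "ln (K s) + e (I * Suc l) \<le> ln (zcon K e s)"
    using ln_zcon_jump[OF s(1), of e] by (simp add: s_def)
  moreover have "ln (zcon K e (s + l)) + (ln (K r) + e (B * Suc l)) \<le> ln (zcon K e (Suc (B * Suc l)))"
  proof -
    have "zcon K e (s + l) * (K r * exp (e (s + l + r - 1))) \<le> zcon K e (s + l + r)"
      by (rule zcon_append_jump[OF r(1)])
    then have "ln (zcon K e (s + l) * (K r * exp (e (B * Suc l)))) \<le> ln (zcon K e (Suc (B * Suc l)))"
      unfolding r(2) using zcon_pos K_pos[OF r(1)] by (subst ln_le_cancel_iff) (auto intro!: mult_pos_pos)
    then show ?thesis using zcon_pos K_pos[OF r(1)] by (simp add: ln_mult_pos)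
  qed
  moreover have "x \<le> ln (zcon K (\<lambda>i. e (s + i)) l)"
    using x by (simp add: e_def s_def)
  moreover have "ln \<kappa> \<le> ln (K s)" "ln \<kappa> \<le> ln (K r)"
    using r s by (auto intro!: lnjump)
  moreover have "- \<bar>h\<bar> - \<beta> * R \<le> e (I * Suc l)"
  proof -
    have "\<beta> * (- v (I * Suc l)) \<le> \<beta> * R" using R beta_pos by (intro mult_left_mono) auto
    then show ?thesis unfolding e_def mult_minus_right by linarith
  qed
  moreover have "- \<bar>h\<bar> - \<beta> * \<bar>v (B * Suc l)\<bar> \<le> e (B * Suc l)"
  proof -
    have "\<beta> * (- v (B * Suc l)) \<le> \<beta> * \<bar>v (B * Suc l)\<bar>" using beta_pos by (intro mult_left_mono) auto
    then show ?thesis unfolding e_def mult_minus_right by linarith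
  qed
  ultimately show ?thesis unfolding e_def by linarith
qed

text \<open>With \<open>B \<ge> 1 / p\<close> blocks a good one exists with probability at least \<open>1 - 1/e \<ge> 1/2\<close>. When there is
  none, the trajectory jumps directly to the last site, which costs less than the two jumps.\<close>

lemma mean_ln_ge_good_blocks:
  assumes \<kappa>: "\<And>n. n \<ge> 1 \<Longrightarrow> n \<le> Suc (B * Suc l) \<Longrightarrow> \<kappa> \<le> K n" "0 < \<kappa>" "\<kappa> \<le> 1"
    and R: "R \<ge> 0" and x: "x \<ge> 0"
    and p: "p = measure S {v. \<bar>v 0\<bar> \<le> R \<and> x \<le> ln_zcon h l (\<lambda>i. v (Suc i))}" "p > 0"
    and B: "real B * p \<ge> 1"
  shows "2 * ln \<kappa> - 2 * \<bar>h\<bar> - \<beta> * R - \<beta> * (\<integral>x. \<bar>x\<bar> \<partial>\<mu>) + x / 2 \<le> mean_ln h (Suc (B * Suc l))"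
proof -
  define G where "G v \<longleftrightarrow> \<bar>v 0\<bar> \<le> R \<and> x \<le> ln_zcon h l (\<lambda>i. v (1 + i))" for v :: "nat \<Rightarrow> real"
  have [measurable]: "(\<lambda>v. ln_zcon h l (\<lambda>i. v (1 + i))) \<in> borel_measurable S"
    by (rule measurable_compose[OF shift_measurable ln_zcon_measurable])
  have [measurable]: "(\<lambda>v. v i) \<in> borel_measurable S" for i by (rule coordinate_measurable)
  have G: "Measurable.pred S G" unfolding G_def by measurable
  have loc: "G v = G w" if "\<And>i. i < Suc l \<Longrightarrow> v i = w i" for v w
  proof -
    have "ln_zcon h l (\<lambda>i. v (1 + i)) = ln_zcon h l (\<lambda>i. w (1 + i))"
      by (rule ln_zcon_cong) (use that in auto)
    then show ?thesis unfolding G_def using that[of 0] by simp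
  qed
  define bad where "bad = {v. \<forall>j<B. \<not> G (\<lambda>i. v (j * Suc l + i))}"
  have bad_sets: "bad \<in> sets S"
  proof -
    have [measurable]: "Measurable.pred S (\<lambda>v. G (\<lambda>i. v (j * Suc l + i)))" for j
      by (rule measurable_compose[OF shift_measurable G])
    have "Measurable.pred S (\<lambda>v. \<forall>j<B. \<not> G (\<lambda>i. v (j * Suc l + i)))" by measurable
    then show ?thesis unfolding bad_def by (rule Collect_sets)
  qed
  have pG: "measure S {v. G v} = p" unfolding p(1) G_def by simp
  have "measure S bad = (1 - p) ^ B"
    unfolding bad_def by (subst no_good_block[OF G loc]) (auto simp: pG)
  also have "\<dots> \<le> exp (- p) ^ B"
    using exp_ge_add_one_self[of "- p"] P.prob_le_1[of "{v. G v}"] pG by (intro power_mono) auto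
  also have "\<dots> = exp (- (real B * p))" by (simp flip: exp_of_nat_mult)
  also have "\<dots> \<le> exp (- 1)" using B by simp
  also have "\<dots> \<le> 1 / 2"
    using exp_ge_add_one_self[of 1] by (simp add: exp_minus field_simps)
  finally have bad_half: "measure S bad \<le> 1 / 2" .
  define c where "c = 2 * ln \<kappa> - 2 * \<bar>h\<bar> - \<beta> * R"
  have abs_int: "integrable S (\<lambda>v. \<bar>v i\<bar>)" for i
    by (rule integrable_coordinate) (rule integrable_abs[OF first_moment])
  have pw: "c - \<beta> * \<bar>v (B * Suc l)\<bar> + (x - x * indicator bad v) \<le> ln_zcon h (Suc (B * Suc l)) v" for v
  proof (cases "v \<in> bad")
    case False
    then obtain I where I: "I < B" "G (\<lambda>i. v (I * Suc l + i))" unfolding bad_def by auto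
    have "2 * ln \<kappa> - 2 * \<bar>h\<bar> - \<beta> * R - \<beta> * \<bar>v (B * Suc l)\<bar> + x \<le> ln_zcon h (Suc (B * Suc l)) v"
      by (rule visit_good_block[OF \<kappa>(1,2) I(1)]) (use I(2) in \<open>auto simp: G_def\<close>)
    then show ?thesis using False unfolding c_def by simp
  next
    case True
    let ?e = "\<lambda>i. h + \<beta> * v i"
    have 1: "1 \<le> Suc (B * Suc l)" by simp
    have "ln (K (Suc (B * Suc l))) + ?e (B * Suc l) \<le> ln_zcon h (Suc (B * Suc l)) v"
      using ln_zcon_jump[OF 1, of ?e] by simp
    moreover have "ln \<kappa> \<le> ln (K (Suc (B * Suc l)))"
      using \<kappa>(1)[OF 1] \<kappa>(2) K_pos[OF 1] by (subst ln_le_cancel_iff) auto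
    moreover have "ln \<kappa> \<le> 0" using \<kappa> by simp
    moreover have "\<beta> * (- v (B * Suc l)) \<le> \<beta> * \<bar>v (B * Suc l)\<bar>"
      using beta_pos by (intro mult_left_mono) auto
    moreover have "\<beta> * R \<ge> 0" using beta_pos R by simp
    ultimately show ?thesis using True unfolding c_def by simp
  qed
  have ind: "integrable S (\<lambda>v. indicator bad v :: real)"
    using bad_sets by (simp add: P.emeasure_eq_measure)
  have "c - \<beta> * (\<integral>x. \<bar>x\<bar> \<partial>\<mu>) + (x - x * measure S bad)
      = (\<integral>v. c - \<beta> * \<bar>v (B * Suc l)\<bar> + (x - x * indicator bad v) \<partial>S)"
    using abs_int ind bad_sets integral_coordinate[of abs "B * Suc l"]
    by (simp add: P.prob_space[simplified])
  also have "\<dots> \<le> mean_ln h (Suc (B * Suc l))"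
    unfolding mean_ln_def
    by (intro integral_mono ln_zcon_integrable pw Bochner_Integration.integrable_add
        Bochner_Integration.integrable_diff integrable_mult_right abs_int ind) auto
  finally have "c - \<beta> * (\<integral>x. \<bar>x\<bar> \<partial>\<mu>) + (x - x * measure S bad) \<le> mean_ln h (Suc (B * Suc l))" .
  moreover have "x * measure S bad \<le> x * (1 / 2)" using bad_half x by (intro mult_left_mono) auto
  ultimately show ?thesis unfolding c_def by linarith
qed

end

context tilted_pinned_law
begin

text \<open>The rare-stretch strategy. Suppose that stretches of length \<open>n\<close> have mean \<open>a0 > 0\<close> under the tilted
  law. A concatenation of \<open>k\<close> of them yields \<open>k * a0 / 2\<close> under the tilted law, hence also under the
  original law with probability \<open>p\<close> of order \<open>exp (- 4 * k * n * H)\<close> at least. Jumping to a good block among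
  \<open>1 / p\<close> blocks costs at most about \<open>2 * a * ln (1 / p)\<close>, since gap probabilities decay at most polynomially. If
  \<open>a0\<close> exceeded \<open>64 * a * n * H\<close>, the gain would win for large \<open>k\<close>, and some constrained mean would be
  positive under the original law.\<close>

lemma tilted_mean_ln_le:
  assumes c: "c > 0" and a: "a \<ge> 0" and K: "\<And>j. j \<ge> 1 \<Longrightarrow> c * real j powr (- a) \<le> K j"
    and H: "rel_entropy \<le> H" "H \<ge> 0" and sub: "\<And>M. mean_ln h M \<le> 0"
  shows "N.mean_ln h n \<le> 64 * a * real n * H"
proof (rule ccontr)
  define a0 where "a0 = N.mean_ln h n"
  assume "\<not> N.mean_ln h n \<le> 64 * a * real n * H"
  then have a0: "a0 > 64 * a * real n * H" unfolding a0_def by simp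
  then have a0_pos: "a0 > 0" using a H by (smt (verit) mult_nonneg_nonneg of_nat_0_le_iff)
  have n: "n \<ge> 1"
    using a0_pos unfolding a0_def N.mean_ln_def by (cases n) auto
  note setsN = sets_tilted_S
  define m where "m = (\<integral>x. \<bar>x\<bar> \<partial>\<nu>)"
  define R where "R = 8 * m + 1"
  have m: "m \<ge> 0" unfolding m_def by (rule Bochner_Integration.integral_nonneg) simp
  have R: "R > 0" unfolding R_def using m by simp
  have coord_tail: "measure N.S {v. R \<le> \<bar>v 0\<bar>} \<le> 1 / 8"
  proof -
    have "measure N.S {v \<in> space N.S. R \<le> \<bar>v 0\<bar>} \<le> (\<integral>v. \<bar>v 0\<bar> \<partial>N.S) / R"
      by (rule integral_Markov_inequality_measure[where A="{}"])
        (use R N.integrable_coordinate[OF integrable_abs[OF N.first_moment]] in auto)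
    also have "(\<integral>v. \<bar>v 0\<bar> \<partial>N.S) = m" unfolding m_def by (rule N.integral_coordinate) simp
    also have "m / R \<le> 1 / 8" using m by (simp add: R_def field_simps)
    finally show ?thesis by simp
  qed
  have "\<exists>k0. \<forall>k\<ge>k0. measure N.S {v. (\<Sum>j<k. ln_zcon h n (\<lambda>i. v (j * n + i))) < real k * (a0 / 2)} \<le> 1 / 8"
    by (rule N.block_sum_lower_tail[OF N.ln_zcon_integrable N.ln_zcon_square_integrable _ a0_pos ln_zcon_cong])
      (simp_all add: a0_def N.mean_ln_def)
  then obtain k0 where k0: "\<And>k. k \<ge> k0 \<Longrightarrow>
      measure N.S {v. (\<Sum>j<k. ln_zcon h n (\<lambda>i. v (j * n + i))) < real k * (a0 / 2)} \<le> 1 / 8"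
    by blast
  define \<mu>1 where "\<mu>1 = (\<integral>x. \<bar>x\<bar> \<partial>\<mu>)"
  define C where "C = 2 * \<bar>ln c\<bar> + 2 * \<bar>h\<bar> + \<beta> * R + \<beta> * \<mu>1
    + 2 * a * (ln 3 + ln 2 + 4 * H + 4)"
  have key: "real k * (a0 / 4) \<le> C + 2 * a * (ln (real (Suc (k * n))) + 4 * (real k * real n * H))"
    if k: "k \<ge> k0" for k
  proof -
    define l where "l = k * n"
    define x where "x = real k * (a0 / 2)"
    define p where "p = measure S {v. \<bar>v 0\<bar> \<le> R \<and> x \<le> ln_zcon h l (\<lambda>i. v (Suc i))}"
    define s where "s = 4 * (real (Suc l) * H + 1)"
    have [measurable]: "(\<lambda>v. ln_zcon h l (\<lambda>i. v (Suc i))) \<in> borel_measurable S"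
      using measurable_compose[OF shift_measurable[of 1] ln_zcon_measurable] by simp
    have [measurable]: "(\<lambda>v. v i) \<in> borel_measurable S" for i by (rule coordinate_measurable)
    define G where "G v \<longleftrightarrow> \<bar>v 0\<bar> \<le> R \<and> x \<le> ln_zcon h l (\<lambda>i. v (Suc i))" for v :: "nat \<Rightarrow> real"
    have G: "Measurable.pred S G" unfolding G_def by measurable
    have loc: "G v = G w" if "\<And>i. i < Suc l \<Longrightarrow> v i = w i" for v w
    proof -
      have "ln_zcon h l (\<lambda>i. v (Suc i)) = ln_zcon h l (\<lambda>i. w (Suc i))"
        by (rule ln_zcon_cong) (use that in auto)
      then show ?thesis unfolding G_def using that[of 0] by simp
    qed
    \<comment> \<open>Under the tilted law a block is good with probability at least \<open>3/4\<close>.\<close>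
    define E1 where "E1 = {v :: nat \<Rightarrow> real. R \<le> \<bar>v 0\<bar>}"
    define E where "E = {v. (\<Sum>j<k. ln_zcon h n (\<lambda>i. v (j * n + i))) < real k * (a0 / 2)}"
    define E2 where "E2 = {v :: nat \<Rightarrow> real. (\<lambda>i. v (1 + i)) \<in> E}"
    have E: "E \<in> sets S"
    proof -
      have [measurable]: "(\<lambda>v. ln_zcon h n (\<lambda>i. v (j * n + i))) \<in> borel_measurable S" for j
        by (rule measurable_compose[OF shift_measurable ln_zcon_measurable])
      have "Measurable.pred S (\<lambda>v. (\<Sum>j<k. ln_zcon h n (\<lambda>i. v (j * n + i))) < real k * (a0 / 2))"
        by measurable
      then show ?thesis unfolding E_def by (rule Collect_sets)
    qed
    have E1: "E1 \<in> sets S"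
    proof -
      have "Measurable.pred S (\<lambda>v. R \<le> \<bar>v 0\<bar>)" by measurable
      then show ?thesis unfolding E1_def by (rule Collect_sets)
    qed
    have E2: "E2 \<in> sets S"
      using measurable_sets[OF shift_measurable[of 1] E] by (simp add: E2_def vimage_def)
    have "measure N.S E2 = measure (distr N.S N.S (\<lambda>v i. v (1 + i))) E"
      by (subst measure_distr[OF N.shift_measurable]) (use E setsN in \<open>auto simp: E2_def vimage_def\<close>)
    also have "\<dots> = measure N.S E" by (simp only: N.distr_shift)
    also have "\<dots> \<le> 1 / 8" unfolding E_def by (rule k0[OF k])
    finally have E2_le: "measure N.S E2 \<le> 1 / 8" .
    have Gs: "{v. G v} \<in> sets S" by (rule Collect_sets[OF G])
    have cover: "space N.S - {v. G v} \<subseteq> E1 \<union> E2"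
    proof
      fix v assume "v \<in> space N.S - {v. G v}"
      then have "\<not> \<bar>v 0\<bar> \<le> R \<or> ln_zcon h l (\<lambda>i. v (1 + i)) < x" by (auto simp: G_def)
      moreover have "(\<Sum>j<k. ln_zcon h n (\<lambda>i. v (1 + (j * n + i)))) \<le> ln_zcon h l (\<lambda>i. v (1 + i))"
        unfolding l_def using ln_zcon_blocks[where h=h and N=n and k=k and v="\<lambda>i. v (1 + i)"] by simp
      ultimately show "v \<in> E1 \<union> E2" by (auto simp: E1_def E2_def E_def x_def)
    qed
    have "1 - measure N.S {v. G v} = measure N.S (space N.S - {v. G v})"
      by (rule N.P.prob_compl[symmetric]) (use Gs setsN in simp)
    also have "\<dots> \<le> measure N.S (E1 \<union> E2)"
      by (rule N.P.finite_measure_mono[OF cover]) (use E1 E2 setsN in simp)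
    also have "\<dots> \<le> measure N.S E1 + measure N.S E2"
      by (rule measure_Un_le) (use E1 E2 setsN in auto)
    also have "\<dots> \<le> 1 / 8 + 1 / 8" using E2_le coord_tail unfolding E1_def by linarith
    finally have Ggood: "measure N.S {v. G v} \<ge> 3 / 4" by simp
    \<comment> \<open>Hence under the original law it is good with probability at least \<open>e\<^sup>-\<^sup>s / 2\<close>.\<close>
    have pG: "p = measure S {v. G v}" unfolding p_def G_def ..
    have "exp (- s) * (1 / 2) \<le> exp (- s) * (measure N.S {v. G v} - 1 / 4)"
      using Ggood by (intro mult_left_mono) auto
    also have "\<dots> \<le> p"
      unfolding pG s_def by (rule entropy_inequality[OF G loc H]) auto
    finally have p_ge: "exp (- s) / 2 \<le> p" by simp
    have p: "p > 0" "p \<le> 1"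
      using p_ge by (smt (verit) exp_gt_zero divide_pos_pos, simp add: p_def P.prob_le_1)
    \<comment> \<open>The number of blocks is of order \<open>1 / p\<close>, so the total length \<open>M\<close> has \<open>ln M \<le> s + O(ln l)\<close>.\<close>
    define B where "B = nat \<lceil>1 / p\<rceil>"
    have Bp: "real B \<ge> 1 / p" "real B \<le> 1 / p + 1"
    proof -
      show "real B \<ge> 1 / p" unfolding B_def by (rule real_nat_ceiling_ge)
      have "1 / p > 0" using p by simp
      then have "\<lceil>1 / p\<rceil> \<ge> 0" by linarith
      then have "real B = of_int \<lceil>1 / p\<rceil>" unfolding B_def by simp
      then show "real B \<le> 1 / p + 1" using of_int_ceiling_le_add_one[of "1 / p"] by simp
    qed
    have p1: "1 / p \<ge> 1" using p by simp
    define M where "M = Suc (B * Suc l)"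
    have M1: "real M \<ge> 1" unfolding M_def by simp
    have M_le: "real M \<le> 3 * real (Suc l) * (1 / p)"
    proof -
      have "real M = real B * real (Suc l) + 1" unfolding M_def by (simp add: algebra_simps)
      also have "\<dots> \<le> (2 * (1 / p)) * real (Suc l) + 1 * (1 / p)"
        using Bp p1 by (intro add_mono mult_right_mono) auto
      also have "1 * (1 / p) \<le> real (Suc l) * (1 / p)"
        using p by (intro mult_right_mono) auto
      finally show ?thesis by (simp add: algebra_simps add_divide_distrib)
    qed
    have lnM: "ln (real M) \<le> ln 3 + ln (real (Suc l)) + (s + ln 2)"
    proof -
      have "ln (real M) \<le> ln (3 * real (Suc l) * (1 / p))" using M_le M1 by (subst ln_le_cancel_iff) (auto intro!: mult_pos_pos p)
      also have "\<dots> = ln (3 * real (Suc l)) + ln (1 / p)" by (rule ln_mult_pos) (use p in auto)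
      also have "ln (3 * real (Suc l)) = ln 3 + ln (real (Suc l))" by (rule ln_mult_pos) auto
      also have "ln (1 / p) \<le> ln (2 * exp s)"
        using p p_ge by (subst ln_le_cancel_iff) (auto simp: exp_minus field_simps)
      also have "\<dots> = s + ln 2" by (simp add: ln_mult_pos)
      finally show ?thesis by simp
    qed
    define \<kappa> where "\<kappa> = c * real M powr (- a)"
    have \<kappa>: "\<kappa> \<le> K j" if "1 \<le> j" "j \<le> M" for j
      unfolding \<kappa>_def by (rule K_ge_power[OF c a K that])
    have \<kappa>_pos: "\<kappa> > 0" unfolding \<kappa>_def using c M1 by simp
    have \<kappa>_le: "\<kappa> \<le> 1" using \<kappa>[of 1] K_le_1[of 1] M1 by simp
    have ln\<kappa>: "ln \<kappa> = ln c - a * ln (real M)"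
      unfolding \<kappa>_def using c M1 by (simp add: ln_mult_pos ln_powr)
    have "2 * ln \<kappa> - 2 * \<bar>h\<bar> - \<beta> * R - \<beta> * \<mu>1 + x / 2 \<le> mean_ln h M"
      unfolding M_def \<mu>1_def
    proof (rule mean_ln_ge_good_blocks[where p=p])
      show "\<And>j. 1 \<le> j \<Longrightarrow> j \<le> Suc (B * Suc l) \<Longrightarrow> \<kappa> \<le> K j" using \<kappa> unfolding M_def .
      show "0 < \<kappa>" "\<kappa> \<le> 1" "0 \<le> R" "0 < p" using \<kappa>_pos \<kappa>_le R p by auto
      show "0 \<le> x" unfolding x_def using a0_pos by simp
      show "p = measure S {v. \<bar>v 0\<bar> \<le> R \<and> x \<le> ln_zcon h l (\<lambda>i. v (Suc i))}" by (rule p_def)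
      show "1 \<le> real B * p" using Bp(1) p by (simp add: field_simps)
    qed
    also have "\<dots> \<le> 0" by (rule sub)
    finally have "x / 2 \<le> 2 * (a * ln (real M)) - 2 * ln c + 2 * \<bar>h\<bar> + \<beta> * R + \<beta> * \<mu>1"
      unfolding ln\<kappa> by (simp add: algebra_simps)
    moreover have "a * ln (real M) \<le> a * (ln 3 + ln (real (Suc l)) + (s + ln 2))"
      using lnM a by (rule mult_left_mono)
    moreover have "a * (ln 3 + ln (real (Suc l)) + (s + ln 2))
        = a * (ln 3 + ln 2 + 4 * H + 4) + a * (ln (real (Suc l)) + 4 * (real k * real n * H))"
      unfolding s_def l_def by (simp add: algebra_simps)
    ultimately have "x / 2 \<le> 2 * (a * (ln 3 + ln 2 + 4 * H + 4)) +
        2 * (a * (ln (real (Suc l)) + 4 * (real k * real n * H)))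
        - 2 * ln c + 2 * \<bar>h\<bar> + \<beta> * R + \<beta> * \<mu>1"
      by linarith
    also have "\<dots> \<le> C + 2 * a * (ln (real (Suc l)) + 4 * (real k * real n * H))"
      unfolding C_def by simp
    finally show ?thesis by (simp add: x_def l_def)
  qed
  \<comment> \<open>The left side grows like \<open>k * a0 / 4\<close>, the right side at most like \<open>k * a0 * 3 / 16\<close>.\<close>
  \<comment> \<open>The logarithm is bounded by a line of slope \<open>\<epsilon>\<close>, small enough to use up only \<open>k * a0 / 16\<close>.\<close>
  define \<epsilon> where "\<epsilon> = a0 / (32 * (a + 1) * real n)"
  have \<epsilon>: "\<epsilon> > 0" unfolding \<epsilon>_def using a0_pos a n by simp
  have log_le: "ln y \<le> \<epsilon> * y - ln \<epsilon>" if "y > 0" for y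
    using ln_le_minus_one[of "\<epsilon> * y"] \<epsilon> that by (simp add: ln_mult_pos)
  define C' where "C' = C + 2 * a * (\<epsilon> - ln \<epsilon>)"
  have bounded: "real k * (a0 / 16) \<le> C'" if "k \<ge> k0" for k
  proof -
    have "2 * a * ln (real (Suc (k * n))) \<le> 2 * a * (\<epsilon> * real (Suc (k * n)) - ln \<epsilon>)"
      using a by (intro mult_left_mono log_le) (auto simp del: of_nat_Suc)
    also have "\<dots> = 2 * a * (\<epsilon> - ln \<epsilon>) + real k * (2 * a * \<epsilon> * real n)" by (simp add: algebra_simps)
    finally have 1: "2 * a * ln (real (Suc (k * n))) \<le> 2 * a * (\<epsilon> - ln \<epsilon>) + real k * (2 * a * \<epsilon> * real n)" .
    have "2 * a * \<epsilon> * real n = (a / (a + 1)) * (a0 / 16)"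
    proof -
      have "a + 1 \<noteq> 0" "real n \<noteq> 0" using a n by auto
      then show ?thesis unfolding \<epsilon>_def by (simp add: divide_simps)
    qed
    also have "\<dots> \<le> 1 * (a0 / 16)" using a a0_pos by (intro mult_right_mono) auto
    finally have 2: "real k * (2 * a * \<epsilon> * real n) \<le> real k * (a0 / 16)" by (intro mult_left_mono) auto
    have "8 * a * real n * H \<le> a0 / 8" using a0 by simp
    then have 3: "real k * (8 * a * real n * H) \<le> real k * (a0 / 8)" by (intro mult_left_mono) auto
    have "real k * (a0 / 4) \<le> C + 2 * a * ln (real (Suc (k * n))) + real k * (8 * a * real n * H)"
      using key[OF that] by (simp add: algebra_simps)
    with 1 2 3 show ?thesis unfolding C'_def by linarith
  qed
  obtain k where k: "real k > C' / (a0 / 16)" using reals_Archimedean2 by blast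
  then have "C' < real (max k k0) * (a0 / 16)"
  proof -
    have "C' < real k * (a0 / 16)" using k a0_pos by (simp add: field_simps)
    also have "\<dots> \<le> real (max k k0) * (a0 / 16)" using a0_pos by (intro mult_right_mono) auto
    finally show ?thesis .
  qed
  with bounded[of "max k k0"] show False by simp
qed

end

section \<open>Comparing a tilt with a shift\<close>

context tilted_pinned_law
begin

lemma integrable_linear_bound:
  assumes "F \<in> borel_measurable S" "\<And>v. \<bar>F v\<bar> \<le> C + D * (\<Sum>i<n. \<bar>v i\<bar>)"
  shows "integrable S F"
proof (rule Bochner_Integration.integrable_bound)
  show "integrable S (\<lambda>v. C + D * (\<Sum>i<n. \<bar>v i\<bar>))"
    by (intro Bochner_Integration.integrable_add integrable_mult_right Bochner_Integration.integrable_sum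
        integrable_coordinate[OF integrable_abs[OF first_moment]]) simp
  show "AE v in S. norm (F v) \<le> norm (C + D * (\<Sum>i<n. \<bar>v i\<bar>))"
    using assms(2) by (intro AE_I2) (auto intro: order_trans[OF _ abs_ge_self])
qed (use assms in auto)

text \<open>Every coordinate enters \<open>F\<close> as \<open>ln (A + B e\<^sup>\<beta>\<^sup>x)\<close> with the other coordinates fixed, so the
  comparison of the laws at a single site extends to all sites. By induction it holds for the
  coordinates after the first, with the first one fixed; Fubini's theorem then allows the first one
  to be exchanged, with the others fixed.\<close>

lemma shift_le_tilt:
  assumes site: "\<And>A B. A \<ge> 0 \<Longrightarrow> B \<ge> 0 \<Longrightarrow> A + B > 0 \<Longrightarrow>
      (\<integral>x. ln (A + B * exp (\<beta> * (x + \<theta>))) \<partial>\<mu>) \<le> (\<integral>x. ln (A + B * exp (\<beta> * x)) \<partial>\<nu>)"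
    and F: "F \<in> borel_measurable S"
    and bound: "D \<ge> 0" "\<And>v. \<bar>F v\<bar> \<le> C + D * (\<Sum>i<n. \<bar>v i\<bar>)"
    and loc: "\<And>v w. (\<And>i. i < n \<Longrightarrow> v i = w i) \<Longrightarrow> F v = F w"
    and affine: "\<And>k v. \<exists>A B. A \<ge> 0 \<and> B \<ge> 0 \<and> (\<forall>x. exp (F (v(k := x))) = A + B * exp (\<beta> * x))"
  shows "(\<integral>v. F (\<lambda>i. v i + \<theta>) \<partial>S) \<le> (\<integral>v. F v \<partial>N.S)"
  using F bound(2) loc affine
proof (induction n arbitrary: F C)
  case 0
  have "F v = F (\<lambda>_. 0)" for v by (rule "0.prems"(3)) simp
  then have F0: "F = (\<lambda>v. F (\<lambda>_. 0))" by (rule ext)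
  show ?case
    by (subst (1 2) F0) (simp add: P.prob_space[simplified] N.P.prob_space[simplified])
next
  case (Suc n)
  note measN = measurable_tilted_S
  interpret NS: pair_sigma_finite \<nu> S ..
  note F = Suc.prems(1)
  have iter: "(\<lambda>(x, v). case_nat x v) \<in> measurable (\<mu> \<Otimes>\<^sub>M S) S" by measurable
  have F2 [measurable]: "(\<lambda>(x, v). F (case_nat x v)) \<in> borel_measurable (\<mu> \<Otimes>\<^sub>M S)"
    using measurable_compose[OF iter F] by (simp add: split_beta')
  have Fx: "(\<lambda>v. F (case_nat x v)) \<in> borel_measurable S" for x
    using measurable_compose[OF measurable_Pair1'[of x \<mu> S] F2] by simp
  have shift: "(\<lambda>v i. v i + \<theta>) \<in> measurable S S"
  proof (rule measurable_PiM_single')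
    show "(\<lambda>v. v i + \<theta>) \<in> measurable S \<mu>" for i
      using coordinate_measurable[of i] unfolding measurable_cong_sets[OF refl sets_law] by measurable
  qed auto
  have shift2: "(\<lambda>(x, v). (x, \<lambda>i. v i + \<theta>)) \<in> measurable (\<nu> \<Otimes>\<^sub>M S) (\<mu> \<Otimes>\<^sub>M S)"
  proof -
    have "(\<lambda>p. (fst p, (\<lambda>v i. v i + \<theta>) (snd p))) \<in> measurable (\<nu> \<Otimes>\<^sub>M S) (\<mu> \<Otimes>\<^sub>M S)"
      by (intro measurable_Pair measurable_compose[OF measurable_snd shift]) simp
    then show ?thesis by (simp add: split_beta')
  qed
  have Fi: "integrable S F" by (rule integrable_linear_bound[OF F Suc.prems(2)])
  have FNi: "integrable N.S F"
  proof (rule Bochner_Integration.integrable_bound)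
    show "integrable N.S (\<lambda>v. C + D * (\<Sum>i<Suc n. \<bar>v i\<bar>))"
      by (intro Bochner_Integration.integrable_add integrable_mult_right Bochner_Integration.integrable_sum
          N.integrable_coordinate[OF integrable_abs[OF N.first_moment]]) simp
    show "AE v in N.S. norm (F v) \<le> norm (C + D * (\<Sum>i<Suc n. \<bar>v i\<bar>))"
      using Suc.prems(2) by (intro AE_I2) (auto intro: order_trans[OF _ abs_ge_self])
  qed (use F measN in auto)
  have bound1: "\<bar>F (case_nat x v)\<bar> \<le> (C + D * \<bar>x\<bar>) + D * (\<Sum>i<n. \<bar>v i\<bar>)" for x v
    using Suc.prems(2)[of "case_nat x v"] unfolding sum.lessThan_Suc_shift by (simp add: algebra_simps)
  have IH: "(\<integral>v. F (case_nat x (\<lambda>i. v i + \<theta>)) \<partial>S) \<le> (\<integral>v. F (case_nat x v) \<partial>N.S)" for x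
  proof (rule Suc.IH[OF Fx bound1])
    show "F (case_nat x v) = F (case_nat x w)" if "\<And>i. i < n \<Longrightarrow> v i = w i" for v w
      by (rule Suc.prems(3)) (auto simp: that split: nat.split)
    show "\<exists>A B. A \<ge> 0 \<and> B \<ge> 0 \<and> (\<forall>y. exp (F (case_nat x (v(k := y)))) = A + B * exp (\<beta> * y))" for k v
    proof -
      have "case_nat x (v(k := y)) = (case_nat x v)(Suc k := y)" for y
        by (auto simp: fun_eq_iff split: nat.split)
      then show ?thesis using Suc.prems(4)[of "case_nat x v" "Suc k"] by (simp del: fun_upd_apply)
    qed
  qed
  \<comment> \<open>Integrability on the product space, needed to exchange the two integrals.\<close>
  have prod_int: "integrable (\<nu> \<Otimes>\<^sub>M S) (\<lambda>(x, v). F (case_nat x (\<lambda>i. v i + \<theta>)))"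
  proof (rule Bochner_Integration.integrable_bound)
    let ?b = "\<lambda>x v. \<bar>C\<bar> + D * \<bar>x\<bar> + D * (\<Sum>i<n. \<bar>v i + \<theta>\<bar>)"
    have bi: "integrable S (\<lambda>v. D * (\<Sum>i<n. \<bar>v i + \<theta>\<bar>))"
      by (intro integrable_mult_right Bochner_Integration.integrable_sum
          integrable_coordinate[where f="\<lambda>x. \<bar>x + \<theta>\<bar>"] integrable_abs
          Bochner_Integration.integrable_add first_moment) simp
    have b_nonneg: "?b x v \<ge> 0" for x v
      using bound(1) by (intro add_nonneg_nonneg mult_nonneg_nonneg sum_nonneg) auto
    show "integrable (\<nu> \<Otimes>\<^sub>M S) (\<lambda>(x, v). ?b x v)"
    proof (rule NS.Fubini_integrable)
      have [measurable]: "(\<lambda>p. snd p i) \<in> borel_measurable (\<nu> \<Otimes>\<^sub>M S)" for i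
        by (rule measurable_compose[OF measurable_snd coordinate_measurable])
      have [measurable]: "fst \<in> borel_measurable (\<nu> \<Otimes>\<^sub>M S)"
        using measurable_fst[of \<nu> S] by (simp add: measurable_cong_sets[OF refl N.sets_law])
      show "(\<lambda>(x, v). ?b x v) \<in> borel_measurable (\<nu> \<Otimes>\<^sub>M S)"
        unfolding split_beta' by measurable
      show "AE x in \<nu>. integrable S (\<lambda>v. case (x, v) of (x, v) \<Rightarrow> ?b x v)"
        using bi by simp
      have "(\<integral>v. norm (?b x v) \<partial>S) = \<bar>C\<bar> + D * \<bar>x\<bar> + (\<integral>v. D * (\<Sum>i<n. \<bar>v i + \<theta>\<bar>) \<partial>S)" for x
      proof -
        have "(\<integral>v. norm (?b x v) \<partial>S) = (\<integral>v. ?b x v \<partial>S)"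
          using b_nonneg by (intro Bochner_Integration.integral_cong) auto
        then show ?thesis using bi by (simp add: P.prob_space[simplified])
      qed
      then show "integrable \<nu> (\<lambda>x. \<integral>v. norm (case (x, v) of (x, v) \<Rightarrow> ?b x v) \<partial>S)"
        using N.first_moment by simp
    qed
    show "(\<lambda>(x, v). F (case_nat x (\<lambda>i. v i + \<theta>))) \<in> borel_measurable (\<nu> \<Otimes>\<^sub>M S)"
      using measurable_compose[OF shift2 F2] by (simp add: split_beta')
    show "AE p in \<nu> \<Otimes>\<^sub>M S. norm (case p of (x, v) \<Rightarrow> F (case_nat x (\<lambda>i. v i + \<theta>)))
        \<le> norm (case p of (x, v) \<Rightarrow> ?b x v)"
    proof (rule AE_I2)
      fix p :: "real \<times> (nat \<Rightarrow> real)"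
      obtain x v where p: "p = (x, v)" by (cases p)
      have "\<bar>F (case_nat x (\<lambda>i. v i + \<theta>))\<bar> \<le> ?b x v"
        using bound1[of x "\<lambda>i. v i + \<theta>"] by linarith
      also have "\<dots> = \<bar>?b x v\<bar>" using b_nonneg[of x v] by simp
      finally show "norm (case p of (x, v) \<Rightarrow> F (case_nat x (\<lambda>i. v i + \<theta>)))
        \<le> norm (case p of (x, v) \<Rightarrow> ?b x v)" unfolding p by simp
    qed
  qed
  have site': "(\<integral>x. F (case_nat (x + \<theta>) (\<lambda>i. v i + \<theta>)) \<partial>\<mu>) \<le> (\<integral>x. F (case_nat x (\<lambda>i. v i + \<theta>)) \<partial>\<nu>)" for v
  proof -
    obtain A B where AB: "A \<ge> 0" "B \<ge> 0"
      "\<And>x. exp (F ((case_nat 0 (\<lambda>i. v i + \<theta>))(0 := x))) = A + B * exp (\<beta> * x)"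
      using Suc.prems(4)[of "case_nat 0 (\<lambda>i. v i + \<theta>)" 0] by blast
    have upd: "(case_nat 0 (\<lambda>i. v i + \<theta>))(0 := x) = case_nat x (\<lambda>i. v i + \<theta>)" for x
      by (auto simp: fun_eq_iff split: nat.split)
    have Fln: "F (case_nat x (\<lambda>i. v i + \<theta>)) = ln (A + B * exp (\<beta> * x))" for x
      using AB(3)[of x] unfolding upd by (metis ln_exp)
    have "A + B * exp (\<beta> * 0) > 0" using AB(3)[of 0] by (metis exp_gt_zero)
    then show ?thesis unfolding Fln by (intro site AB) simp
  qed
  have Fsi: "integrable S (\<lambda>v. F (\<lambda>i. v i + \<theta>))"
  proof (rule integrable_linear_bound[where C="C + D * (real (Suc n) * \<bar>\<theta>\<bar>)" and D=D])
    show "(\<lambda>v. F (\<lambda>i. v i + \<theta>)) \<in> borel_measurable S" by (rule measurable_compose[OF shift F])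
    fix v :: "nat \<Rightarrow> real"
    have "(\<Sum>i<Suc n. \<bar>v i + \<theta>\<bar>) \<le> (\<Sum>i<Suc n. \<bar>v i\<bar> + \<bar>\<theta>\<bar>)" by (intro sum_mono) simp
    also have "\<dots> = (\<Sum>i<Suc n. \<bar>v i\<bar>) + real (Suc n) * \<bar>\<theta>\<bar>" by (simp only: sum.distrib) simp
    finally have "D * (\<Sum>i<Suc n. \<bar>v i + \<theta>\<bar>) \<le> D * ((\<Sum>i<Suc n. \<bar>v i\<bar>) + real (Suc n) * \<bar>\<theta>\<bar>)"
      using bound(1) by (rule mult_left_mono)
    then show "\<bar>F (\<lambda>i. v i + \<theta>)\<bar> \<le> C + D * (real (Suc n) * \<bar>\<theta>\<bar>) + D * (\<Sum>i<Suc n. \<bar>v i\<bar>)"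
      using Suc.prems(2)[of "\<lambda>i. v i + \<theta>"] by (simp only: distrib_left)
  qed
  have case_shift: "(\<lambda>i. case_nat x v i + \<theta>) = case_nat (x + \<theta>) (\<lambda>i. v i + \<theta>)" for x :: real and v
    by (auto simp: fun_eq_iff split: nat.split)
  interpret MS: pair_sigma_finite \<mu> S ..
  have "(\<integral>v. F (\<lambda>i. v i + \<theta>) \<partial>S) = (\<integral>v. \<integral>x. F (case_nat (x + \<theta>) (\<lambda>i. v i + \<theta>)) \<partial>\<mu> \<partial>S)"
    by (subst integral_iter(3)[OF Fsi]) (simp only: case_shift)
  also have "\<dots> \<le> (\<integral>v. \<integral>x. F (case_nat x (\<lambda>i. v i + \<theta>)) \<partial>\<nu> \<partial>S)"
  proof (rule integral_mono[OF _ _ site'])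
    have "integrable (\<mu> \<Otimes>\<^sub>M S) (\<lambda>(x, v). F (case_nat (x + \<theta>) (\<lambda>i. v i + \<theta>)))"
      using integral_iter(1)[OF Fsi] by (simp only: case_shift)
    from MS.integrable_snd[OF this]
    show "integrable S (\<lambda>v. \<integral>x. F (case_nat (x + \<theta>) (\<lambda>i. v i + \<theta>)) \<partial>\<mu>)" .
    from NS.integrable_snd[OF prod_int]
    show "integrable S (\<lambda>v. \<integral>x. F (case_nat x (\<lambda>i. v i + \<theta>)) \<partial>\<nu>)" .
  qed
  also have "\<dots> = (\<integral>x. \<integral>v. F (case_nat x (\<lambda>i. v i + \<theta>)) \<partial>S \<partial>\<nu>)"
    by (rule NS.Fubini_integral[OF prod_int])
  also have "\<dots> \<le> (\<integral>x. \<integral>v. F (case_nat x v) \<partial>N.S \<partial>\<nu>)"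
  proof (rule integral_mono[OF _ _ IH])
    from NS.integrable_fst[OF prod_int]
    show "integrable \<nu> (\<lambda>x. \<integral>v. F (case_nat x (\<lambda>i. v i + \<theta>)) \<partial>S)" .
    interpret NN: pair_sigma_finite \<nu> N.S ..
    from NN.integrable_fst[OF N.integral_iter(1)[OF FNi]]
    show "integrable \<nu> (\<lambda>x. \<integral>v. F (case_nat x v) \<partial>N.S)" .
  qed
  also have "\<dots> = (\<integral>v. F v \<partial>N.S)" by (rule N.integral_iter(2)[OF FNi, symmetric])
  finally show ?case .
qed

lemma mean_ln_shift_le_tilt:
  assumes "\<And>A B. A \<ge> 0 \<Longrightarrow> B \<ge> 0 \<Longrightarrow> A + B > 0 \<Longrightarrow>
      (\<integral>x. ln (A + B * exp (\<beta> * (x + \<theta>))) \<partial>\<mu>) \<le> (\<integral>x. ln (A + B * exp (\<beta> * x)) \<partial>\<nu>)"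
  shows "mean_ln (h + \<beta> * \<theta>) n \<le> N.mean_ln h n"
proof -
  have "mean_ln (h + \<beta> * \<theta>) n = (\<integral>v. ln_zcon h n (\<lambda>i. v i + \<theta>) \<partial>S)"
    unfolding mean_ln_def by (simp add: algebra_simps)
  also have "\<dots> \<le> (\<integral>v. ln_zcon h n v \<partial>N.S)"
  proof (rule shift_le_tilt[where C="\<bar>ln (K n)\<bar> + real n * \<bar>h\<bar>" and D=\<beta> and n=n])
    fix v :: "nat \<Rightarrow> real"
    have "(\<Sum>i<n. \<bar>h + \<beta> * v i\<bar>) \<le> (\<Sum>i<n. \<bar>h\<bar> + \<beta> * \<bar>v i\<bar>)"
    proof (intro sum_mono)
      fix i
      show "\<bar>h + \<beta> * v i\<bar> \<le> \<bar>h\<bar> + \<beta> * \<bar>v i\<bar>"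
        using abs_triangle_ineq[of h "\<beta> * v i"] beta_pos by (simp add: abs_mult)
    qed
    also have "\<dots> = real n * \<bar>h\<bar> + \<beta> * (\<Sum>i<n. \<bar>v i\<bar>)"
      by (simp add: sum.distrib sum_distrib_left)
    finally show "\<bar>ln_zcon h n v\<bar> \<le> \<bar>ln (K n)\<bar> + real n * \<bar>h\<bar> + \<beta> * (\<Sum>i<n. \<bar>v i\<bar>)"
      using ln_zcon_abs_le[of "\<lambda>i. h + \<beta> * v i" n] by linarith
  next
    fix k and v :: "nat \<Rightarrow> real"
    obtain A B where AB: "A \<ge> 0" "B \<ge> 0" "\<And>x. zcon K ((\<lambda>i. h + \<beta> * v i)(k := x)) n = A + B * exp x"
      using zcon_affine_coordinate[of K "\<lambda>i. h + \<beta> * v i" k n] K_nonneg by blast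
    show "\<exists>A B. A \<ge> 0 \<and> B \<ge> 0 \<and> (\<forall>x. exp (ln_zcon h n (v(k := x))) = A + B * exp (\<beta> * x))"
    proof (rule exI[of _ A], rule exI[of _ "B * exp h"], intro conjI allI)
      fix x
      have "(\<lambda>i. h + \<beta> * (v(k := x)) i) = (\<lambda>i. h + \<beta> * v i)(k := h + \<beta> * x)" by auto
      then have "zcon K (\<lambda>i. h + \<beta> * (v(k := x)) i) n = A + B * exp (h + \<beta> * x)"
        using AB(3) by metis
      then have "exp (ln_zcon h n (v(k := x))) = A + B * exp (h + \<beta> * x)"
        using zcon_pos by (metis exp_ln)
      then show "exp (ln_zcon h n (v(k := x))) = A + (B * exp h) * exp (\<beta> * x)"
        by (simp add: exp_add mult.assoc)
    qed (use AB in auto)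
  qed (use assms beta_pos in \<open>auto intro: ln_zcon_cong\<close>)
  finally show ?thesis unfolding N.mean_ln_def .
qed

end

text \<open>A tilt does at least as much for every single site as a shift of the environment by \<open>\<theta>\<close>, at
  an entropy cost of second order in \<open>\<theta>\<close>.\<close>

definition admissible_tilt :: "real measure \<Rightarrow> real \<Rightarrow> real \<Rightarrow> real \<Rightarrow> (real \<Rightarrow> real) \<Rightarrow> bool" where
  "admissible_tilt \<mu> \<beta> C \<theta> g \<longleftrightarrow> tilted_law \<mu> g
     \<and> integrable (density \<mu> (\<lambda>x. ennreal (g x))) (\<lambda>x. x\<^sup>2)
     \<and> (\<integral>x. ln (g x) \<partial>density \<mu> (\<lambda>x. ennreal (g x))) \<le> C * \<theta>\<^sup>2
     \<and> (\<forall>A B. A \<ge> 0 \<longrightarrow> B \<ge> 0 \<longrightarrow> A + B > 0 \<longrightarrow>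
          (\<integral>x. ln (A + B * exp (\<beta> * (x + \<theta>))) \<partial>\<mu>)
          \<le> (\<integral>x. ln (A + B * exp (\<beta> * x)) \<partial>density \<mu> (\<lambda>x. ennreal (g x))))"

definition tiltable :: "real measure \<Rightarrow> real \<Rightarrow> bool" where
  "tiltable \<mu> \<beta> \<longleftrightarrow> (\<exists>C\<ge>0. \<exists>\<theta>\<^sub>0>0. \<forall>\<theta>. 0 < \<theta> \<longrightarrow> \<theta> \<le> \<theta>\<^sub>0 \<longrightarrow> (\<exists>g. admissible_tilt \<mu> \<beta> C \<theta> g))"

text \<open>Smoothing in finite volume. Raising \<open>h\<close> by \<open>\<delta>\<close> is a shift of the environment by \<open>\<delta> / \<beta>\<close>, which a
  tilt of entropy \<open>O(\<delta>\<^sup>2)\<close> per site dominates; and the rare-stretch strategy bounds the tilted mean by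
  the total entropy when there is no localisation at \<open>h\<close>.\<close>

theorem (in pinned_law) quadratic_smoothing:
  assumes "tiltable \<mu> \<beta>"
    and "c > 0" "a \<ge> 0" "\<And>j. j \<ge> 1 \<Longrightarrow> c * real j powr (- a) \<le> K j"
  shows "\<exists>C\<ge>0. \<exists>\<delta>\<^sub>0>0. \<forall>h. (\<forall>M. mean_ln h M \<le> 0) \<longrightarrow>
    (\<forall>\<delta> n. 0 < \<delta> \<longrightarrow> \<delta> \<le> \<delta>\<^sub>0 \<longrightarrow> mean_ln (h + \<delta>) n \<le> C * real n * \<delta>\<^sup>2)"
proof -
  obtain C \<theta>0 where C: "C \<ge> 0" "\<theta>0 > 0"
    and tilt: "\<And>\<theta>. 0 < \<theta> \<Longrightarrow> \<theta> \<le> \<theta>0 \<Longrightarrow> \<exists>g. admissible_tilt \<mu> \<beta> C \<theta> g"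
    using assms(1) unfolding tiltable_def by blast
  define D where "D = 64 * a * C / \<beta>\<^sup>2"
  have D: "D \<ge> 0" "0 < \<beta> * \<theta>0" using C assms beta_pos by (auto simp: D_def)
  have "mean_ln (h + \<delta>) n \<le> D * real n * \<delta>\<^sup>2"
    if sub: "\<forall>M. mean_ln h M \<le> 0" and \<delta>: "0 < \<delta>" "\<delta> \<le> \<beta> * \<theta>0" for h \<delta> n
  proof -
    define \<theta> where "\<theta> = \<delta> / \<beta>"
    have \<theta>: "0 < \<theta>" "\<theta> \<le> \<theta>0" "\<beta> * \<theta> = \<delta>" using \<delta> beta_pos by (auto simp: \<theta>_def field_simps)
    obtain g where g: "tilted_law \<mu> g" "integrable (density \<mu> (\<lambda>x. ennreal (g x))) (\<lambda>x. x\<^sup>2)"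
      "(\<integral>x. ln (g x) \<partial>density \<mu> (\<lambda>x. ennreal (g x))) \<le> C * \<theta>\<^sup>2"
      "\<And>A B. A \<ge> 0 \<Longrightarrow> B \<ge> 0 \<Longrightarrow> A + B > 0 \<Longrightarrow>
          (\<integral>x. ln (A + B * exp (\<beta> * (x + \<theta>))) \<partial>\<mu>)
          \<le> (\<integral>x. ln (A + B * exp (\<beta> * x)) \<partial>density \<mu> (\<lambda>x. ennreal (g x)))"
      using tilt[OF \<theta>(1,2)] unfolding admissible_tilt_def by blast
    interpret T: tilted_law \<mu> g by (rule g(1))
    interpret T: tilted_pinned_law K \<mu> \<beta> g by unfold_locales (rule g(2))
    have "mean_ln (h + \<delta>) n \<le> T.N.mean_ln h n"
      using T.mean_ln_shift_le_tilt[OF g(4), of h n] \<theta>(3) by simp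
    also have "\<dots> \<le> 64 * a * real n * (C * \<theta>\<^sup>2)"
      by (rule T.tilted_mean_ln_le[where c=c]) (use assms g(3) C sub in \<open>auto simp: T.rel_entropy_def\<close>)
    also have "\<dots> = D * real n * \<delta>\<^sup>2"
      using beta_pos by (simp add: \<theta>_def D_def power_divide)
    finally show ?thesis .
  qed
  with D show ?thesis by blast
qed

section \<open>Laws that can be tilted\<close>

text \<open>The complement of the support is the union of all open null sets, and countably many of them
  cover it.\<close>

lemma bounded_law_support_AE:
  fixes \<mu> :: "real measure"
  assumes sets: "sets \<mu> = sets borel" and bdd: "bounded (law_support \<mu>)"
  obtains M where "M \<ge> 1" "AE x in \<mu>. \<bar>x\<bar> \<le> M"
proof -
  define \<F> where "\<F> = {U :: real set. open U \<and> emeasure \<mu> U = 0}"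
  obtain \<F>' where \<F>': "\<F>' \<subseteq> \<F>" "countable \<F>'" "\<Union>\<F>' = \<Union>\<F>"
    by (rule Lindelof[of \<F>]) (auto simp: \<F>_def)
  have "(\<Union>U\<in>\<F>'. U) \<in> null_sets \<mu>"
    by (rule null_sets_UN'[OF \<F>'(2)]) (use \<F>'(1) in \<open>auto simp: \<F>_def null_sets_def sets\<close>)
  then have AE: "AE x in \<mu>. x \<notin> \<Union>\<F>" using \<F>'(3) by (auto dest: AE_not_in)
  obtain M where M: "\<And>x. x \<in> law_support \<mu> \<Longrightarrow> norm x \<le> M"
    using bdd unfolding bounded_iff by blast
  have "x \<in> law_support \<mu>" if "x \<notin> \<Union>\<F>" for x
    using that unfolding law_support_def \<F>_def by (auto simp: zero_less_iff_neq_zero)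
  with AE M have "AE x in \<mu>. \<bar>x\<bar> \<le> max 1 M" by (auto elim!: eventually_mono intro: max.coboundedI2)
  then show thesis by (intro that[of "max 1 M"]) auto
qed

text \<open>The response \<open>\<phi>'\<close> of \<open>\<phi> x = ln (A + B e\<^sup>\<beta>\<^sup>x)\<close> varies on a bounded interval
  by a bounded factor only, whatever \<open>A\<close> and \<open>B\<close> are.\<close>

lemma log_affine_increment:
  fixes A B \<beta> M x y :: real
  assumes AB: "A \<ge> 0" "B \<ge> 0" "A + B > 0" and \<beta>: "\<beta> > 0"
    and xy: "- M \<le> x" "x \<le> y" "y \<le> M + 1"
  defines "q \<equiv> B * exp (- \<beta> * M) / (A + B * exp (- \<beta> * M))"
  shows "\<beta> * q * (y - x) \<le> ln (A + B * exp (\<beta> * y)) - ln (A + B * exp (\<beta> * x))"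
    and "ln (A + B * exp (\<beta> * y)) - ln (A + B * exp (\<beta> * x)) \<le> \<beta> * exp (\<beta> * (2 * M + 1)) * q * (y - x)"
proof -
  have pos: "A + B * exp t > 0" for t
    using AB by (cases "A > 0") (auto intro: add_pos_nonneg)
  define D where "D z = \<beta> * (B * exp (\<beta> * z) / (A + B * exp (\<beta> * z)))" for z
  have deriv: "((\<lambda>z. ln (A + B * exp (\<beta> * z))) has_real_derivative D z) (at z)" for z
    unfolding D_def using pos[of "\<beta> * z"] by (auto intro!: derivative_eq_intros)
  have lower: "\<beta> * q \<le> D z" if "- M \<le> z" for z
  proof -
    have "\<beta> * (- M) \<le> \<beta> * z" using that \<beta> by (intro mult_left_mono) auto
    then have "exp (- \<beta> * M) \<le> exp (\<beta> * z)" by simp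
    then have "B * exp (- \<beta> * M) * A \<le> B * exp (\<beta> * z) * A" using AB by (intro mult_right_mono mult_left_mono) auto
    then have "q \<le> B * exp (\<beta> * z) / (A + B * exp (\<beta> * z))"
      unfolding q_def using pos[of "\<beta> * z"] pos[of "- \<beta> * M"] by (simp add: divide_simps algebra_simps)
    then show ?thesis unfolding D_def using \<beta> by (intro mult_left_mono) auto
  qed
  have upper: "D z \<le> \<beta> * exp (\<beta> * (2 * M + 1)) * q" if "- M \<le> z" "z \<le> M + 1" for z
  proof -
    have "\<beta> * (- M) \<le> \<beta> * z" using that \<beta> by (intro mult_left_mono) auto
    then have e1: "exp (- \<beta> * M) \<le> exp (\<beta> * z)" by simp
    have e2: "exp (\<beta> * z) \<le> exp (\<beta> * (2 * M + 1)) * exp (- \<beta> * M)"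
    proof -
      have "\<beta> * z \<le> \<beta> * (M + 1)" using that \<beta> by (intro mult_left_mono) auto
      then show ?thesis by (simp add: algebra_simps flip: exp_add)
    qed
    have "B * exp (\<beta> * z) / (A + B * exp (\<beta> * z)) \<le> B * exp (\<beta> * z) / (A + B * exp (- \<beta> * M))"
      using AB pos[of "\<beta> * z"] pos[of "- \<beta> * M"] e1 by (intro divide_left_mono add_left_mono mult_left_mono) auto
    also have "\<dots> \<le> B * (exp (\<beta> * (2 * M + 1)) * exp (- \<beta> * M)) / (A + B * exp (- \<beta> * M))"
      using AB pos[of "- \<beta> * M"] e2 by (intro divide_right_mono mult_left_mono) auto
    also have "\<dots> = exp (\<beta> * (2 * M + 1)) * q" unfolding q_def by simp
    finally have "\<beta> * (B * exp (\<beta> * z) / (A + B * exp (\<beta> * z))) \<le> \<beta> * (exp (\<beta> * (2 * M + 1)) * q)"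
      using \<beta> by (intro mult_left_mono) auto
    then show ?thesis unfolding D_def by (simp only: mult.assoc)
  qed
  have "\<exists>z. x \<le> z \<and> z \<le> y \<and> ln (A + B * exp (\<beta> * y)) - ln (A + B * exp (\<beta> * x)) = (y - x) * D z"
  proof (cases "x = y")
    case False
    then obtain z where "x < z" "z < y"
      "ln (A + B * exp (\<beta> * y)) - ln (A + B * exp (\<beta> * x)) = (y - x) * D z"
      using MVT2[of x y "\<lambda>z. ln (A + B * exp (\<beta> * z))" D] deriv xy by auto
    then show ?thesis by (intro exI[of _ z]) auto
  qed auto
  then obtain z where z: "x \<le> z" "z \<le> y"
    "ln (A + B * exp (\<beta> * y)) - ln (A + B * exp (\<beta> * x)) = (y - x) * D z" by blast
  have "(y - x) * (\<beta> * q) \<le> (y - x) * D z" using xy z by (intro mult_left_mono lower) auto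
  then show "\<beta> * q * (y - x) \<le> ln (A + B * exp (\<beta> * y)) - ln (A + B * exp (\<beta> * x))"
    unfolding z(3) by (simp add: mult.commute)
  have "(y - x) * D z \<le> (y - x) * (\<beta> * exp (\<beta> * (2 * M + 1)) * q)" using xy z by (intro mult_left_mono upper) auto
  then show "ln (A + B * exp (\<beta> * y)) - ln (A + B * exp (\<beta> * x)) \<le> \<beta> * exp (\<beta> * (2 * M + 1)) * q * (y - x)"
    unfolding z(3) by (simp add: mult.commute)
qed

text \<open>The tilt has density \<open>1 + s x\<close> on the support. As the mean is zero and the variance one, its entropy is at most
  \<open>s\<^sup>2\<close>, whereas the integral of \<open>\<phi>\<close> increases by \<open>s\<close> times the covariance of \<open>x\<close> and \<open>\<phi> x\<close>, which is
  of first order in \<open>s\<close> and comparable with the response to a shift.\<close>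

lemma tiltable_of_bounded:
  fixes \<mu> :: "real measure"
  assumes "prob_space \<mu>" and sets [measurable_cong]: "sets \<mu> = sets borel"
    and M: "M \<ge> 1" "AE x in \<mu>. \<bar>x\<bar> \<le> M"
    and mean: "(\<integral>x. x \<partial>\<mu>) = 0" and var: "(\<integral>x. x\<^sup>2 \<partial>\<mu>) = 1" and \<beta>: "\<beta> > 0"
  shows "tiltable \<mu> \<beta>"
proof -
  interpret prob_space \<mu> by fact
  have bdd_int: "integrable \<mu> f" if f: "f \<in> borel_measurable borel"
    and b: "\<And>x. \<bar>x\<bar> \<le> M \<Longrightarrow> \<bar>f x\<bar> \<le> k" for f :: "real \<Rightarrow> real" and k
  proof (rule integrable_const_bound[where B=k])
    show "AE x in \<mu>. norm (f x) \<le> k" using M(2) by eventually_elim (simp add: b)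
  qed (simp add: f measurable_cong_sets[OF sets refl])
  define E where "E = exp (\<beta> * (2 * M + 1))"
  have E: "E > 0" unfolding E_def by simp
  define \<theta>0 where "\<theta>0 = min 1 (1 / (2 * M * E))"
  have \<theta>0: "\<theta>0 > 0" unfolding \<theta>0_def using M E by simp
  have tilt: "\<exists>g. admissible_tilt \<mu> \<beta> (E\<^sup>2) \<theta> g"
    if \<theta>: "0 < \<theta>" "\<theta> \<le> \<theta>0" for \<theta>
  proof -
    define s where "s = \<theta> * E"
    have \<theta>1: "\<theta> \<le> 1" using \<theta> unfolding \<theta>0_def by simp
    have s: "s > 0" "s * M \<le> 1 / 2"
    proof -
      show "s > 0" unfolding s_def using \<theta> E by simp
      have "\<theta> \<le> 1 / (2 * M * E)" using \<theta> unfolding \<theta>0_def by simp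
      then show "s * M \<le> 1 / 2" unfolding s_def using M E by (simp add: field_simps)
    qed
    \<comment> \<open>Clamping \<open>x\<close> keeps the density positive off the support as well.\<close>
    define u where "u x = s * max (- M) (min M x)" for x
    define g where "g x = 1 + u x" for x
    have u_bound: "\<bar>u x\<bar> \<le> 1 / 2" for x
    proof -
      have "\<bar>max (- M) (min M x)\<bar> \<le> M" using M by auto
      then have "s * \<bar>max (- M) (min M x)\<bar> \<le> s * M" using s by (intro mult_left_mono) auto
      moreover have "\<bar>u x\<bar> = s * \<bar>max (- M) (min M x)\<bar>" unfolding u_def using s by (simp add: abs_mult)
      ultimately show ?thesis using s by linarith
    qed
    have u_eq: "AE x in \<mu>. u x = s * x" using M(2) by eventually_elim (auto simp: u_def)
    have [measurable]: "u \<in> borel_measurable borel" unfolding u_def by measurable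
    have [measurable]: "g \<in> borel_measurable borel" unfolding g_def by measurable
    have g_bounds: "1 / 2 \<le> g x" "g x \<le> 3 / 2" for x using u_bound[of x] unfolding g_def by auto
    have g_nonneg: "g x \<ge> 0" for x using g_bounds[of x] by simp
    have id_int: "integrable \<mu> (\<lambda>x. x)" by (rule bdd_int[of _ M]) auto
    have sq_int: "integrable \<mu> (\<lambda>x. x\<^sup>2)"
      by (rule bdd_int[of _ "M\<^sup>2"]) (auto simp: abs_le_square_iff[symmetric])
    have u_int: "integrable \<mu> u"
      by (rule bdd_int[of _ "1/2"]) (use u_bound in auto)
    have u2_int: "integrable \<mu> (\<lambda>x. (u x)\<^sup>2)"
    proof (rule bdd_int[of _ "(1/2)\<^sup>2"])
      show "\<bar>(u x)\<^sup>2\<bar> \<le> (1 / 2)\<^sup>2" for x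
        using u_bound[of x] by (metis abs_ge_zero abs_power2 power2_abs power_mono)
    qed simp
    have u_mean: "(\<integral>x. u x \<partial>\<mu>) = 0"
    proof -
      have "(\<integral>x. u x \<partial>\<mu>) = (\<integral>x. s * x \<partial>\<mu>)" by (rule integral_cong_AE) (use u_eq in auto)
      then show ?thesis using mean by simp
    qed
    have u_sq: "(\<integral>x. (u x)\<^sup>2 \<partial>\<mu>) = s\<^sup>2"
    proof -
      have "(\<integral>x. (u x)\<^sup>2 \<partial>\<mu>) = (\<integral>x. s\<^sup>2 * x\<^sup>2 \<partial>\<mu>)"
        by (rule integral_cong_AE) (use u_eq in \<open>auto simp: power_mult_distrib elim!: eventually_mono\<close>)
      then show ?thesis using var by simp
    qed
    define \<nu> where "\<nu> = density \<mu> (\<lambda>x. ennreal (g x))"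
    have \<nu>_int: "integrable \<nu> f \<longleftrightarrow> integrable \<mu> (\<lambda>x. g x * f x)"
      and \<nu>_integral: "(\<integral>x. f x \<partial>\<nu>) = (\<integral>x. g x * f x \<partial>\<mu>)"
      if "f \<in> borel_measurable borel" for f :: "real \<Rightarrow> real"
      unfolding \<nu>_def using that g_nonneg
      by (auto simp: integrable_density integral_density measurable_cong_sets[OF sets refl])
    have "prob_space \<nu>"
    proof
      have "emeasure \<nu> (space \<nu>) = (\<integral>\<^sup>+x. ennreal (g x) \<partial>\<mu>)"
        unfolding \<nu>_def by (subst emeasure_density) (auto intro!: nn_integral_cong)
      also have "\<dots> = ennreal (\<integral>x. g x \<partial>\<mu>)"
        by (rule nn_integral_eq_integral) (use u_int g_nonneg in \<open>auto simp: g_def[abs_def]\<close>)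
      also have "(\<integral>x. g x \<partial>\<mu>) = 1" unfolding g_def using u_int u_mean prob_space by simp
      finally show "emeasure \<nu> (space \<nu>) = 1" by simp
    qed
    have glng_int: "integrable \<mu> (\<lambda>x. g x * ln (g x))"
    proof (rule bdd_int[of _ "3 / 2 * 2"])
      show "\<bar>g x * ln (g x)\<bar> \<le> 3 / 2 * 2" for x
      proof -
        have "ln (g x) \<le> g x - 1" "- ln (g x) \<le> 1 / g x - 1"
          using g_bounds[of x] ln_le_minus_one[of "g x"] ln_le_minus_one[of "1 / g x"] by (auto simp: ln_div)
        moreover have "1 / g x \<le> 2" using g_bounds[of x] by (simp add: field_simps)
        ultimately have "\<bar>ln (g x)\<bar> \<le> 2" using g_bounds[of x] by linarith
        then show ?thesis unfolding abs_mult using g_bounds[of x] by (intro mult_mono) auto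
      qed
    qed simp
    then have "integrable \<nu> (\<lambda>x. ln (g x))" by (subst \<nu>_int) auto
    with \<open>prob_space \<nu>\<close> have "tilted_law \<mu> g"
      unfolding \<nu>_def
      by (intro tilted_law.intro iid_reals.intro iid_reals_axioms.intro tilted_law_axioms.intro
          prob_space_axioms sets \<open>g \<in> borel_measurable borel\<close> g_nonneg)
    moreover have "integrable \<nu> (\<lambda>x. x\<^sup>2)"
    proof (subst \<nu>_int)
      show "integrable \<mu> (\<lambda>x. g x * x\<^sup>2)"
      proof (rule bdd_int[of _ "3 / 2 * M\<^sup>2"])
        fix x assume "\<bar>x\<bar> \<le> M"
        then have "x\<^sup>2 \<le> M\<^sup>2" using M by (simp add: abs_le_square_iff[symmetric])
        then show "\<bar>g x * x\<^sup>2\<bar> \<le> 3 / 2 * M\<^sup>2"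
          unfolding abs_mult using g_bounds[of x] by (intro mult_mono) auto
      qed simp
    qed simp
    moreover have "(\<integral>x. ln (g x) \<partial>\<nu>) \<le> E\<^sup>2 * \<theta>\<^sup>2"
    proof -
      have "(\<integral>x. ln (g x) \<partial>\<nu>) = (\<integral>x. g x * ln (g x) \<partial>\<mu>)" by (subst \<nu>_integral) auto
      also have "\<dots> \<le> (\<integral>x. u x + (u x)\<^sup>2 \<partial>\<mu>)"
      proof (rule integral_mono_AE[OF glng_int])
        show "integrable \<mu> (\<lambda>x. u x + (u x)\<^sup>2)" using u_int u2_int by auto
        have "g x * ln (g x) \<le> g x * (g x - 1)" for x
          using g_bounds[of x] by (intro mult_left_mono ln_le_minus_one) auto
        then show "AE x in \<mu>. g x * ln (g x) \<le> u x + (u x)\<^sup>2"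
          by (simp add: g_def power2_eq_square algebra_simps)
      qed
      also have "\<dots> = s\<^sup>2" using u_int u2_int u_mean u_sq by simp
      finally show ?thesis unfolding s_def by (simp add: power_mult_distrib mult.commute)
    qed
    moreover have "(\<integral>x. ln (A + B * exp (\<beta> * (x + \<theta>))) \<partial>\<mu>) \<le> (\<integral>x. ln (A + B * exp (\<beta> * x)) \<partial>\<nu>)"
      if AB: "A \<ge> 0" "B \<ge> 0" "A + B > 0" for A B
    proof -
      define \<phi> where "\<phi> x = ln (A + B * exp (\<beta> * x))" for x
      have [measurable]: "\<phi> \<in> borel_measurable borel" unfolding \<phi>_def by measurable
      \<comment> \<open>\<open>\<beta> * q\<close> is the slope of \<open>\<phi>\<close> at \<open>- M\<close>, the smallest one on the support.\<close>
      define q where "q = B * exp (- \<beta> * M) / (A + B * exp (- \<beta> * M))"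
      have q: "q \<ge> 0" unfolding q_def using AB by (auto intro!: divide_nonneg_nonneg)
      note inc = log_affine_increment[OF AB \<beta>, where M=M, folded q_def \<phi>_def E_def]
      have \<phi>_dist: "\<bar>\<phi> x - \<phi> 0\<bar> \<le> \<beta> * E * q * (M + 1)" if "- M \<le> x" "x \<le> M + 1" for x
      proof -
        have b: "\<beta> * E * q \<ge> 0" using \<beta> E q by simp
        have b': "\<beta> * q \<ge> 0" using \<beta> q by simp
        show ?thesis
        proof (cases "x \<ge> 0")
          case True
          have "0 \<le> \<beta> * q * (x - 0)" by (rule mult_nonneg_nonneg[OF b']) (use True in simp)
          moreover have "\<beta> * E * q * (x - 0) \<le> \<beta> * E * q * (M + 1)" using b that by (intro mult_left_mono) auto
          ultimately show ?thesis using inc[of 0 x] that True M by auto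
        next
          case False
          have "0 \<le> \<beta> * q * (0 - x)" by (rule mult_nonneg_nonneg[OF b']) (use False in simp)
          moreover have "\<beta> * E * q * (0 - x) \<le> \<beta> * E * q * (M + 1)" using b that M by (intro mult_left_mono) auto
          ultimately show ?thesis using inc[of x 0] that False M by auto
        qed
      qed
      let ?C = "\<bar>\<phi> 0\<bar> + \<beta> * E * q * (M + 1)"
      have \<phi>_bound: "\<bar>\<phi> x\<bar> \<le> ?C" if "- M \<le> x" "x \<le> M + 1" for x
        using \<phi>_dist[OF that] by linarith
      have \<phi>_int: "integrable \<mu> \<phi>" by (rule bdd_int[of _ "?C"]) (auto intro!: \<phi>_bound)
      have \<phi>s_int: "integrable \<mu> (\<lambda>x. \<phi> (x + \<theta>))"
        by (rule bdd_int[of _ "?C"]) (use \<theta> \<theta>1 in \<open>auto intro!: \<phi>_bound\<close>)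
      have u\<phi>_int: "integrable \<mu> (\<lambda>x. u x * \<phi> x)"
      proof (rule bdd_int[of _ "1 / 2 * ?C"])
        fix x assume "\<bar>x\<bar> \<le> M"
        then show "\<bar>u x * \<phi> x\<bar> \<le> 1 / 2 * ?C"
          unfolding abs_mult using u_bound[of x] by (intro mult_mono \<phi>_bound) auto
      qed simp
      have "(\<integral>x. \<phi> (x + \<theta>) \<partial>\<mu>) - (\<integral>x. \<phi> x \<partial>\<mu>) = (\<integral>x. \<phi> (x + \<theta>) - \<phi> x \<partial>\<mu>)"
        using \<phi>_int \<phi>s_int by simp
      also have "\<dots> \<le> (\<integral>x. \<beta> * E * q * \<theta> \<partial>\<mu>)"
      proof (rule integral_mono_AE)
        show "AE x in \<mu>. \<phi> (x + \<theta>) - \<phi> x \<le> \<beta> * E * q * \<theta>"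
          using M(2)
        proof eventually_elim
          fix x assume "\<bar>x\<bar> \<le> M"
          then show "\<phi> (x + \<theta>) - \<phi> x \<le> \<beta> * E * q * \<theta>"
            using inc(2)[of x "x + \<theta>"] \<theta> \<theta>1 by auto
        qed
      qed (use \<phi>_int \<phi>s_int in auto)
      also have "\<dots> = (\<integral>x. s * \<beta> * q * x\<^sup>2 \<partial>\<mu>)"
        using prob_space var by (simp add: s_def)
      also have "\<dots> \<le> (\<integral>x. u x * \<phi> x - \<phi> 0 * u x \<partial>\<mu>)"
      proof (rule integral_mono_AE)
        show "AE x in \<mu>. s * \<beta> * q * x\<^sup>2 \<le> u x * \<phi> x - \<phi> 0 * u x"
          using M(2) u_eq
        proof eventually_elim
          fix x assume x: "\<bar>x\<bar> \<le> M" "u x = s * x"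
          have "\<beta> * q * x\<^sup>2 \<le> x * (\<phi> x - \<phi> 0)"
          proof (cases "x \<ge> 0")
            case True
            then have "\<beta> * q * (x - 0) \<le> \<phi> x - \<phi> 0" using x M by (intro inc(1)) auto
            then have "x * (\<beta> * q * (x - 0)) \<le> x * (\<phi> x - \<phi> 0)" using True by (rule mult_left_mono)
            then show ?thesis by (simp add: power2_eq_square mult_ac)
          next
            case False
            then have "\<beta> * q * (0 - x) \<le> \<phi> 0 - \<phi> x" using x M by (intro inc(1)) auto
            then have "(- x) * (\<beta> * q * (0 - x)) \<le> (- x) * (\<phi> 0 - \<phi> x)" using False by (intro mult_left_mono) auto
            then show ?thesis by (simp add: power2_eq_square algebra_simps)
          qed
          then have "s * (\<beta> * q * x\<^sup>2) \<le> s * (x * (\<phi> x - \<phi> 0))" using s by (intro mult_left_mono) auto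
          then show "s * \<beta> * q * x\<^sup>2 \<le> u x * \<phi> x - \<phi> 0 * u x" using x by (simp add: algebra_simps)
        qed
      qed (use sq_int u\<phi>_int u_int in auto)
      also have "\<dots> = (\<integral>x. u x * \<phi> x \<partial>\<mu>)" using u\<phi>_int u_int u_mean by simp
      finally have "(\<integral>x. \<phi> (x + \<theta>) \<partial>\<mu>) \<le> (\<integral>x. \<phi> x \<partial>\<mu>) + (\<integral>x. u x * \<phi> x \<partial>\<mu>)" by simp
      also have "\<dots> = (\<integral>x. g x * \<phi> x \<partial>\<mu>)" using \<phi>_int u\<phi>_int by (simp add: g_def algebra_simps)
      also have "\<dots> = (\<integral>x. \<phi> x \<partial>\<nu>)" by (subst \<nu>_integral) auto
      finally show ?thesis unfolding \<phi>_def .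
    qed
    ultimately show ?thesis unfolding admissible_tilt_def \<nu>_def by blast
  qed
  show ?thesis unfolding tiltable_def
    using \<theta>0 tilt zero_le_power2[of E] by blast
qed

text \<open>Since \<open>a ln (a / b) \<ge> a - b\<close>, the negative part of the integrand has integral at most \<open>1\<close>. An upper
  bound on the extended integral therefore makes the positive part integrable too; in particular the
  value \<open>\<infinity>\<close>, taken where \<open>b\<close> vanishes and \<open>a\<close> does not, occurs on a null set only.\<close>

lemma finite_entropy_integrable:
  fixes a b :: "real \<Rightarrow> real"
  assumes [measurable]: "a \<in> borel_measurable borel" "b \<in> borel_measurable borel"
    and nonneg: "\<And>x. a x \<ge> 0" "\<And>x. b x \<ge> 0"
    and b_prob: "(\<integral>\<^sup>+y. ennreal (b y) \<partial>lborel) = 1"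
    and ent: "extended_integral lborel (\<lambda>y. entropy_integrand (a y) (b y)) \<le> ereal r"
  shows "AE y in lborel. b y = 0 \<longrightarrow> a y = 0"
    and "integrable lborel (\<lambda>y. a y * ln (a y / b y))"
    and "(\<integral>y. a y * ln (a y / b y) \<partial>lborel) \<le> r"
proof -
  define E where "E y = entropy_integrand (a y) (b y)" for y
  define f where "f y = a y * ln (a y / b y)" for y
  have [measurable]: "E \<in> borel_measurable borel"
    unfolding E_def entropy_integrand_def by measurable
  have [measurable]: "f \<in> borel_measurable borel" unfolding f_def by measurable
  let ?pos = "\<integral>\<^sup>+y. e2ennreal (E y) \<partial>lborel" and ?neg = "\<integral>\<^sup>+y. e2ennreal (- E y) \<partial>lborel"
  have "?neg \<le> (\<integral>\<^sup>+y. ennreal (b y) \<partial>lborel)"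
  proof (intro nn_integral_mono)
    fix y
    consider "a y = 0" | "a y > 0" "b y = 0" | "a y > 0" "b y > 0"
      using nonneg[of y] by (auto simp: less_le)
    then show "e2ennreal (- E y) \<le> ennreal (b y)"
    proof cases
      case 3
      have "a y * ln (b y / a y) \<le> a y * (b y / a y - 1)"
        using 3 by (intro mult_left_mono ln_le_minus_one) auto
      also have "\<dots> \<le> b y" using 3 by (simp add: algebra_simps)
      finally have "- (a y * ln (a y / b y)) \<le> b y" using 3 by (simp add: ln_div algebra_simps)
      then show ?thesis using 3 unfolding E_def entropy_integrand_def
        by (simp add: e2ennreal_ereal ennreal_leI)
    qed (auto simp: E_def entropy_integrand_def e2ennreal_neg)
  qed
  then have neg: "?neg \<le> 1" using b_prob by simp
  have "?neg < \<infinity>" using neg by (rule le_less_trans) simp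
  then have neg_fin: "?neg \<noteq> \<infinity>" by simp
  have le: "enn2ereal ?pos - enn2ereal ?neg \<le> ereal r"
    using ent unfolding extended_integral_def E_def .
  have pos_fin: "?pos \<noteq> \<infinity>"
  proof
    assume "?pos = \<infinity>"
    then have "enn2ereal ?pos - enn2ereal ?neg = \<infinity>"
      using neg_fin by (cases "?neg") auto
    with le show False by simp
  qed
  have "AE y in lborel. e2ennreal (E y) \<noteq> \<infinity>"
    by (rule nn_integral_PInf_AE) (use pos_fin in auto)
  then have E_fin: "AE y in lborel. b y = 0 \<longrightarrow> a y = 0"
  proof eventually_elim
    case (elim y)
    then show ?case by (auto simp: E_def entropy_integrand_def split: if_splits)
  qed
  then show "AE y in lborel. b y = 0 \<longrightarrow> a y = 0" .
  have Ef: "AE y in lborel. E y = ereal (f y)"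
    using E_fin by eventually_elim (auto simp: E_def f_def entropy_integrand_def)
  have pos: "(\<integral>\<^sup>+y. ennreal (f y) \<partial>lborel) = ?pos"
    using Ef by (intro nn_integral_cong_AE) (auto elim!: eventually_mono simp: e2ennreal_ereal)
  have neg: "(\<integral>\<^sup>+y. ennreal (- f y) \<partial>lborel) = ?neg"
    using Ef by (intro nn_integral_cong_AE) (auto elim!: eventually_mono simp: e2ennreal_ereal)
  have fi: "integrable lborel f"
    unfolding real_integrable_def pos neg using pos_fin neg_fin by simp
  then show "integrable lborel (\<lambda>y. a y * ln (a y / b y))" unfolding f_def .
  have "(\<integral>y. f y \<partial>lborel) = enn2real ?pos - enn2real ?neg"
    using real_lebesgue_integral_def[OF fi] unfolding pos neg .
  moreover have "ereal (enn2real ?pos - enn2real ?neg) = enn2ereal ?pos - enn2ereal ?neg"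
    using pos_fin neg_fin by (cases "?pos"; cases "?neg") auto
  ultimately have "ereal (\<integral>y. f y \<partial>lborel) \<le> ereal r" using le by simp
  then show "(\<integral>y. a y * ln (a y / b y) \<partial>lborel) \<le> r" unfolding f_def by simp
qed

text \<open>Here the tilted law is the translate of the original one, so the comparison is an
  equality and the hypothesis bounds the entropy.\<close>

lemma tiltable_of_smooth_density:
  assumes Q: "prob_space Q" and smooth: "smooth_density_condition Q X"
    and sq: "integrable (distr Q borel X) (\<lambda>x. x\<^sup>2)"
  shows "tiltable (distr Q borel X) \<beta>"
proof -
  obtain d R where d_nonneg: "\<And>x. d x \<ge> 0" and dist: "distributed Q lborel X (\<lambda>x. ennreal (d x))"
    and R: "\<And>x. extended_integral lborel (\<lambda>y. entropy_integrand (d (x + y)) (d y)) \<le> ereal (R * x\<^sup>2)"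
    using smooth unfolding smooth_density_condition_def by blast
  define \<mu> where "\<mu> = distr Q borel X"
  have X [measurable]: "X \<in> borel_measurable Q" using distributed_measurable[OF dist] by simp
  have d_meas [measurable]: "d \<in> borel_measurable borel"
    using distributed_real_measurable[OF d_nonneg dist] by simp
  have \<mu>: "\<mu> = density lborel (\<lambda>x. ennreal (d x))"
    unfolding \<mu>_def using distributed_distr_eq_density[OF dist] by (simp cong: distr_cong)
  interpret prob_space \<mu>
    unfolding \<mu>_def by (rule prob_space.prob_space_distr[OF Q]) simp
  have sets: "sets \<mu> = sets borel" unfolding \<mu>_def by simp
  have d_prob: "(\<integral>\<^sup>+y. ennreal (d y) \<partial>lborel) = 1"
    using emeasure_space_1 unfolding \<mu> by (simp add: emeasure_density)
  have tilt: "\<exists>g. admissible_tilt \<mu> \<beta> \<bar>R\<bar> \<theta> g" for \<theta> :: real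
  proof -
    define a where "a y = d (- \<theta> + y)" for y
    have a_nonneg: "a y \<ge> 0" for y unfolding a_def by (rule d_nonneg)
    have [measurable]: "a \<in> borel_measurable borel" unfolding a_def by measurable
    have "extended_integral lborel (\<lambda>y. entropy_integrand (a y) (d y)) \<le> ereal (R * \<theta>\<^sup>2)"
      using R[of "- \<theta>"] unfolding a_def by simp
    note fe = finite_entropy_integrable[OF _ _ a_nonneg d_nonneg d_prob this, simplified]
    define g where "g y = a y / d y" for y
    have g_nonneg: "g y \<ge> 0" for y unfolding g_def using a_nonneg d_nonneg by simp
    have g_meas [measurable]: "g \<in> borel_measurable borel" unfolding g_def by measurable
    define \<nu> where "\<nu> = density \<mu> (\<lambda>x. ennreal (g x))"
    have \<nu>: "\<nu> = density lborel (\<lambda>x. ennreal (a x))"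
    proof -
      have "\<nu> = density lborel (\<lambda>x. ennreal (d x) * ennreal (g x))"
        unfolding \<nu>_def \<mu> by (rule density_density_eq) auto
      also have "\<dots> = density lborel (\<lambda>x. ennreal (a x))"
      proof (rule density_cong)
        show "AE x in lborel. ennreal (d x) * ennreal (g x) = ennreal (a x)"
          using fe(1)
        proof eventually_elim
          case (elim x)
          have "d x * g x = a x" using elim by (cases "d x = 0") (auto simp: g_def)
          then show ?case using d_nonneg g_nonneg by (simp flip: ennreal_mult)
        qed
      qed auto
      finally show ?thesis .
    qed
    have \<nu>_shift: "\<nu> = distr \<mu> borel ((+) \<theta>)"
    proof -
      have "\<nu> = density (distr lborel borel ((+) \<theta>)) (\<lambda>x. ennreal (a x))"
        unfolding \<nu> by (simp only: lborel_distr_plus)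
      also have "\<dots> = distr (density lborel (\<lambda>x. ennreal (a (\<theta> + x)))) borel ((+) \<theta>)"
        by (rule density_distr) auto
      also have "(\<lambda>x. ennreal (a (\<theta> + x))) = (\<lambda>x. ennreal (d x))" by (simp add: a_def)
      finally show ?thesis unfolding \<mu> .
    qed
    have plus: "(+) \<theta> \<in> measurable \<mu> borel" unfolding measurable_cong_sets[OF sets refl] by simp
    have \<nu>_int: "(\<integral>x. f x \<partial>\<nu>) = (\<integral>x. f (\<theta> + x) \<partial>\<mu>)" if "f \<in> borel_measurable borel" for f :: "real \<Rightarrow> real"
      unfolding \<nu>_shift by (rule integral_distr[OF plus that])
    have prob: "prob_space \<nu>" unfolding \<nu>_shift by (rule prob_space_distr[OF plus])
    have lng: "AE y in lborel. a y * ln (g y) = a y * ln (a y / d y)" by (simp add: g_def)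
    have "integrable \<nu> (\<lambda>x. ln (g x))"
      unfolding \<nu> by (subst integrable_real_density) (use fe(2) a_nonneg in \<open>auto simp: g_def\<close>)
    with prob have "tilted_law \<mu> g"
      unfolding \<nu>_def
      by (intro tilted_law.intro iid_reals.intro iid_reals_axioms.intro tilted_law_axioms.intro
          prob_space_axioms sets g_meas g_nonneg)
    moreover have "integrable \<nu> (\<lambda>x. x\<^sup>2)"
    proof -
      have "integrable \<mu> (\<lambda>x. x)"
        by (rule square_integrable_imp_integrable)
          (simp_all add: sq[folded \<mu>_def] measurable_cong_sets[OF sets refl])
      then have "integrable \<mu> (\<lambda>x. (\<theta> + x)\<^sup>2)"
        unfolding power2_sum
        by (intro Bochner_Integration.integrable_add integrable_mult_right sq[folded \<mu>_def]) simp
      then show ?thesis unfolding \<nu>_shift by (subst integrable_distr_eq[OF plus]) auto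
    qed
    moreover have "(\<integral>x. ln (g x) \<partial>\<nu>) \<le> \<bar>R\<bar> * \<theta>\<^sup>2"
    proof -
      have "(\<integral>x. ln (g x) \<partial>\<nu>) = (\<integral>y. a y * ln (a y / d y) \<partial>lborel)"
        unfolding \<nu> by (subst integral_real_density) (use a_nonneg in \<open>auto simp: g_def\<close>)
      also have "\<dots> \<le> R * \<theta>\<^sup>2" by (rule fe(3))
      also have "\<dots> \<le> \<bar>R\<bar> * \<theta>\<^sup>2" by (intro mult_right_mono) auto
      finally show ?thesis .
    qed
    moreover have "(\<integral>x. ln (A + B * exp (\<beta> * (x + \<theta>))) \<partial>\<mu>) \<le> (\<integral>x. ln (A + B * exp (\<beta> * x)) \<partial>\<nu>)" for A B
      by (subst \<nu>_int) (simp_all add: add.commute)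
    ultimately show ?thesis unfolding admissible_tilt_def \<nu>_def by blast
  qed
  show ?thesis unfolding tiltable_def \<mu>_def[symmetric]
    using tilt abs_ge_zero[of R] zero_less_one[where 'a=real] by blast
qed

section \<open>Slowly varying functions\<close>

lemma near_full_measure:
  fixes f :: "nat \<Rightarrow> real \<Rightarrow> real"
  assumes [measurable]: "\<And>m. f m \<in> borel_measurable borel"
    and lim: "\<And>u. (\<lambda>m. f m u) \<longlonglongrightarrow> 0" and b: "b > 0"
  shows "\<exists>n0. \<forall>n\<ge>n0. b - 1 / 2 < measure lborel {u \<in> {0..b}. \<forall>m\<ge>n. \<bar>f m u\<bar> < 1}"
proof -
  define U where "U n = {u \<in> {0..b}. \<forall>m\<ge>n. \<bar>f m u\<bar> < 1}" for n
  have U [measurable]: "U n \<in> sets lborel" for n unfolding U_def by measurable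
  have "(\<Union>n. U n) = {0..b}"
  proof
    show "{0..b} \<subseteq> (\<Union>n. U n)"
    proof
      fix u assume "u \<in> {0..b}"
      moreover obtain n where "\<forall>m\<ge>n. norm (f m u - 0) < 1"
        using LIMSEQ_D[OF lim[of u], of 1] by auto
      ultimately show "u \<in> (\<Union>n. U n)" by (auto simp: U_def)
    qed
  qed (auto simp: U_def)
  moreover have "(\<lambda>n. measure lborel (U n)) \<longlonglongrightarrow> measure lborel (\<Union>n. U n)"
  proof (rule Lim_measure_incseq)
    show "incseq U" by (auto simp: incseq_def U_def)
    show "emeasure lborel (\<Union>n. U n) \<noteq> \<infinity>" unfolding \<open>(\<Union>n. U n) = {0..b}\<close> using b by simp
  qed (use U in auto)
  ultimately have "(\<lambda>n. measure lborel (U n)) \<longlonglongrightarrow> b" using b by simp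
  then have "eventually (\<lambda>n. b - 1 / 2 < measure lborel (U n)) sequentially"
    by (rule order_tendstoD) simp
  then show ?thesis unfolding U_def eventually_sequentially .
qed

text \<open>A one-sided part of the uniform convergence theorem, in additive form. If \<open>h\<close> dropped by
  more than \<open>2\<close> between \<open>t m\<close> and \<open>t m + s m\<close>, then the set of \<open>u\<close> with \<open>h (t m + u)\<close> close to
  \<open>h (t m)\<close> and the translate by \<open>s m\<close> of the set of \<open>u\<close> with \<open>h (t m + s m + u)\<close> close
  to \<open>h (t m + s m)\<close> would be disjoint, but both have nearly full measure in intervals that overlap.\<close>

lemma slowly_varying_bounded_drop:
  fixes h :: "real \<Rightarrow> real"
  assumes [measurable]: "h \<in> borel_measurable borel"
    and slow: "\<And>u. ((\<lambda>t. h (t + u) - h t) \<longlongrightarrow> 0) at_top"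
  shows "\<exists>T. \<forall>t\<ge>T. \<forall>s\<in>{0..1}. h t - 2 \<le> h (t + s)"
proof (rule ccontr)
  assume "\<not> ?thesis"
  then have "\<forall>n::nat. \<exists>t s. t \<ge> real n \<and> s \<in> {0..1} \<and> h (t + s) < h t - 2"
    by (meson not_le)
  then obtain t s where ts: "\<And>n. t n \<ge> real n" "\<And>n. s n \<in> {0..1}" "\<And>n. h (t n + s n) < h (t n) - 2"
    by metis
  have t_top: "filterlim t at_top sequentially"
    by (rule filterlim_at_top_mono[OF filterlim_real_sequentially]) (use ts(1) in auto)
  have ts_top: "filterlim (\<lambda>n. t n + s n) at_top sequentially"
  proof (rule filterlim_at_top_mono[OF filterlim_real_sequentially])
    have "real n \<le> t n + s n" for n using ts(1)[of n] ts(2)[of n] by auto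
    then show "\<forall>\<^sub>F n in sequentially. real n \<le> t n + s n" by simp
  qed
  obtain n1 where n1: "\<And>n. n \<ge> n1 \<Longrightarrow>
      2 - 1 / 2 < measure lborel {u \<in> {0..2}. \<forall>m\<ge>n. \<bar>h (t m + u) - h (t m)\<bar> < 1}"
    using near_full_measure[of "\<lambda>m u. h (t m + u) - h (t m)" 2] filterlim_compose[OF slow t_top]
    by auto
  obtain n2 where n2: "\<And>n. n \<ge> n2 \<Longrightarrow>
      1 - 1 / 2 < measure lborel {u \<in> {0..1}. \<forall>m\<ge>n. \<bar>h (t m + s m + u) - h (t m + s m)\<bar> < 1}"
    using near_full_measure[of "\<lambda>m u. h (t m + s m + u) - h (t m + s m)" 1] filterlim_compose[OF slow ts_top]
    by auto
  define n where "n = max n1 n2"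
  define U where "U = {u \<in> {0..2}. \<forall>m\<ge>n. \<bar>h (t m + u) - h (t m)\<bar> < 1}"
  define V where "V = {u \<in> {0..1}. \<forall>m\<ge>n. \<bar>h (t m + s m + u) - h (t m + s m)\<bar> < 1}"
  define W where "W = (\<lambda>u. u - s n) -` V"
  have U: "U \<in> sets lborel" unfolding U_def by measurable
  have V: "V \<in> sets lborel" unfolding V_def by measurable
  have W: "W \<in> sets lborel"
    using measurable_sets[of "\<lambda>u. u - s n" borel borel V] V by (simp add: W_def)
  have "emeasure lborel W = emeasure (distr lborel borel ((+) (- s n))) V"
    using V by (subst emeasure_distr) (auto simp: W_def vimage_def)
  then have "emeasure lborel W = emeasure lborel V" by (simp add: lborel_distr_plus)
  then have mW: "measure lborel W = measure lborel V" by (simp add: measure_def)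
  have "U \<inter> W = {}"
  proof (rule ccontr)
    assume "U \<inter> W \<noteq> {}"
    then obtain u where u: "u \<in> U" "u - s n \<in> V" by (auto simp: W_def)
    have "\<bar>h (t n + u) - h (t n)\<bar> < 1" using u(1) unfolding U_def by auto
    moreover have "\<bar>h (t n + s n + (u - s n)) - h (t n + s n)\<bar> < 1" using u(2) unfolding V_def by blast
    then have "\<bar>h (t n + u) - h (t n + s n)\<bar> < 1" by (simp add: algebra_simps)
    ultimately show False using ts(3)[of n] by linarith
  qed
  moreover have sub: "U \<union> W \<subseteq> {0..2}" using ts(2)[of n] by (auto simp: U_def W_def V_def)
  have finite: "emeasure lborel A \<noteq> \<infinity>" if "A \<subseteq> U \<union> W" for A
  proof -
    have "emeasure lborel A \<le> emeasure lborel {0..2::real}"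
      by (rule emeasure_mono) (use that sub in auto)
    then show ?thesis by (auto simp: top_unique)
  qed
  ultimately have "measure lborel (U \<union> W) = measure lborel U + measure lborel W"
    using U W finite by (intro measure_Union) auto
  moreover have "measure lborel (U \<union> W) \<le> measure lborel {0..2::real}"
    using sub U W by (intro measure_mono_fmeasurable) (auto simp: fmeasurable_def)
  moreover have "measure lborel U > 2 - 1 / 2" "measure lborel V > 1 - 1 / 2"
    using n1[of n] n2[of n] unfolding n_def U_def V_def by auto
  ultimately show False using mW by simp
qed

text \<open>On the logarithmic scale \<open>ln L\<close> drops by at most \<open>2\<close> per unit step, so \<open>L\<close> decays at most like the
  power \<open>-2\<close>.\<close>

lemma slowly_varying_lower_bound:
  assumes "slowly_varying L"
  shows "\<exists>c>0. \<forall>n\<ge>1. c * real n powr (- 2) \<le> L (real n)"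
proof -
  have meas: "L \<in> borel_measurable (restrict_space borel {0<..})"
    and pos: "\<And>x. x > 0 \<Longrightarrow> L x > 0"
    and lim: "\<And>u. u > 0 \<Longrightarrow> ((\<lambda>x. L (x * u) / L x) \<longlongrightarrow> 1) at_top"
    using assms unfolding slowly_varying_def by auto
  define h where "h t = ln (L (exp t))" for t
  have "(\<lambda>t. L (exp t)) \<in> borel_measurable borel"
    by (rule measurable_compose[OF _ meas]) (intro measurable_restrict_space2, auto)
  then have [measurable]: "h \<in> borel_measurable borel" unfolding h_def by measurable
  have "((\<lambda>t. h (t + u) - h t) \<longlongrightarrow> 0) at_top" for u
  proof -
    have "((\<lambda>t. L (exp t * exp u) / L (exp t)) \<longlongrightarrow> 1) at_top"
      by (rule filterlim_compose[OF lim exp_at_top]) simp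
    then have "((\<lambda>t. ln (L (exp t * exp u) / L (exp t))) \<longlongrightarrow> ln 1) at_top"
      by (rule tendsto_ln) simp
    moreover have "ln (L (exp t * exp u) / L (exp t)) = h (t + u) - h t" for t
      unfolding h_def exp_add using pos by (intro ln_divide_pos) auto
    ultimately show ?thesis by simp
  qed
  from slowly_varying_bounded_drop[OF _ this]
  have "\<exists>T. \<forall>t\<ge>T. \<forall>s\<in>{0..1}. h t - 2 \<le> h (t + s)" by simp
  then obtain T0 where T0: "\<And>t s. t \<ge> T0 \<Longrightarrow> s \<in> {0..1} \<Longrightarrow> h t - 2 \<le> h (t + s)"
    by blast
  define T where "T = max 0 T0"
  have steps: "h T - 2 * real k \<le> h (T + real k)" for k
  proof (induction k)
    case (Suc k)
    have "h (T + real k) - 2 \<le> h (T + real k + 1)" by (rule T0) (auto simp: T_def)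
    then show ?case using Suc by (simp add: algebra_simps)
  qed simp
  have lower: "h T - 2 * (t - T) - 2 \<le> h t" if "t \<ge> T" for t
  proof -
    define k where "k = nat \<lfloor>t - T\<rfloor>"
    have k: "real k \<le> t - T" "t - T \<le> real k + 1" unfolding k_def using that by linarith+
    have "h (T + real k) - 2 \<le> h (T + real k + (t - T - real k))"
      by (rule T0) (use k in \<open>auto simp: T_def\<close>)
    then show ?thesis using steps[of k] k by simp
  qed
  define N where "N = nat \<lceil>exp T\<rceil>"
  define c where "c = Min (insert (exp (h T - 2)) ((\<lambda>n. L (real n)) ` {1..N}))"
  have c_pos: "c > 0" unfolding c_def by (subst Min_gr_iff) (auto intro: pos)
  have "c * real n powr (- 2) \<le> L (real n)" if n: "n \<ge> 1" for n
  proof (cases "n \<le> N")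
    case True
    have "real n powr (- 2) \<le> 1 powr (- 2)" using n by (intro powr_mono2') auto
    then have "c * real n powr (- 2) \<le> c * 1" using c_pos by (intro mult_left_mono) auto
    also have "\<dots> \<le> L (real n)" unfolding c_def mult_1_right using True n by (intro Min_le) auto
    finally show ?thesis .
  next
    case False
    then have "exp T \<le> real n" unfolding N_def by linarith
    then have "T \<le> ln (real n)" using n by (subst ln_ge_iff) auto
    from lower[OF this] have "h T - 2 - 2 * ln (real n) \<le> ln (L (real n))"
      using n by (simp add: h_def T_def)
    then have "exp (h T - 2 - 2 * ln (real n)) \<le> exp (ln (L (real n)))" by simp
    moreover have "exp (h T - 2 - 2 * ln (real n)) = exp (h T - 2) * real n powr (- 2)"
      using n by (simp add: powr_def flip: exp_add)
    moreover have "c * real n powr (- 2) \<le> exp (h T - 2) * real n powr (- 2)"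
      unfolding c_def by (intro mult_right_mono Min_le) auto
    moreover have "exp (ln (L (real n))) = L (real n)" using pos[of "real n"] n by simp
    ultimately show ?thesis by linarith
  qed
  with c_pos show ?thesis by blast
qed

section \<open>Renewal paths\<close>

text \<open>The contacts of a trajectory from \<open>0\<close> to \<open>n\<close> in increasing order, without the origin.\<close>

definition paths :: "nat \<Rightarrow> nat list set" where
  "paths n = {xs. sorted_wrt (<) (0 # xs) \<and> last (0 # xs) = n}"

lemma paths_0 [simp]: "paths 0 = {[]}"
proof -
  have "xs = []" if xs: "xs \<in> paths 0" for xs
  proof (rule ccontr)
    assume "xs \<noteq> []"
    then have mem: "last xs \<in> set xs" by (rule last_in_set)
    have pos: "\<forall>x\<in>set xs. 0 < x" and "last xs = 0"
      using xs \<open>xs \<noteq> []\<close> unfolding paths_def by simp_all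
    with bspec[OF pos mem] show False by simp
  qed
  moreover have "[] \<in> paths 0" by (simp add: paths_def)
  ultimately show ?thesis by blast
qed

lemma paths_Suc: "paths (Suc n) = (\<Union>m\<in>{..n}. (\<lambda>xs. xs @ [Suc n]) ` paths m)"
proof (intro equalityI subsetI)
  fix xs assume xs: "xs \<in> paths (Suc n)"
  then have "xs \<noteq> []" by (auto simp: paths_def)
  then obtain ys y where "xs = ys @ [y]" by (cases xs rule: rev_cases) auto
  with xs have ys: "xs = ys @ [Suc n]" by (simp add: paths_def)
  have "last (0 # ys) \<in> set (0 # ys)" by (rule last_in_set) simp
  then have "last (0 # ys) \<le> n"
    using xs unfolding ys paths_def by (auto simp: sorted_wrt_append)
  moreover have "ys \<in> paths (last (0 # ys))"
    using xs unfolding ys paths_def by (auto simp: sorted_wrt_append)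
  ultimately show "xs \<in> (\<Union>m\<in>{..n}. (\<lambda>xs. xs @ [Suc n]) ` paths m)" using ys by blast
next
  fix xs assume "xs \<in> (\<Union>m\<in>{..n}. (\<lambda>xs. xs @ [Suc n]) ` paths m)"
  then obtain m ys where m: "m \<le> n" "ys \<in> paths m" "xs = ys @ [Suc n]" by blast
  have "y \<le> m" if "y \<in> set (0 # ys)" for y
  proof -
    have eq: "butlast (0 # ys) @ [last (0 # ys)] = 0 # ys" by (rule append_butlast_last_id) simp
    have s: "sorted_wrt (<) (butlast (0 # ys) @ [last (0 # ys)])"
      unfolding eq using m(2) by (simp add: paths_def)
    have "y \<in> set (butlast (0 # ys) @ [last (0 # ys)])" unfolding eq by (rule that)
    with s have "y \<le> last (0 # ys)" unfolding sorted_wrt_append by auto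
    then show ?thesis using m(2) by (simp add: paths_def)
  qed
  then have "\<forall>y\<in>set (0 # ys). y < Suc n" using m(1) by fastforce
  then show "xs \<in> paths (Suc n)" using m by (auto simp: paths_def sorted_wrt_append)
qed

lemma finite_paths [simp]: "finite (paths n)"
proof (induction n rule: less_induct)
  case (less n)
  then show ?case by (cases n) (auto simp: paths_Suc)
qed

definition epochs :: "(nat \<Rightarrow> enat) \<Rightarrow> bool" where
  "epochs T \<longleftrightarrow> T 0 = 0 \<and> (\<forall>k. if T k = \<infinity> then T (Suc k) = \<infinity> else T k < T (Suc k))"

lemma epochs_less:
  assumes "epochs T" "i < j" "T i \<noteq> \<infinity>"
  shows "T i < T j"
  using assms(2)
proof (induction j)
  case (Suc j)
  have step: "if T j = \<infinity> then T (Suc j) = \<infinity> else T j < T (Suc j)"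
    using assms(1) unfolding epochs_def by blast
  show ?case
  proof (cases "i = j")
    case True
    then show ?thesis using step assms(3) by simp
  next
    case False
    then have "T i < T j" using Suc by simp
    then show ?thesis using step assms(3) by (cases "T j = \<infinity>") (auto intro: less_trans)
  qed
qed simp

lemma epochs_follow_path:
  assumes T: "epochs T" and k: "T k = enat n"
  shows "\<exists>xs\<in>paths n. \<forall>i\<le>length xs. T i = enat ((0 # xs) ! i)"
proof -
  have fin: "\<exists>m. T i = enat m" if "i \<le> k" for i
  proof (cases "T i")
    case infinity
    have "T (i + d) = \<infinity>" for d
      using T infinity by (induction d) (auto simp: epochs_def)
    from this[of "k - i"] that k show ?thesis by simp
  qed auto
  define t where "t i = the_enat (T i)" for i
  have t: "T i = enat (t i)" if "i \<le> k" for i using fin[OF that] unfolding t_def by auto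
  define xs where "xs = map t [1..<Suc k]"
  have t0: "t 0 = 0" using T unfolding t_def epochs_def by (simp add: zero_enat_def)
  have full: "0 # xs = map t [0..<Suc k]"
    unfolding xs_def by (subst (2) upt_conv_Cons) (auto simp: t0)
  have "sorted_wrt (<) (map t [0..<Suc k])"
    unfolding sorted_wrt_map
  proof (rule sorted_wrt_mono_rel[of _ "(<)"])
    fix i j assume "i \<in> set [0..<Suc k]" "j \<in> set [0..<Suc k]" "i < j"
    then show "t i < t j" using epochs_less[OF T, of i j] t[of i] t[of j] by auto
  qed (rule sorted_wrt_upt)
  moreover have "last (map t [0..<Suc k]) = n" using t[of k] k by (simp add: last_map)
  ultimately have "xs \<in> paths n" unfolding paths_def full[symmetric] by simp
  moreover have "T i = enat ((0 # xs) ! i)" if "i \<le> length xs" for i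
    unfolding full using that t[of i] by (simp add: xs_def del: upt_Suc)
  ultimately show ?thesis by blast
qed

lemma path_nth_last: "xs \<in> paths n \<Longrightarrow> (0 # xs) ! length xs = n"
  unfolding paths_def by (auto simp: last_conv_nth nth_Cons' split: if_splits)

lemma epochs_path_unique:
  assumes T: "epochs T" and xs: "xs \<in> paths n" "\<forall>i\<le>length xs. T i = enat ((0 # xs) ! i)"
    and ys: "ys \<in> paths n" "\<forall>i\<le>length ys. T i = enat ((0 # ys) ! i)"
  shows "xs = ys"
proof -
  have x: "T (length xs) = enat n" using xs path_nth_last[OF xs(1)] by auto
  have y: "T (length ys) = enat n" using ys path_nth_last[OF ys(1)] by auto
  have len: "length xs = length ys"
    using epochs_less[OF T, of "length xs" "length ys"] epochs_less[OF T, of "length ys" "length xs"] x y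
    by (cases "length xs" "length ys" rule: linorder_cases) auto
  have "(0 # xs) ! i = (0 # ys) ! i" if "i \<le> length xs" for i
    using xs(2) ys(2) that len by (metis enat.inject)
  then have "0 # xs = 0 # ys" using len by (intro nth_equalityI) auto
  then show ?thesis by simp
qed

lemma epochs_path_range:
  assumes T: "epochs T" and xs: "xs \<in> paths n" "\<forall>i\<le>length xs. T i = enat ((0 # xs) ! i)"
  shows "{m. \<exists>k. T k = enat m} \<inter> {1..n} = set xs"
proof (intro equalityI subsetI)
  have last: "T (length xs) = enat n" using xs path_nth_last[OF xs(1)] by auto
  fix m assume "m \<in> {m. \<exists>k. T k = enat m} \<inter> {1..n}"
  then obtain k where k: "T k = enat m" "1 \<le> m" "m \<le> n" by auto
  have "k \<le> length xs"
  proof (rule ccontr)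
    assume "\<not> k \<le> length xs"
    then show False using epochs_less[OF T, of "length xs" k] last k by auto
  qed
  moreover have "k \<noteq> 0"
  proof
    assume "k = 0"
    then have "enat m = enat 0" using T k(1) by (simp add: epochs_def zero_enat_def)
    then show False using k(2) by simp
  qed
  ultimately show "m \<in> set xs" using xs(2) k(1) by (cases k) (auto intro!: nth_mem)
next
  fix m assume "m \<in> set xs"
  then obtain i where i: "i < length xs" "xs ! i = m" by (auto simp: in_set_conv_nth)
  have "T (Suc i) = enat m" using xs(2) i by auto
  moreover have "T (Suc i) \<le> T (length xs)"
    using epochs_less[OF T, of "Suc i" "length xs"] i calculation
    by (cases "Suc i = length xs") (auto intro: less_imp_le)
  moreover have "T (length xs) = enat n" using xs path_nth_last[OF xs(1)] by auto
  moreover have "m \<ge> 1"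
    using xs(1) \<open>m \<in> set xs\<close> by (auto simp: paths_def Suc_le_eq)
  ultimately show "m \<in> {m. \<exists>k. T k = enat m} \<inter> {1..n}" by auto
qed

context renewal_process
begin

definition gap_prob :: "nat \<Rightarrow> real" where
  "gap_prob n = prob {x \<in> space P. \<tau> 1 x = enat n}"

definition path_event :: "nat list \<Rightarrow> 'a set" where
  "path_event xs = {x \<in> space P. \<forall>i\<le>length xs. \<tau> i x = enat ((0 # xs) ! i)}"

lemma epoch_event [measurable]: "{x \<in> space P. \<tau> k x = j} \<in> events"
  using tau_measurable[of k] by measurable

lemma path_event_sets [measurable]: "path_event xs \<in> events"
proof -
  have "path_event xs = (\<Inter>i\<in>{..length xs}. {x \<in> space P. \<tau> i x = enat ((0 # xs) ! i)})"
    by (auto simp: path_event_def)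
  then show ?thesis by (auto intro!: sets.finite_INT)
qed

lemma AE_epochs: "AE x in P. epochs (\<lambda>k. \<tau> k x)"
  using tau_0 tau_increasing by eventually_elim (simp add: epochs_def)

lemma gap_prob_sum: "(\<Sum>j=1..n. gap_prob j) \<le> 1"
proof -
  have "(\<Sum>j=1..n. gap_prob j) = prob (\<Union>j\<in>{1..n}. {x \<in> space P. \<tau> 1 x = enat j})"
    unfolding gap_prob_def
    by (rule finite_measure_finite_Union[symmetric]) (auto simp: disjoint_family_on_def)
  then show ?thesis by simp
qed

lemma path_event_snoc:
  assumes xs: "xs \<in> paths m" and n: "m < n"
  shows "prob (path_event (xs @ [n])) = prob (path_event xs) * gap_prob (n - m)"
proof -
  let ?t = "\<lambda>i. (0 # xs) ! i"
  have last: "?t (length xs) = m" using path_nth_last[OF xs] .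
  have eq: "path_event (xs @ [n]) = {x \<in> space P. (\<forall>i\<le>length xs. \<tau> i x = enat (?t i)) \<and>
      \<tau> (Suc (length xs)) x = enat (?t (length xs)) + enat (n - m)}"
  proof -
    have "(0 # xs @ [n]) ! i = ?t i" if "i \<le> length xs" for i
      using that by (auto simp: nth_append nth_Cons' )
    then show ?thesis unfolding path_event_def using last n
      by (auto simp: le_Suc_eq nth_append all_conj_distrib)
  qed
  show ?thesis unfolding eq tau_increments by (simp add: path_event_def gap_prob_def)
qed

lemma path_event_Nil: "prob (path_event []) = 1"
proof -
  have "prob (path_event []) = prob (space P)"
    by (rule finite_measure_eq_AE) (use tau_0 in \<open>auto simp: path_event_def zero_enat_def elim!: eventually_mono\<close>)
  then show ?thesis by (simp add: prob_space)
qed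

text \<open>Summation over the last gap turns the independence of the increments into the recursion that
  defines \<open>zcon\<close>.\<close>

lemma path_sum:
  "(\<Sum>xs\<in>paths n. prob (path_event xs) * exp (\<Sum>m\<leftarrow>xs. e (m - 1))) = zcon gap_prob e n"
proof (induction n rule: less_induct)
  case (less n)
  show ?case
  proof (cases n)
    case 0
    then show ?thesis by (simp add: path_event_Nil)
  next
    case (Suc k)
    let ?f = "\<lambda>xs. prob (path_event xs) * exp (\<Sum>m\<leftarrow>xs. e (m - 1))"
    have disj: "(\<lambda>xs. xs @ [Suc k]) ` paths i \<inter> (\<lambda>xs. xs @ [Suc k]) ` paths j = {}" if "i \<noteq> j" for i j
      using that by (auto simp: paths_def)
    have "(\<Sum>xs\<in>paths n. ?f xs) = (\<Sum>m\<in>{..k}. \<Sum>xs\<in>(\<lambda>xs. xs @ [Suc k]) ` paths m. ?f xs)"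
      unfolding Suc paths_Suc by (rule sum.UNION_disjoint) (use disj in auto)
    also have "\<dots> = (\<Sum>m\<in>{..k}. \<Sum>xs\<in>paths m. ?f (xs @ [Suc k]))"
      by (intro sum.cong refl sum.reindex_cong[OF _ refl refl]) (auto simp: inj_on_def)
    also have "\<dots> = (\<Sum>m\<in>{..k}. \<Sum>xs\<in>paths m. ?f xs * (gap_prob (Suc k - m) * exp (e k)))"
      by (intro sum.cong refl) (simp add: path_event_snoc exp_add)
    also have "\<dots> = (\<Sum>m\<in>{..k}. zcon gap_prob e m * (gap_prob (Suc k - m) * exp (e k)))"
      using less.IH Suc by (intro sum.cong refl) (simp add: sum_distrib_right[symmetric])
    also have "\<dots> = zcon gap_prob e n"
      unfolding Suc zcon.simps(2) by (simp add: sum_distrib_right mult.assoc)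
    finally show ?thesis .
  qed
qed

end

section \<open>Free and constrained partition functions\<close>

context renewal_process
begin

definition gibbs_weight :: "(nat \<Rightarrow> real) \<Rightarrow> nat \<Rightarrow> 'a \<Rightarrow> real" where
  "gibbs_weight e N x = exp (\<Sum>n=1..N. e (n - 1) * indicator (renewal_set \<tau> x) n)"

definition free_partition :: "(nat \<Rightarrow> real) \<Rightarrow> nat \<Rightarrow> real" where
  "free_partition e N = (\<integral>x. gibbs_weight e N x \<partial>P)"

lemma boltzmann_weight_eq: "boltzmann_weight \<tau> \<beta> h v N = gibbs_weight (\<lambda>i. h + \<beta> * v (Suc i)) N"
  unfolding boltzmann_weight_def gibbs_weight_def by (auto intro!: ext arg_cong[where f=exp] sum.cong)

lemma partition_function_eq:
  "partition_function P \<tau> \<beta> h v N = free_partition (\<lambda>i. h + \<beta> * v (Suc i)) N"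
  unfolding partition_function_def free_partition_def boltzmann_weight_eq ..

lemma renewal_event [measurable]: "Measurable.pred P (\<lambda>x. n \<in> renewal_set \<tau> x)"
proof -
  have "(\<lambda>x. n \<in> renewal_set \<tau> x) = (\<lambda>x. \<exists>k. \<tau> k x = enat n)"
    by (simp add: renewal_set_def)
  moreover have "Measurable.pred P (\<lambda>x. \<tau> k x = enat n)" for k
    using tau_measurable[of k] by measurable
  ultimately show ?thesis by simp
qed

lemma renewal_indicator_measurable [measurable]:
  "(\<lambda>x. indicator (renewal_set \<tau> x) n :: real) \<in> borel_measurable P"
proof -
  have "(\<lambda>x. indicator (renewal_set \<tau> x) n :: real) = (\<lambda>x. if n \<in> renewal_set \<tau> x then 1 else 0)"
    by (auto simp: indicator_def fun_eq_iff)
  then show ?thesis by simp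
qed

lemma gibbs_weight_measurable [measurable]: "gibbs_weight e N \<in> borel_measurable P"
  unfolding gibbs_weight_def by measurable

lemma gibbs_weight_pos: "gibbs_weight e N x > 0"
  unfolding gibbs_weight_def by simp

lemma abs_energy_le:
  fixes e :: "nat \<Rightarrow> real"
  shows "\<bar>\<Sum>n=1..N. e (n - 1) * indicator (renewal_set \<tau> x) n\<bar> \<le> (\<Sum>i<N. \<bar>e i\<bar>)"
proof -
  have "\<bar>\<Sum>n=1..N. e (n - 1) * indicator (renewal_set \<tau> x) n\<bar> \<le> (\<Sum>n=1..N. \<bar>e (n - 1)\<bar>)"
    by (rule order_trans[OF sum_abs], rule sum_mono) (auto simp: indicator_def)
  also have "\<dots> = (\<Sum>i<N. \<bar>e i\<bar>)"
    by (rule sum.reindex_bij_witness[of _ Suc "\<lambda>n. n - 1"]) auto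
  finally show ?thesis .
qed

lemma gibbs_weight_bounds:
  "exp (- (\<Sum>i<N. \<bar>e i\<bar>)) \<le> gibbs_weight e N x" "gibbs_weight e N x \<le> exp (\<Sum>i<N. \<bar>e i\<bar>)"
  using abs_energy_le[where e=e and N=N and x=x] unfolding gibbs_weight_def by auto

lemma gibbs_weight_integrable [simp]: "integrable P (gibbs_weight e N)"
  by (rule integrable_const_bound[where B="exp (\<Sum>i<N. \<bar>e i\<bar>)"])
    (use gibbs_weight_bounds(2) gibbs_weight_pos in \<open>auto simp: abs_of_pos\<close>)

lemma free_partition_bounds:
  "exp (- (\<Sum>i<N. \<bar>e i\<bar>)) \<le> free_partition e N" "free_partition e N \<le> exp (\<Sum>i<N. \<bar>e i\<bar>)"
proof -
  have "(\<integral>x. exp (- (\<Sum>i<N. \<bar>e i\<bar>)) \<partial>P) \<le> free_partition e N"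
    unfolding free_partition_def by (intro integral_mono gibbs_weight_bounds) auto
  then show "exp (- (\<Sum>i<N. \<bar>e i\<bar>)) \<le> free_partition e N" by (simp add: prob_space)
  have "free_partition e N \<le> (\<integral>x. exp (\<Sum>i<N. \<bar>e i\<bar>) \<partial>P)"
    unfolding free_partition_def by (intro integral_mono gibbs_weight_bounds) auto
  then show "free_partition e N \<le> exp (\<Sum>i<N. \<bar>e i\<bar>)" by (simp add: prob_space)
qed

lemma free_partition_pos: "free_partition e N > 0"
  using free_partition_bounds(1)[where e=e and N=N] by (rule less_le_trans[rotated]) simp

lemma ln_free_partition_abs_le: "\<bar>ln (free_partition e N)\<bar> \<le> (\<Sum>i<N. \<bar>e i\<bar>)"
proof -
  have "ln (exp (- (\<Sum>i<N. \<bar>e i\<bar>))) \<le> ln (free_partition e N)"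
    using free_partition_bounds(1) free_partition_pos by (subst ln_le_cancel_iff) auto
  moreover have "ln (free_partition e N) \<le> ln (exp (\<Sum>i<N. \<bar>e i\<bar>))"
    using free_partition_bounds(2) free_partition_pos by (subst ln_le_cancel_iff) auto
  ultimately show ?thesis by simp
qed

lemma gibbs_weight_eq_sum:
  "gibbs_weight e N x = exp (\<Sum>n\<in>renewal_set \<tau> x \<inter> {1..N}. e (n - 1))"
proof -
  have "(\<Sum>n\<in>renewal_set \<tau> x \<inter> {1..N}. e (n - 1)) = (\<Sum>n=1..N. if n \<in> renewal_set \<tau> x then e (n - 1) else 0)"
    by (subst Int_commute) (rule sum.inter_restrict, simp)
  also have "\<dots> = (\<Sum>n=1..N. e (n - 1) * indicator (renewal_set \<tau> x) n)"
    by (intro sum.cong) (auto simp: indicator_def)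
  finally show ?thesis unfolding gibbs_weight_def by simp
qed

text \<open>The weight only depends on the contacts in \<open>{1..N}\<close>, so the integral is a finite sum of explicit
  exponentials of the energies; measurability in the environment follows.\<close>

lemma integral_gibbs_weight_event:
  assumes B: "B \<in> events"
  shows "(\<integral>x. gibbs_weight e N x * indicator B x \<partial>P)
    = (\<Sum>A\<in>Pow {1..N}. prob ({x \<in> space P. renewal_set \<tau> x \<inter> {1..N} = A} \<inter> B) * exp (\<Sum>n\<in>A. e (n - 1)))"
proof -
  let ?E = "\<lambda>A. {x \<in> space P. renewal_set \<tau> x \<inter> {1..N} = A}"
  have E: "?E A \<in> events" for A
  proof (cases "A \<subseteq> {1..N}")
    case True
    then have "?E A = {x \<in> space P. \<forall>n\<in>{1..N}. n \<in> renewal_set \<tau> x \<longleftrightarrow> n \<in> A}" by auto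
    also have "\<dots> \<in> events" by measurable
    finally show ?thesis .
  next
    case False
    then have empty: "?E A = {}" by auto
    show ?thesis unfolding empty by simp
  qed
  have pw: "gibbs_weight e N x * indicator B x
      = (\<Sum>A\<in>Pow {1..N}. indicator (?E A \<inter> B) x * exp (\<Sum>n\<in>A. e (n - 1)))" if x: "x \<in> space P" for x
  proof -
    let ?A = "renewal_set \<tau> x \<inter> {1..N}"
    have "(\<Sum>A\<in>Pow {1..N}. indicator (?E A \<inter> B) x * exp (\<Sum>n\<in>A. e (n - 1)))
        = (\<Sum>A\<in>Pow {1..N}. if A = ?A then indicator B x * exp (\<Sum>n\<in>A. e (n - 1)) else 0)"
      by (intro sum.cong) (use x in \<open>auto simp: indicator_def\<close>)
    also have "\<dots> = indicator B x * exp (\<Sum>n\<in>?A. e (n - 1))" by (subst sum.delta) auto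
    finally show ?thesis by (simp add: gibbs_weight_eq_sum mult.commute)
  qed
  have "(\<integral>x. gibbs_weight e N x * indicator B x \<partial>P)
      = (\<integral>x. (\<Sum>A\<in>Pow {1..N}. indicator (?E A \<inter> B) x * exp (\<Sum>n\<in>A. e (n - 1))) \<partial>P)"
    by (intro Bochner_Integration.integral_cong refl pw)
  also have "\<dots> = (\<Sum>A\<in>Pow {1..N}. \<integral>x. indicator (?E A \<inter> B) x * exp (\<Sum>n\<in>A. e (n - 1)) \<partial>P)"
    using E B by (intro Bochner_Integration.integral_sum integrable_mult_left) (auto simp: emeasure_eq_measure)
  also have "\<dots> = (\<Sum>A\<in>Pow {1..N}. prob (?E A \<inter> B) * exp (\<Sum>n\<in>A. e (n - 1)))"
    using E B by (intro sum.cong refl) auto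
  finally show ?thesis .
qed

lemma integral_gibbs_weight_measurable:
  assumes B: "B \<in> events" and e: "\<And>i. (\<lambda>w. e w i) \<in> borel_measurable M"
  shows "(\<lambda>w. \<integral>x. gibbs_weight (e w) N x * indicator B x \<partial>P) \<in> borel_measurable M"
  unfolding integral_gibbs_weight_event[OF B] using e by measurable

lemma free_partition_measurable:
  assumes e: "\<And>i. (\<lambda>w. e w i) \<in> borel_measurable M"
  shows "(\<lambda>w. free_partition (e w) N) \<in> borel_measurable M"
proof -
  have "free_partition e N = (\<integral>x. gibbs_weight e N x * indicator (space P) x \<partial>P)" for e
    unfolding free_partition_def by (intro Bochner_Integration.integral_cong) auto
  then show ?thesis using integral_gibbs_weight_measurable[OF sets.top e] by simp
qed

text \<open>Almost surely, a trajectory with a contact at \<open>n\<close> follows exactly one path to \<open>n\<close>.\<close>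

lemma contact_partition:
  "(\<integral>x. gibbs_weight e n x * indicator {x. n \<in> renewal_set \<tau> x} x \<partial>P) = zcon gap_prob e n"
proof -
  have pw: "AE x in P. gibbs_weight e n x * indicator {x. n \<in> renewal_set \<tau> x} x
      = (\<Sum>xs\<in>paths n. indicator (path_event xs) x * exp (\<Sum>m\<leftarrow>xs. e (m - 1)))"
    using AE_epochs AE_space
  proof eventually_elim
    case (elim x)
    let ?T = "\<lambda>k. \<tau> k x"
    have member: "x \<in> path_event xs \<longleftrightarrow> (\<forall>i\<le>length xs. ?T i = enat ((0 # xs) ! i))" for xs
      using elim(2) by (simp add: path_event_def)
    show ?case
    proof (cases "n \<in> renewal_set \<tau> x")
      case True
      then obtain k where "?T k = enat n" by (auto simp: renewal_set_def)
      then obtain xs where xs: "xs \<in> paths n" "\<forall>i\<le>length xs. ?T i = enat ((0 # xs) ! i)"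
        using epochs_follow_path[OF elim(1)] by blast
      have unique: "x \<in> path_event ys \<longleftrightarrow> ys = xs" if "ys \<in> paths n" for ys
        using epochs_path_unique[OF elim(1) that _ xs] xs(2) member by blast
      have "distinct xs"
        using xs(1) by (simp add: paths_def strict_sorted_iff)
      have "gibbs_weight e n x = exp (\<Sum>m\<in>set xs. e (m - 1))"
        using epochs_path_range[OF elim(1) xs] by (simp add: gibbs_weight_eq_sum renewal_set_def)
      also have "(\<Sum>m\<in>set xs. e (m - 1)) = (\<Sum>m\<leftarrow>xs. e (m - 1))"
        using \<open>distinct xs\<close> by (simp add: sum_list_distinct_conv_sum_set)
      finally have w: "gibbs_weight e n x = exp (\<Sum>m\<leftarrow>xs. e (m - 1))" .
      have "(\<Sum>ys\<in>paths n. indicator (path_event ys) x * exp (\<Sum>m\<leftarrow>ys. e (m - 1)))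
          = (\<Sum>ys\<in>paths n. if ys = xs then exp (\<Sum>m\<leftarrow>ys. e (m - 1)) else 0)"
        by (intro sum.cong) (auto simp: indicator_def unique)
      also have "\<dots> = exp (\<Sum>m\<leftarrow>xs. e (m - 1))" using xs(1) by (subst sum.delta) auto
      finally show ?thesis using True w by simp
    next
      case False
      have "x \<notin> path_event xs" if "xs \<in> paths n" for xs
        using False path_nth_last[OF that] unfolding member renewal_set_def by auto
      then show ?thesis using False by simp
    qed
  qed
  have ev: "{x \<in> space P. n \<in> renewal_set \<tau> x} \<in> events" by measurable
  have "(\<integral>x. gibbs_weight e n x * indicator {x. n \<in> renewal_set \<tau> x} x \<partial>P)
      = (\<integral>x. (\<Sum>xs\<in>paths n. indicator (path_event xs) x * exp (\<Sum>m\<leftarrow>xs. e (m - 1))) \<partial>P)"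
  proof (rule integral_cong_AE[OF _ _ pw])
    show "(\<lambda>x. gibbs_weight e n x * indicator {x. n \<in> renewal_set \<tau> x} x) \<in> borel_measurable P"
      by (simp add: indicator_def)
    show "(\<lambda>x. \<Sum>xs\<in>paths n. indicator (path_event xs) x * exp (\<Sum>m\<leftarrow>xs. e (m - 1))) \<in> borel_measurable P"
      by (intro borel_measurable_sum borel_measurable_times borel_measurable_indicator path_event_sets
          borel_measurable_const)
  qed
  also have "\<dots> = (\<Sum>xs\<in>paths n. \<integral>x. indicator (path_event xs) x * exp (\<Sum>m\<leftarrow>xs. e (m - 1)) \<partial>P)"
    by (intro Bochner_Integration.integral_sum integrable_mult_left) (auto simp: emeasure_eq_measure)
  also have "\<dots> = (\<Sum>xs\<in>paths n. prob (path_event xs) * exp (\<Sum>m\<leftarrow>xs. e (m - 1)))"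
    by (intro sum.cong refl) simp
  also have "\<dots> = zcon gap_prob e n" by (rule path_sum)
  finally show ?thesis .
qed

lemma contact_integrable:
  "integrable P (\<lambda>x. gibbs_weight e n x * indicator {x. n \<in> renewal_set \<tau> x} x)"
proof (rule Bochner_Integration.integrable_bound[OF gibbs_weight_integrable[of e n]])
  show "AE x in P. norm (gibbs_weight e n x * indicator {x. n \<in> renewal_set \<tau> x} x) \<le> norm (gibbs_weight e n x)"
    by (auto simp: indicator_def)
qed (simp add: indicator_def)

lemma zcon_le_free_partition: "zcon gap_prob e N \<le> free_partition e N"
  unfolding contact_partition[symmetric] free_partition_def
  by (intro integral_mono contact_integrable)
    (use gibbs_weight_pos[of e N] in \<open>auto simp: indicator_def intro: less_imp_le\<close>)

text \<open>After its last contact \<open>n\<close> up to \<open>N\<close>, a trajectory collects no more energy.\<close>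

lemma free_partition_le_sum_zcon: "free_partition e N \<le> (\<Sum>n\<le>N. zcon gap_prob e n)"
proof -
  have "free_partition e N \<le> (\<integral>x. (\<Sum>n\<le>N. gibbs_weight e n x * indicator {x. n \<in> renewal_set \<tau> x} x) \<partial>P)"
    unfolding free_partition_def
  proof (rule integral_mono_AE)
    show "AE x in P. gibbs_weight e N x \<le> (\<Sum>n\<le>N. gibbs_weight e n x * indicator {x. n \<in> renewal_set \<tau> x} x)"
      using tau_0
    proof eventually_elim
      case (elim x)
      let ?R = "renewal_set \<tau> x \<inter> {0..N}"
      define n where "n = Max ?R"
      have "0 \<in> ?R" using elim by (auto simp: renewal_set_def zero_enat_def)
      then have n: "n \<in> ?R" unfolding n_def by (intro Max_in) auto
      have "m \<le> n" if "m \<in> ?R" for m unfolding n_def by (rule Max_ge) (use that in auto)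
      then have "renewal_set \<tau> x \<inter> {1..N} = renewal_set \<tau> x \<inter> {1..n}" using n by fastforce
      then have "gibbs_weight e N x = gibbs_weight e n x" by (simp add: gibbs_weight_eq_sum)
      also have "\<dots> = gibbs_weight e n x * indicator {x. n \<in> renewal_set \<tau> x} x" using n by simp
      also have "\<dots> \<le> (\<Sum>n\<le>N. gibbs_weight e n x * indicator {x. n \<in> renewal_set \<tau> x} x)"
        using n less_imp_le[OF gibbs_weight_pos] by (intro member_le_sum) (auto intro!: mult_nonneg_nonneg)
      finally show ?case .
    qed
    show "integrable P (\<lambda>x. \<Sum>n\<le>N. gibbs_weight e n x * indicator {x. n \<in> renewal_set \<tau> x} x)"
      by (intro Bochner_Integration.integrable_sum contact_integrable)
  qed simp
  also have "\<dots> = (\<Sum>n\<le>N. zcon gap_prob e n)"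
    by (subst Bochner_Integration.integral_sum) (rule contact_integrable, simp only: contact_partition)
  finally show ?thesis .
qed

text \<open>A trajectory whose first gap exceeds \<open>N\<close> has weight one.\<close>

lemma free_partition_ge_gap: "gap_prob (Suc N) \<le> free_partition e N"
proof -
  have "gap_prob (Suc N) = (\<integral>x. indicator {x \<in> space P. \<tau> 1 x = enat (Suc N)} x \<partial>P)"
    unfolding gap_prob_def by simp
  also have "\<dots> \<le> free_partition e N"
    unfolding free_partition_def
  proof (rule integral_mono_AE)
    show "AE x in P. indicator {x \<in> space P. \<tau> 1 x = enat (Suc N)} x \<le> gibbs_weight e N x"
      using AE_epochs
    proof eventually_elim
      case (elim x)
      show ?case
      proof (cases "\<tau> 1 x = enat (Suc N)")
        case True
        have "k = 0 \<or> n \<ge> Suc N" if k: "\<tau> k x = enat n" for k n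
        proof (cases k)
          case (Suc j)
          then show ?thesis using epochs_less[OF elim, of 1 k] True k by (cases j) auto
        qed simp
        moreover have "\<tau> 0 x = enat 0" using elim by (simp add: epochs_def zero_enat_def)
        ultimately have "renewal_set \<tau> x \<inter> {1..N} = {}" by (force simp: renewal_set_def)
        then show ?thesis by (simp add: gibbs_weight_eq_sum indicator_def)
      next
        case False
        then show ?thesis using less_imp_le[OF gibbs_weight_pos] by (simp add: indicator_def)
      qed
    qed
  qed (auto simp: emeasure_eq_measure)
  finally show ?thesis .
qed

text \<open>Exponential Markov inequality: raising every energy by \<open>\<delta>\<close> multiplies the weight of a
  trajectory by \<open>e\<^sup>\<delta>\<close> per contact. The origin is a contact that carries no weight.\<close>

lemma many_contacts_le:
  fixes N :: nat and \<delta> t :: real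
  assumes \<delta>: "\<delta> \<ge> 0"
  defines "B \<equiv> {x \<in> space P. real (card (renewal_set \<tau> x \<inter> {0..N})) > t}"
  shows "(\<integral>x. gibbs_weight e N x * indicator B x \<partial>P) \<le> exp (- \<delta> * (t - 1)) * free_partition (\<lambda>i. e i + \<delta>) N"
    and "B \<in> events"
proof -
  have card: "real (card (renewal_set \<tau> x \<inter> {0..N})) = (\<Sum>n\<in>{0..N}. indicator (renewal_set \<tau> x) n)" for x
    by (simp add: indicator_def of_bool_def sum.If_cases Int_commute)
  show B: "B \<in> events" unfolding B_def card by measurable
  have "(\<integral>x. gibbs_weight e N x * indicator B x \<partial>P) \<le> (\<integral>x. exp (- \<delta> * (t - 1)) * gibbs_weight (\<lambda>i. e i + \<delta>) N x \<partial>P)"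
  proof (rule integral_mono_AE)
    show "integrable P (\<lambda>x. gibbs_weight e N x * indicator B x)"
      by (rule Bochner_Integration.integrable_bound[OF gibbs_weight_integrable[of e N]])
        (use B in \<open>auto simp: indicator_def\<close>)
    show "AE x in P. gibbs_weight e N x * indicator B x \<le> exp (- \<delta> * (t - 1)) * gibbs_weight (\<lambda>i. e i + \<delta>) N x"
    proof (rule AE_I2)
      fix x
      let ?A = "renewal_set \<tau> x \<inter> {1..N}"
      show "gibbs_weight e N x * indicator B x \<le> exp (- \<delta> * (t - 1)) * gibbs_weight (\<lambda>i. e i + \<delta>) N x"
      proof (cases "x \<in> B")
        case True
        have "renewal_set \<tau> x \<inter> {0..N} \<subseteq> insert 0 ?A" by auto
        then have "card (renewal_set \<tau> x \<inter> {0..N}) \<le> card (insert 0 ?A)" by (intro card_mono) auto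
        also have "\<dots> \<le> Suc (card ?A)" by (rule card_insert_le_m1) auto
        finally have "t - 1 \<le> real (card ?A)" using True unfolding B_def by simp
        then have "\<delta> * (t - 1) \<le> \<delta> * real (card ?A)" using \<delta> by (rule mult_left_mono)
        moreover have "gibbs_weight (\<lambda>i. e i + \<delta>) N x = gibbs_weight e N x * exp (\<delta> * real (card ?A))"
          by (simp add: gibbs_weight_eq_sum sum.distrib exp_add mult.commute)
        ultimately have "gibbs_weight e N x * exp (\<delta> * (t - 1)) \<le> gibbs_weight (\<lambda>i. e i + \<delta>) N x"
          using gibbs_weight_pos[of e N x] by (simp add: mult_left_mono)
        then have "exp (- \<delta> * (t - 1)) * (gibbs_weight e N x * exp (\<delta> * (t - 1)))
            \<le> exp (- \<delta> * (t - 1)) * gibbs_weight (\<lambda>i. e i + \<delta>) N x" by (intro mult_left_mono) auto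
        moreover have "exp (- \<delta> * (t - 1)) * (gibbs_weight e N x * exp (\<delta> * (t - 1))) = gibbs_weight e N x"
          by (simp add: exp_minus)
        ultimately have "gibbs_weight e N x \<le> exp (- \<delta> * (t - 1)) * gibbs_weight (\<lambda>i. e i + \<delta>) N x"
          by (simp only:)
        then show ?thesis using True by simp
      next
        case False
        then show ?thesis using less_imp_le[OF gibbs_weight_pos] by simp
      qed
    qed
  qed simp
  then show "(\<integral>x. gibbs_weight e N x * indicator B x \<partial>P) \<le> exp (- \<delta> * (t - 1)) * free_partition (\<lambda>i. e i + \<delta>) N"
    unfolding free_partition_def by simp
qed

end

section \<open>The disordered pinning model\<close>

locale disordered_pinning = R: renewal_process P \<tau> + E: random_environment Q \<omega>
  for P :: "'a measure" and \<tau> :: "nat \<Rightarrow> 'a \<Rightarrow> enat"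
    and Q :: "'b measure" and \<omega> :: "nat \<Rightarrow> 'b \<Rightarrow> real" +
  fixes \<beta> c a :: real
  assumes beta: "\<beta> > 0" and c_pos: "c > 0" and a_nonneg: "a \<ge> 0"
    and gap_lower: "\<And>j. j \<ge> 1 \<Longrightarrow> c * real j powr (- a) \<le> R.gap_prob j"
begin

definition site_law :: "real measure" where "site_law = distr Q borel (\<omega> 1)"

text \<open>Coordinates of sequences are numbered from \<open>0\<close>, sites from \<open>1\<close>.\<close>

definition env :: "'b \<Rightarrow> nat \<Rightarrow> real" where "env w i = \<omega> (Suc i) w"

lemma omega_measurable: "n \<ge> 1 \<Longrightarrow> \<omega> n \<in> borel_measurable Q"
  using E.omega_indep unfolding E.indep_vars_def by auto

lemma gap_prob_pos: "j \<ge> 1 \<Longrightarrow> R.gap_prob j > 0"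
  by (rule less_le_trans[OF _ gap_lower]) (use c_pos in auto)

lemma site_integral: "f \<in> borel_measurable borel \<Longrightarrow> (\<integral>x. f x \<partial>site_law) = (\<integral>w. f (\<omega> 1 w) \<partial>Q)"
  for f :: "real \<Rightarrow> real"
  unfolding site_law_def by (rule integral_distr[OF omega_measurable]) auto

sublocale M: pinned_law R.gap_prob site_law \<beta>
proof (intro pinned_law.intro gap_law.intro iid_reals.intro iid_reals_axioms.intro pinned_law_axioms.intro)
  show "prob_space site_law" unfolding site_law_def by (rule E.prob_space_distr[OF omega_measurable]) simp
  show "integrable site_law (\<lambda>x. x\<^sup>2)"
    unfolding site_law_def using E.omega_integrable(2) by (subst integrable_distr_eq[OF omega_measurable]) auto
qed (auto intro: gap_prob_pos beta R.gap_prob_sum[simplified] simp: site_law_def)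

lemma env_measurable: "env \<in> measurable Q M.S"
  by (rule measurable_PiM_single') (auto simp: env_def[abs_def] omega_measurable site_law_def)

lemma distr_env: "distr Q M.S env = M.S"
proof -
  let ?N = "PiM {1..} (\<lambda>_::nat. borel :: real measure)" and ?N' = "PiM UNIV (\<lambda>_::nat. borel :: real measure)"
  let ?X = "\<lambda>w. \<lambda>i\<in>{1..}. \<omega> i w" and ?f = "\<lambda>v. \<lambda>i\<in>UNIV. v (Suc i)"
  have X: "?X \<in> measurable Q ?N"
    by (rule measurable_restrict) (auto intro: omega_measurable)
  have f: "?f \<in> measurable ?N ?N'"
    by (rule measurable_restrict) (auto intro: measurable_component_singleton)
  have indep: "distr Q ?N ?X = PiM {1..} (\<lambda>i. distr Q borel (\<omega> i))"
    using E.omega_indep by (subst (asm) E.indep_vars_iff_distr_eq_PiM') (auto intro: omega_measurable)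
  have "distr Q ?N' (\<lambda>w. \<lambda>i\<in>UNIV. \<omega> (Suc i) w) = distr Q ?N' (?f \<circ> ?X)"
    by (intro arg_cong[where f="distr Q ?N'"]) (auto simp: fun_eq_iff)
  also have "\<dots> = distr (distr Q ?N ?X) ?N' ?f" by (rule distr_distr[OF f X, symmetric])
  also have "\<dots> = distr (PiM {1..} (\<lambda>i. distr Q borel (\<omega> i))) (PiM UNIV (\<lambda>i. distr Q borel (\<omega> (Suc i)))) ?f"
    unfolding indep by (rule distr_cong) (auto intro!: sets_PiM_cong)
  also have "\<dots> = PiM UNIV (\<lambda>i. distr Q borel (\<omega> (Suc i)))"
  proof (rule distr_PiM_reindex)
    show "prob_space (distr Q borel (\<omega> i))" if "i \<in> {1..}" for i
      using that by (intro E.prob_space_distr omega_measurable) simp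
    show "inj_on Suc UNIV" by simp
    show "Suc \<in> UNIV \<rightarrow> {1..}" by auto
  qed
  also have "(\<lambda>i. distr Q borel (\<omega> (Suc i))) = (\<lambda>i. site_law)"
    unfolding site_law_def by (intro ext E.omega_ident) simp
  finally have "distr Q (PiM UNIV (\<lambda>_. borel)) env = M.S" by (simp add: env_def[abs_def] restrict_def)
  moreover have "distr Q M.S env = distr Q (PiM UNIV (\<lambda>_. borel)) env"
    by (rule distr_cong) (auto simp: M.sets_S)
  ultimately show ?thesis by simp
qed

lemma env_integral:
  fixes F :: "(nat \<Rightarrow> real) \<Rightarrow> real"
  assumes "F \<in> borel_measurable M.S"
  shows "(\<integral>w. F (env w) \<partial>Q) = (\<integral>v. F v \<partial>M.S)"
proof -
  have "(\<integral>v. F v \<partial>M.S) = (\<integral>v. F v \<partial>distr Q M.S env)" by (simp only: distr_env)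
  also have "\<dots> = (\<integral>w. F (env w) \<partial>Q)" by (rule integral_distr[OF env_measurable assms])
  finally show ?thesis ..
qed

definition ln_free :: "real \<Rightarrow> nat \<Rightarrow> (nat \<Rightarrow> real) \<Rightarrow> real" where
  "ln_free h N v = ln (R.free_partition (\<lambda>i. h + \<beta> * v i) N)"

definition mean_free :: "real \<Rightarrow> nat \<Rightarrow> real" where
  "mean_free h N = (\<integral>v. ln_free h N v \<partial>M.S)"

lemma ln_free_measurable: "ln_free h N \<in> borel_measurable M.S"
proof -
  have "(\<lambda>v. R.free_partition (\<lambda>i. h + \<beta> * v i) N) \<in> borel_measurable M.S"
    by (rule R.free_partition_measurable)
      (intro borel_measurable_add borel_measurable_times borel_measurable_const M.coordinate_measurable)
  then show ?thesis unfolding ln_free_def by (rule borel_measurable_ln)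
qed

lemma ln_free_integrable: "integrable M.S (ln_free h N)"
proof (rule Bochner_Integration.integrable_bound[OF M.energy_integrable])
  show "AE v in M.S. norm (ln_free h N v) \<le> norm (\<Sum>i<N. \<bar>h + \<beta> * v i\<bar>)"
  proof (rule AE_I2)
    fix v :: "nat \<Rightarrow> real"
    show "norm (ln_free h N v) \<le> norm (\<Sum>i<N. \<bar>h + \<beta> * v i\<bar>)"
      using R.ln_free_partition_abs_le[of "\<lambda>i. h + \<beta> * v i" N] unfolding ln_free_def by simp
  qed
qed (rule ln_free_measurable)

lemma ln_partition_function:
  "ln (partition_function P \<tau> \<beta> h (\<lambda>n. \<omega> n w) N) = ln_free h N (env w)"
  unfolding R.partition_function_eq ln_free_def env_def ..

definition boundary_cost :: "real \<Rightarrow> nat \<Rightarrow> real" where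
  "boundary_cost h N = ln 2 + \<bar>h\<bar> + \<beta> * (\<integral>x. \<bar>x\<bar> \<partial>site_law) - ln c + (a + 1) * ln (real N)"

text \<open>Dropping the constraint to end with a contact costs a polynomial factor and the energy of the
  last site only: a last contact \<open>n < N\<close> can be followed by one more gap, ending at \<open>N\<close>.\<close>

lemma ln_free_le:
  assumes N: "N \<ge> 1"
  shows "ln_free h N v \<le> ln 2 + M.ln_zcon h N v + \<bar>h\<bar> + \<beta> * \<bar>v (N - 1)\<bar> - ln c + (a + 1) * ln (real N)"
proof -
  define e where "e i = h + \<beta> * v i" for i
  define \<kappa> where "\<kappa> = c * real N powr (- a)"
  have \<kappa>_pos: "\<kappa> > 0" unfolding \<kappa>_def using c_pos N by simp
  have \<kappa>: "\<kappa> \<le> R.gap_prob j" if "1 \<le> j" "j \<le> N" for j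
    unfolding \<kappa>_def by (rule M.K_ge_power[OF c_pos a_nonneg gap_lower that])
  have \<kappa>_le: "\<kappa> \<le> 1" using \<kappa>[of 1] M.K_le_1[of 1] N by simp
  define D where "D = zcon R.gap_prob e N * (exp \<bar>e (N - 1)\<bar> / \<kappa>)"
  have term_le: "zcon R.gap_prob e n \<le> D" if "n \<le> N" for n
  proof (cases "n = N")
    case True
    have "\<kappa> \<le> exp \<bar>e (N - 1)\<bar>" using \<kappa>_le one_le_exp_iff[of "\<bar>e (N - 1)\<bar>"] by linarith
    then have "1 \<le> exp \<bar>e (N - 1)\<bar> / \<kappa>" using \<kappa>_pos by simp
    then have "zcon R.gap_prob e N * 1 \<le> D" unfolding D_def by (intro mult_left_mono) auto
    then show ?thesis using True by simp
  next
    case False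
    then have n: "N - n \<ge> 1" "N - n \<le> N" "n + (N - n) = N" using that by auto
    have "\<kappa> * exp (- \<bar>e (N - 1)\<bar>) \<le> R.gap_prob (N - n) * exp (e (N - 1))"
      using \<kappa>[OF n(1,2)] \<kappa>_pos by (intro mult_mono) auto
    then have "zcon R.gap_prob e n * (\<kappa> * exp (- \<bar>e (N - 1)\<bar>))
        \<le> zcon R.gap_prob e n * (R.gap_prob (N - n) * exp (e (N - 1)))"
      by (intro mult_left_mono) auto
    also have "\<dots> \<le> zcon R.gap_prob e N"
      using M.zcon_append_jump[OF n(1), of e n] unfolding n(3) .
    finally show ?thesis unfolding D_def using \<kappa>_pos by (simp add: exp_minus field_simps)
  qed
  have "R.free_partition e N \<le> (\<Sum>n\<le>N. zcon R.gap_prob e n)" by (rule R.free_partition_le_sum_zcon)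
  also have "\<dots> \<le> (\<Sum>n\<le>N. D)" by (intro sum_mono term_le) simp
  also have "\<dots> = real (Suc N) * D" by simp
  finally have "ln (R.free_partition e N) \<le> ln (real (Suc N) * D)"
    using R.free_partition_pos by (subst ln_le_cancel_iff) (auto intro: less_le_trans)
  also have "\<dots> = ln (real (Suc N)) + (ln (zcon R.gap_prob e N) + (\<bar>e (N - 1)\<bar> - ln \<kappa>))"
  proof -
    have q: "exp \<bar>e (N - 1)\<bar> / \<kappa> > 0" using \<kappa>_pos by simp
    have "D > 0" unfolding D_def by (rule mult_pos_pos[OF M.zcon_pos q])
    then have "ln (real (Suc N) * D) = ln (real (Suc N)) + ln D" by (intro ln_mult_pos) auto
    also have "ln D = ln (zcon R.gap_prob e N) + ln (exp \<bar>e (N - 1)\<bar> / \<kappa>)"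
      unfolding D_def by (rule ln_mult_pos[OF M.zcon_pos q])
    also have "ln (exp \<bar>e (N - 1)\<bar> / \<kappa>) = \<bar>e (N - 1)\<bar> - ln \<kappa>"
      using \<kappa>_pos by (simp add: ln_divide_pos)
    finally show ?thesis .
  qed
  also have "ln \<kappa> = ln c - a * ln (real N)"
    unfolding \<kappa>_def using c_pos N by (simp add: ln_mult_pos ln_powr)
  finally have "ln_free h N v \<le> ln (real (Suc N)) + (M.ln_zcon h N v + (\<bar>e (N - 1)\<bar> - (ln c - a * ln (real N))))"
    unfolding ln_free_def e_def .
  moreover have "\<bar>e (N - 1)\<bar> \<le> \<bar>h\<bar> + \<beta> * \<bar>v (N - 1)\<bar>"
    unfolding e_def using abs_triangle_ineq[of h "\<beta> * v (N - 1)"] beta by (simp add: abs_mult)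
  moreover have "ln (real (Suc N)) \<le> ln (2 * real N)" using N by (subst ln_le_cancel_iff) auto
  then have "ln (real (Suc N)) \<le> ln 2 + ln (real N)" using N by (simp add: ln_mult_pos)
  moreover have "(a + 1) * ln (real N) = a * ln (real N) + ln (real N)" by (simp add: distrib_right)
  ultimately show ?thesis by linarith
qed

lemma mean_free_bounds:
  shows "M.mean_ln h N \<le> mean_free h N"
    and "N \<ge> 1 \<Longrightarrow> mean_free h N \<le> M.mean_ln h N + boundary_cost h N"
proof -
  show "M.mean_ln h N \<le> mean_free h N"
    unfolding M.mean_ln_def mean_free_def
  proof (intro integral_mono M.ln_zcon_integrable ln_free_integrable)
    fix v :: "nat \<Rightarrow> real"
    show "M.ln_zcon h N v \<le> ln_free h N v"
      unfolding ln_free_def using R.zcon_le_free_partition M.zcon_pos R.free_partition_pos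
      by (subst ln_le_cancel_iff) auto
  qed
  assume N: "N \<ge> 1"
  define k where "k = ln 2 + \<bar>h\<bar> - ln c + (a + 1) * ln (real N)"
  have vi: "integrable M.S (\<lambda>v. \<beta> * \<bar>v (N - 1)\<bar>)"
    by (intro integrable_mult_right M.integrable_coordinate[OF integrable_abs[OF M.first_moment]])
  have "mean_free h N \<le> (\<integral>v. k + M.ln_zcon h N v + \<beta> * \<bar>v (N - 1)\<bar> \<partial>M.S)"
    unfolding mean_free_def
  proof (intro integral_mono ln_free_integrable Bochner_Integration.integrable_add M.ln_zcon_integrable vi)
    fix v :: "nat \<Rightarrow> real"
    show "ln_free h N v \<le> k + M.ln_zcon h N v + \<beta> * \<bar>v (N - 1)\<bar>"
      using ln_free_le[OF N, of h v] unfolding k_def by linarith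
  qed (rule M.P.integrable_const)
  also have "\<dots> = k + M.mean_ln h N + \<beta> * (\<integral>v. \<bar>v (N - 1)\<bar> \<partial>M.S)"
    using vi M.ln_zcon_integrable[of h N] unfolding M.mean_ln_def
    by (simp add: M.P.prob_space[simplified] M.integrable_coordinate[OF integrable_abs[OF M.first_moment]])
  also have "(\<integral>v. \<bar>v (N - 1)\<bar> \<partial>M.S) = (\<integral>x. \<bar>x\<bar> \<partial>site_law)"
    by (rule M.integral_coordinate) simp
  finally show "mean_free h N \<le> M.mean_ln h N + boundary_cost h N"
    unfolding k_def boundary_cost_def by linarith
qed

text \<open>The boundary cost is logarithmic, so the free and the constrained means have the same growth
  rate, which by superadditivity of the latter is a supremum.\<close>

lemma free_energy_limit:
  "(\<lambda>N. M.mean_ln h N / real N) \<longlonglongrightarrow> free_energy P \<tau> Q \<omega> \<beta> h"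
  "n \<ge> 1 \<Longrightarrow> M.mean_ln h n / real n \<le> free_energy P \<tau> Q \<omega> \<beta> h"
proof -
  obtain L where L: "(\<lambda>n. M.mean_ln h n / real n) \<longlonglongrightarrow> L" "\<And>n. n \<ge> 1 \<Longrightarrow> M.mean_ln h n / real n \<le> L"
    using M.mean_ln_convergent[of h] by blast
  have cost: "(\<lambda>N. boundary_cost h N / real N) \<longlonglongrightarrow> 0"
  proof -
    define k where "k = ln 2 + \<bar>h\<bar> + \<beta> * (\<integral>x. \<bar>x\<bar> \<partial>site_law) - ln c"
    have "(\<lambda>N. k / real N + (a + 1) * (ln (real N) / real N)) \<longlonglongrightarrow> 0 + (a + 1) * 0"
      by (intro tendsto_add tendsto_mult tendsto_const lim_const_over_n lim_ln_over_n)
    then show ?thesis unfolding boundary_cost_def k_def by (simp add: add_divide_distrib)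
  qed
  have "(\<lambda>N. mean_free h N / real N) \<longlonglongrightarrow> L"
  proof (rule tendsto_sandwich[OF _ _ L(1)])
    show "\<forall>\<^sub>F N in sequentially. M.mean_ln h N / real N \<le> mean_free h N / real N"
      using mean_free_bounds(1) by (auto intro!: always_eventually divide_right_mono)
    show "\<forall>\<^sub>F N in sequentially. mean_free h N / real N \<le> M.mean_ln h N / real N + boundary_cost h N / real N"
      using eventually_ge_at_top[of 1]
    proof eventually_elim
      case (elim N)
      then show ?case using mean_free_bounds(2)[of N h] by (simp add: divide_right_mono flip: add_divide_distrib)
    qed
    show "(\<lambda>N. M.mean_ln h N / real N + boundary_cost h N / real N) \<longlonglongrightarrow> L"
      using tendsto_add[OF L(1) cost] by simp
  qed
  moreover have "(1 / real N) * (\<integral>w. ln (partition_function P \<tau> \<beta> h (\<lambda>n. \<omega> n w) N) \<partial>Q) = mean_free h N / real N" for N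
    unfolding ln_partition_function env_integral[OF ln_free_measurable] mean_free_def by simp
  ultimately have "free_energy P \<tau> Q \<omega> \<beta> h = L"
    unfolding free_energy_def by (simp only: limI)
  with L show "(\<lambda>N. M.mean_ln h N / real N) \<longlonglongrightarrow> free_energy P \<tau> Q \<omega> \<beta> h"
    "n \<ge> 1 \<Longrightarrow> M.mean_ln h n / real n \<le> free_energy P \<tau> Q \<omega> \<beta> h" by auto
qed

text \<open>Below the critical point every constrained mean is non-positive, because the free energy
  is their supremum. The annealed bound shows that the infimum defining the critical point is
  over a set bounded below.\<close>

lemma mean_ln_nonpos_below_critical:
  assumes h: "h < critical_point P \<tau> Q \<omega> \<beta>"
  shows "M.mean_ln h n \<le> 0"
proof -
  define \<Lambda> where "\<Lambda> = (\<integral>w. exp (\<beta> * \<omega> 1 w) \<partial>Q)"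
  have int: "integrable Q (\<lambda>w. exp (\<beta> * \<omega> 1 w))" using E.omega_exp_moments beta by simp
  have \<Lambda>: "(\<integral>\<^sup>+x. ennreal (exp (h' + \<beta> * x)) \<partial>site_law) = ennreal (exp h' * \<Lambda>)" for h'
  proof -
    have "(\<integral>\<^sup>+x. ennreal (exp (h' + \<beta> * x)) \<partial>site_law) = (\<integral>\<^sup>+w. ennreal (exp h' * exp (\<beta> * \<omega> 1 w)) \<partial>Q)"
      unfolding site_law_def by (subst nn_integral_distr[OF omega_measurable]) (auto simp: exp_add)
    also have "\<dots> = ennreal (\<integral>w. exp h' * exp (\<beta> * \<omega> 1 w) \<partial>Q)"
      by (rule nn_integral_eq_integral) (use int in auto)
    finally show ?thesis unfolding \<Lambda>_def by simp
  qed
  have "\<Lambda> \<ge> 0" unfolding \<Lambda>_def by simp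
  have "bdd_below {h. free_energy P \<tau> Q \<omega> \<beta> h > 0}"
  proof (rule bdd_belowI)
    fix h' assume "h' \<in> {h. free_energy P \<tau> Q \<omega> \<beta> h > 0}"
    then have pos: "free_energy P \<tau> Q \<omega> \<beta> h' > 0" by simp
    show "- \<Lambda> \<le> h'"
    proof (rule ccontr)
      assume "\<not> - \<Lambda> \<le> h'"
      then have "exp h' * \<Lambda> \<le> exp (- \<Lambda>) * \<Lambda>" using \<open>\<Lambda> \<ge> 0\<close> by (intro mult_right_mono) auto
      also have "\<dots> \<le> exp (- \<Lambda>) * exp \<Lambda>"
      proof (intro mult_left_mono)
        show "\<Lambda> \<le> exp \<Lambda>" using exp_ge_add_one_self[of \<Lambda>] by linarith
      qed simp
      also have "\<dots> = 1" by (simp flip: exp_add)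
      finally have "(\<integral>\<^sup>+x. ennreal (exp (h' + \<beta> * x)) \<partial>site_law) \<le> 1" unfolding \<Lambda> by simp
      then have neg: "M.mean_ln h' N \<le> 0" for N by (rule M.mean_ln_nonpos)
      have "free_energy P \<tau> Q \<omega> \<beta> h' \<le> 0"
        by (rule LIMSEQ_le_const2[OF free_energy_limit(1)]) (use neg in \<open>auto simp: divide_nonpos_nonneg\<close>)
      with pos show False by simp
    qed
  qed
  then have "free_energy P \<tau> Q \<omega> \<beta> h \<le> 0"
    using h cInf_lower[of h "{h. free_energy P \<tau> Q \<omega> \<beta> h > 0}"] unfolding critical_point_def by force
  note f = this
  show ?thesis
  proof (cases "n = 0")
    case True
    then show ?thesis by (simp add: M.mean_ln_def)
  next
    case False
    then have "M.mean_ln h n / real n \<le> 0" using free_energy_limit(2)[of n h] f by simp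
    then show ?thesis using False by (simp add: divide_le_0_iff)
  qed
qed

text \<open>Smoothing is applied from \<open>h\<^sub>c - \<delta>\<close> to \<open>h\<^sub>c + \<delta>\<close>, since \<open>h\<^sub>c\<close> itself is not below
  the critical point.\<close>

lemma near_critical_bound:
  assumes "tiltable site_law \<beta>"
  shows "\<exists>C\<ge>0. \<exists>\<delta>\<^sub>0>0. \<forall>\<delta> n. 0 < \<delta> \<longrightarrow> \<delta> \<le> \<delta>\<^sub>0 \<longrightarrow>
    M.mean_ln (critical_point P \<tau> Q \<omega> \<beta> + \<delta>) n \<le> C * real n * \<delta>\<^sup>2"
proof -
  let ?hc = "critical_point P \<tau> Q \<omega> \<beta>"
  obtain C \<delta>0 where C: "C \<ge> 0" "\<delta>0 > 0"
    and bound: "\<And>h \<delta> n. (\<And>M. M.mean_ln h M \<le> 0) \<Longrightarrow> 0 < \<delta> \<Longrightarrow> \<delta> \<le> \<delta>0 \<Longrightarrow>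
      M.mean_ln (h + \<delta>) n \<le> C * real n * \<delta>\<^sup>2"
    using M.quadratic_smoothing[OF assms c_pos a_nonneg gap_lower] by blast
  have "M.mean_ln (?hc + \<delta>) n \<le> (4 * C) * real n * \<delta>\<^sup>2" if "0 < \<delta>" "\<delta> \<le> \<delta>0 / 2" for \<delta> n
  proof -
    have "M.mean_ln ((?hc - \<delta>) + 2 * \<delta>) n \<le> C * real n * (2 * \<delta>)\<^sup>2"
      by (rule bound) (use that mean_ln_nonpos_below_critical in auto)
    then show ?thesis by (simp add: power_mult_distrib algebra_simps)
  qed
  then show ?thesis using C by (meson half_gt_zero mult_nonneg_nonneg zero_le_numeral)
qed

lemma pinning_measure_event:
  assumes B: "B \<in> R.events"
  shows "measure (pinning_measure P \<tau> \<beta> h v N) B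
    = (\<integral>x. R.gibbs_weight (\<lambda>i. h + \<beta> * v (Suc i)) N x * indicator B x \<partial>P)
      / R.free_partition (\<lambda>i. h + \<beta> * v (Suc i)) N"
proof -
  let ?W = "R.gibbs_weight (\<lambda>i. h + \<beta> * v (Suc i)) N" and ?Z = "R.free_partition (\<lambda>i. h + \<beta> * v (Suc i)) N"
  have Z: "?Z > 0" by (rule R.free_partition_pos)
  have int: "integrable P (\<lambda>x. ?W x * indicator B x)"
    by (rule Bochner_Integration.integrable_bound[OF R.gibbs_weight_integrable])
      (use B in \<open>auto simp: indicator_def\<close>)
  have "emeasure (pinning_measure P \<tau> \<beta> h v N) B = (\<integral>\<^sup>+x. ennreal (?W x / ?Z) * indicator B x \<partial>P)"
    unfolding pinning_measure_def R.boltzmann_weight_eq R.partition_function_eq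
    using B by (intro emeasure_density) auto
  also have "\<dots> = (\<integral>\<^sup>+x. ennreal (?W x * indicator B x / ?Z) \<partial>P)"
    by (intro nn_integral_cong) (auto simp: indicator_def)
  also have "\<dots> = ennreal (\<integral>x. ?W x * indicator B x / ?Z \<partial>P)"
  proof (rule nn_integral_eq_integral)
    show "AE x in P. 0 \<le> ?W x * indicator B x / ?Z"
      using less_imp_le[OF R.gibbs_weight_pos] less_imp_le[OF Z] by (intro AE_I2) (auto simp: indicator_def)
  qed (use int in auto)
  finally have "emeasure (pinning_measure P \<tau> \<beta> h v N) B = ennreal ((\<integral>x. ?W x * indicator B x \<partial>P) / ?Z)"
    by simp
  moreover have "(\<integral>x. ?W x * indicator B x \<partial>P) / ?Z \<ge> 0"
    using less_imp_le[OF R.gibbs_weight_pos] Z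
    by (intro divide_nonneg_pos Bochner_Integration.integral_nonneg) (auto simp: indicator_def)
  ultimately show ?thesis by (simp add: measure_def)
qed

lemma ln_free_lower: "ln c - a * ln (real (Suc N)) \<le> ln_free h N v"
proof -
  have "c * real (Suc N) powr (- a) \<le> R.free_partition (\<lambda>i. h + \<beta> * v i) N"
    using gap_lower[of "Suc N"] R.free_partition_ge_gap by (auto intro: order_trans)
  then have "ln (c * real (Suc N) powr (- a)) \<le> ln_free h N v"
    unfolding ln_free_def using c_pos R.free_partition_pos by (subst ln_le_cancel_iff) auto
  moreover have "ln (c * real (Suc N) powr (- a)) = ln c - a * ln (real (Suc N))"
    using c_pos by (simp add: ln_mult_pos ln_powr del: of_nat_Suc)
  ultimately show ?thesis by simp
qed

text \<open>With \<open>\<delta> = N\<^sup>-\<^sup>1\<^sup>/\<^sup>2\<close>, having more than \<open>N\<^sup>\<gamma>\<close> contacts at \<open>h\<^sub>c\<close> has probability at most about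
  \<open>exp (- N\<^sup>\<gamma>\<^sup>-\<^sup>1\<^sup>/\<^sup>2)\<close> times the ratio of the partition functions at \<open>h\<^sub>c + \<delta>\<close> and at \<open>h\<^sub>c\<close>. The variable
  \<open>Y\<close> below bounds the logarithm of this ratio. It is non-negative with mean \<open>O(ln N)\<close>, so it
  stays below a small power of \<open>N\<close> with high probability.\<close>

theorem few_contacts_at_criticality:
  assumes tilt: "tiltable site_law \<beta>" and \<gamma>: "\<gamma> > 1 / 2"
  shows "tendsto_in_probability Q
    (\<lambda>N w. measure
       (pinning_measure P \<tau> \<beta> (critical_point P \<tau> Q \<omega> \<beta>) (\<lambda>n. \<omega> n w) N)
       {x \<in> space P. real (card (renewal_set \<tau> x \<inter> {0..N})) > real N powr \<gamma>}) 0"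
proof -
  define hc where "hc = critical_point P \<tau> Q \<omega> \<beta>"
  define B where "B N = {x \<in> space P. real (card (renewal_set \<tau> x \<inter> {0..N})) > real N powr \<gamma>}" for N
  define X where "X N w = measure (pinning_measure P \<tau> \<beta> hc (\<lambda>n. \<omega> n w) N) (B N)" for N w
  have B: "B N \<in> R.events" for N unfolding B_def by (rule R.many_contacts_le(2)[where \<delta>=0]) simp
  have X_eq: "X N w = (\<integral>x. R.gibbs_weight (\<lambda>i. hc + \<beta> * env w i) N x * indicator (B N) x \<partial>P)
      / R.free_partition (\<lambda>i. hc + \<beta> * env w i) N" for N w
    unfolding X_def pinning_measure_event[OF B] env_def ..
  have energy: "(\<lambda>w. hc + \<beta> * env w i) \<in> borel_measurable Q" for i
    unfolding env_def by (intro borel_measurable_add borel_measurable_times borel_measurable_const omega_measurable) simp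
  have X_meas: "X N \<in> borel_measurable Q" for N
    unfolding X_eq[abs_def]
    by (intro borel_measurable_divide R.integral_gibbs_weight_measurable[OF B] R.free_partition_measurable energy)
  define \<eta> where "\<eta> = (\<gamma> - 1 / 2) / 2"
  have \<eta>: "\<eta> > 0" unfolding \<eta>_def using \<gamma> by simp
  define \<delta> where "\<delta> N = real N powr (- 1 / 2)" for N :: nat
  define Y where "Y N v = ln_free (hc + \<delta> N) N v - (ln c - a * ln (real (Suc N)))" for N v
  have Y_nonneg: "Y N v \<ge> 0" for N v unfolding Y_def using ln_free_lower by simp
  have Y_int: "integrable M.S (Y N)" for N
    unfolding Y_def[abs_def] by (intro Bochner_Integration.integrable_diff ln_free_integrable M.P.integrable_const)
  have Y_meas [measurable]: "Y N \<in> borel_measurable M.S" for N using Y_int[of N] by auto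
  \<comment> \<open>At distance \<open>N\<^sup>-\<^sup>1\<^sup>/\<^sup>2\<close> above the critical point, \<open>ln Z\<close> has only logarithmic mean.\<close>
  obtain C \<delta>0 where C: "C \<ge> 0" "\<delta>0 > 0" and near: "\<And>\<delta> n. 0 < \<delta> \<Longrightarrow> \<delta> \<le> \<delta>0 \<Longrightarrow>
      M.mean_ln (hc + \<delta>) n \<le> C * real n * \<delta>\<^sup>2"
    using near_critical_bound[OF tilt] unfolding hc_def by blast
  define k where "k = C + (ln 2 + (\<bar>hc\<bar> + 1) + \<beta> * (\<integral>x. \<bar>x\<bar> \<partial>site_law) - ln c) - ln c + a * ln 2"
  have Y_mean: "(\<integral>v. Y N v \<partial>M.S) \<le> k + (2 * a + 1) * ln (real N)" if N: "N \<ge> 1" "\<delta> N \<le> \<delta>0" for N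
  proof -
    have \<delta>N: "\<delta> N > 0" "\<delta> N \<le> 1" "(\<delta> N)\<^sup>2 = 1 / real N"
    proof -
      show "\<delta> N > 0" unfolding \<delta>_def using N by simp
      have "real N powr (- 1 / 2) \<le> 1 powr (- 1 / 2)" using N by (intro powr_mono2') auto
      then show "\<delta> N \<le> 1" unfolding \<delta>_def by simp
      have "(\<delta> N)\<^sup>2 = real N powr (- 1 / 2 + - 1 / 2)" unfolding \<delta>_def power2_eq_square by (simp only: powr_add)
      then show "(\<delta> N)\<^sup>2 = 1 / real N" using N by (simp add: powr_minus_divide)
    qed
    have "M.mean_ln (hc + \<delta> N) N \<le> C * real N * (\<delta> N)\<^sup>2" by (rule near) (use \<delta>N N in auto)
    also have "\<dots> = C" using N \<delta>N by simp
    finally have 1: "M.mean_ln (hc + \<delta> N) N \<le> C" .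
    have "\<bar>hc + \<delta> N\<bar> \<le> \<bar>hc\<bar> + 1" using \<delta>N by linarith
    then have 2: "boundary_cost (hc + \<delta> N) N
        \<le> (ln 2 + (\<bar>hc\<bar> + 1) + \<beta> * (\<integral>x. \<bar>x\<bar> \<partial>site_law) - ln c) + (a + 1) * ln (real N)"
      unfolding boundary_cost_def by simp
    have "ln (real (Suc N)) \<le> ln (2 * real N)" using N by (subst ln_le_cancel_iff) auto
    then have "ln (real (Suc N)) \<le> ln 2 + ln (real N)" using N by (simp add: ln_mult_pos)
    then have 3: "a * ln (real (Suc N)) \<le> a * (ln 2 + ln (real N))" using a_nonneg by (rule mult_left_mono)
    have "(\<integral>v. Y N v \<partial>M.S) = mean_free (hc + \<delta> N) N - (ln c - a * ln (real (Suc N)))"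
      unfolding Y_def mean_free_def using ln_free_integrable
      by (simp add: M.P.prob_space[simplified] del: of_nat_Suc)
    also have "\<dots> \<le> C + boundary_cost (hc + \<delta> N) N - (ln c - a * ln (real (Suc N)))"
      using mean_free_bounds(2)[OF N(1), of "hc + \<delta> N"] 1 by linarith
    also have "\<dots> \<le> k + (2 * a + 1) * ln (real N)"
      using 2 3 unfolding k_def by (simp add: algebra_simps)
    finally show ?thesis .
  qed
  have markov: "measure M.S {v. real N powr \<eta> \<le> Y N v} \<le> (k + (2 * a + 1) * ln (real N)) / real N powr \<eta>"
    if N: "N \<ge> 1" "\<delta> N \<le> \<delta>0" for N
  proof -
    have "measure M.S {v \<in> space M.S. real N powr \<eta> \<le> Y N v} \<le> (\<integral>v. Y N v \<partial>M.S) / real N powr \<eta>"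
      by (rule integral_Markov_inequality_measure[where A="{}"]) (use Y_int Y_nonneg N in auto)
    also have "\<dots> \<le> (k + (2 * a + 1) * ln (real N)) / real N powr \<eta>"
      using Y_mean[OF N] by (intro divide_right_mono) auto
    finally show ?thesis by simp
  qed
  \<comment> \<open>Here \<open>\<delta> N * N\<^sup>\<gamma>\<close> is the square of \<open>x = N\<^sup>\<eta>\<close>, and \<open>1 + x - x\<^sup>2 \<le> 2 - x\<close>.\<close>
  have X_small: "X N w \<le> exp (2 - real N powr \<eta>)" if N: "N \<ge> 1" and Yw: "Y N (env w) < real N powr \<eta>" for N w
  proof -
    let ?Z = "\<lambda>h. R.free_partition (\<lambda>i. h + \<beta> * env w i) N"
    have \<delta>N: "0 \<le> \<delta> N" "\<delta> N \<le> 1"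
    proof -
      show "\<delta> N \<ge> 0" unfolding \<delta>_def by simp
      have "real N powr (- 1 / 2) \<le> 1 powr (- 1 / 2)" using N by (intro powr_mono2') auto
      then show "\<delta> N \<le> 1" unfolding \<delta>_def by simp
    qed
    have expo: "\<delta> N * real N powr \<gamma> = (real N powr \<eta>)\<^sup>2"
      unfolding \<delta>_def \<eta>_def power2_eq_square by (simp flip: powr_add)
    have "X N w \<le> exp (- \<delta> N * (real N powr \<gamma> - 1)) * R.free_partition (\<lambda>i. (hc + \<beta> * env w i) + \<delta> N) N / ?Z hc"
      unfolding X_eq B_def using R.free_partition_pos
      by (intro divide_right_mono R.many_contacts_le(1) \<delta>N) (auto intro: less_imp_le)
    also have "R.free_partition (\<lambda>i. (hc + \<beta> * env w i) + \<delta> N) N = ?Z (hc + \<delta> N)"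
      by (simp add: algebra_simps)
    also have "exp (- \<delta> N * (real N powr \<gamma> - 1)) * ?Z (hc + \<delta> N) / ?Z hc
        = exp (- \<delta> N * (real N powr \<gamma> - 1) + ln_free (hc + \<delta> N) N (env w) - ln_free hc N (env w))"
      unfolding ln_free_def exp_add exp_diff using R.free_partition_pos by simp
    also have "\<dots> \<le> exp (2 - real N powr \<eta>)"
    proof -
      have "ln_free (hc + \<delta> N) N (env w) - ln_free hc N (env w) \<le> Y N (env w)"
        unfolding Y_def using ln_free_lower[of N hc "env w"] by linarith
      moreover have "- \<delta> N * (real N powr \<gamma> - 1) = \<delta> N - (real N powr \<eta>)\<^sup>2"
        using expo by (simp add: algebra_simps)
      moreover have "2 * real N powr \<eta> \<le> (real N powr \<eta>)\<^sup>2 + 1"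
        using zero_le_power2[of "real N powr \<eta> - 1"] by (simp add: power2_diff)
      ultimately have "- \<delta> N * (real N powr \<gamma> - 1) + ln_free (hc + \<delta> N) N (env w) - ln_free hc N (env w)
          \<le> 2 - real N powr \<eta>"
        using \<delta>N Yw by linarith
      then show ?thesis by simp
    qed
    finally show ?thesis .
  qed
  have power_top: "filterlim (\<lambda>N. real N powr \<eta>) at_top sequentially"
  proof -
    have "(\<lambda>N. real N powr (- \<eta>)) \<longlonglongrightarrow> 0"
      by (rule tendsto_neg_powr[OF _ filterlim_real_sequentially]) (use \<eta> in simp)
    moreover have "\<forall>\<^sub>F N in sequentially. 0 < real N powr (- \<eta>)"
      using eventually_ge_at_top[of 1] by eventually_elim simp
    ultimately have "filterlim (\<lambda>N. inverse (real N powr (- \<eta>))) at_top sequentially"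
      by (rule filterlim_inverse_at_top)
    then show ?thesis by (simp add: powr_minus)
  qed
  have \<delta>_lim: "eventually (\<lambda>N. \<delta> N < \<delta>0) sequentially"
  proof (rule order_tendstoD)
    show "\<delta> \<longlonglongrightarrow> 0" unfolding \<delta>_def[abs_def]
      by (rule tendsto_neg_powr[OF _ filterlim_real_sequentially]) simp
  qed (use C in simp)
  have rate: "(\<lambda>N. (k + (2 * a + 1) * ln (real N)) / real N powr \<eta>) \<longlonglongrightarrow> 0"
  proof -
    have "(\<lambda>N. k * inverse (real N powr \<eta>) + (2 * a + 1) * (ln (real N) / real N powr \<eta>)) \<longlonglongrightarrow> k * 0 + (2 * a + 1) * 0"
      by (intro tendsto_add tendsto_mult tendsto_const lim_ln_over_power[OF \<eta>] tendsto_inverse_0_at_top[OF power_top])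
    then show ?thesis by (simp add: add_divide_distrib divide_inverse[of k])
  qed
  have "(\<lambda>N. measure Q {w \<in> space Q. \<bar>X N w - 0\<bar> > \<epsilon>}) \<longlonglongrightarrow> 0" if \<epsilon>: "\<epsilon> > 0" for \<epsilon>
  proof (rule tendsto_sandwich[OF _ _ tendsto_const rate])
    have "eventually (\<lambda>N. 2 - ln \<epsilon> < real N powr \<eta>) sequentially"
      using power_top by (simp add: filterlim_at_top_dense)
    with eventually_ge_at_top[of 1] \<delta>_lim
    show "eventually (\<lambda>N. measure Q {w \<in> space Q. \<bar>X N w - 0\<bar> > \<epsilon>}
        \<le> (k + (2 * a + 1) * ln (real N)) / real N powr \<eta>) sequentially"
    proof eventually_elim
      case (elim N)
      let ?A = "{v. real N powr \<eta> \<le> Y N v}"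
      have A: "?A \<in> sets M.S"
      proof -
        have "Measurable.pred M.S (\<lambda>v. real N powr \<eta> \<le> Y N v)" by measurable
        then show ?thesis by (rule M.Collect_sets)
      qed
      have "{w \<in> space Q. \<bar>X N w - 0\<bar> > \<epsilon>} \<subseteq> env -` ?A \<inter> space Q"
      proof
        fix w assume w: "w \<in> {w \<in> space Q. \<bar>X N w - 0\<bar> > \<epsilon>}"
        have "X N w \<ge> 0" unfolding X_def by simp
        then have X: "X N w > \<epsilon>" using w by simp
        have "exp (2 - real N powr \<eta>) \<le> exp (ln \<epsilon>)" using elim by simp
        then have "\<not> X N w \<le> exp (2 - real N powr \<eta>)" using X \<epsilon> by simp
        then have "\<not> Y N (env w) < real N powr \<eta>" using X_small[of N w] elim by blast
        then show "w \<in> env -` ?A \<inter> space Q" using w by simp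
      qed
      then have "measure Q {w \<in> space Q. \<bar>X N w - 0\<bar> > \<epsilon>} \<le> measure Q (env -` ?A \<inter> space Q)"
        by (rule E.finite_measure_mono) (rule measurable_sets[OF env_measurable A])
      also have "\<dots> = measure (distr Q M.S env) ?A"
        by (rule measure_distr[OF env_measurable A, symmetric])
      also have "\<dots> = measure M.S ?A" by (simp only: distr_env)
      also have "\<dots> \<le> (k + (2 * a + 1) * ln (real N)) / real N powr \<eta>"
        by (rule markov) (use elim in auto)
      finally show ?case .
    qed
  qed simp
  with X_meas have "tendsto_in_probability Q X 0" unfolding tendsto_in_probability_def by blast
  then show ?thesis unfolding X_def[abs_def] B_def hc_def .
qed

end

theorem corollary1p4:
  fixes P :: "'a measure" and \<tau> :: "nat \<Rightarrow> 'a \<Rightarrow> enat"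
    and Q :: "'b measure" and \<omega> :: "nat \<Rightarrow> 'b \<Rightarrow> real"
    and L :: "real \<Rightarrow> real" and \<alpha> \<beta> \<gamma> :: real
  assumes "renewal_process P \<tau>"
    and "\<alpha> > 0" and "slowly_varying L" and "has_regular_tail P \<tau> L \<alpha>"
    and "random_environment Q \<omega>"
    and "bounded (law_support (distr Q borel (\<omega> 1))) \<or> smooth_density_condition Q (\<omega> 1)"
    and "\<gamma> > 1 / 2" and "\<beta> > 0"
  shows "tendsto_in_probability Q
    (\<lambda>N w. measure
       (pinning_measure P \<tau> \<beta> (critical_point P \<tau> Q \<omega> \<beta>) (\<lambda>n. \<omega> n w) N)
       {x \<in> space P. real (card (renewal_set \<tau> x \<inter> {0..N})) > real N powr \<gamma>}) 0"
proof -
  interpret R: renewal_process P \<tau> by fact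
  interpret E: random_environment Q \<omega> by fact
  obtain c where c: "c > 0" "\<And>n. n \<ge> 1 \<Longrightarrow> c * real n powr (- 2) \<le> L (real n)"
    using slowly_varying_lower_bound[OF assms(3)] by blast
  have gap: "c * real j powr (- (3 + \<alpha>)) \<le> R.gap_prob j" if j: "j \<ge> 1" for j
  proof -
    have "c * real j powr (- (3 + \<alpha>)) = c * real j powr (- 2) * real j powr (- (1 + \<alpha>))"
      using j by (simp add: mult.assoc flip: powr_add)
    also have "\<dots> \<le> L (real j) * real j powr (- (1 + \<alpha>))" by (intro mult_right_mono c(2) j) simp
    also have "\<dots> = R.gap_prob j"
      using assms(4) j unfolding has_regular_tail_def R.gap_prob_def powr_minus_divide by simp
    finally show ?thesis .
  qed
  interpret D: disordered_pinning P \<tau> Q \<omega> \<beta> c "3 + \<alpha>"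
    by unfold_locales (use assms c(1) gap in auto)
  have "tiltable D.site_law \<beta>"
    using assms(6)
  proof
    assume "bounded (law_support (distr Q borel (\<omega> 1)))"
    then obtain M where M: "M \<ge> 1" "AE x in D.site_law. \<bar>x\<bar> \<le> M"
      using bounded_law_support_AE[of D.site_law] D.M.sets_law unfolding D.site_law_def by blast
    show ?thesis
    proof (rule tiltable_of_bounded[OF D.M.prob_space_law D.M.sets_law M])
      show "(\<integral>x. x \<partial>D.site_law) = 0" using E.omega_mean by (subst D.site_integral) auto
      show "(\<integral>x. x\<^sup>2 \<partial>D.site_law) = 1"
        using E.omega_variance E.omega_mean by (subst D.site_integral) auto
    qed fact
  next
    assume "smooth_density_condition Q (\<omega> 1)"
    then show ?thesis
      unfolding D.site_law_def
      by (rule tiltable_of_smooth_density[OF E.prob_space_axioms _ D.M.square_integrable[unfolded D.site_law_def]])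
  qed
  then show ?thesis using \<open>\<gamma> > 1 / 2\<close> by (rule D.few_contacts_at_criticality)
qed

end
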